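(* Let $\mathcal P\subset\mathbb{R}^d$ be a rational polytope with denominator $p$, and $\lambda$ an integral form that is generic and positive with respect to $\mathcal P$. Then for any $0\le r<p$ and any integer $k>0$, \[ (-1)^{\dim\mathcal P}\,\chi_{\mathcal P}^{\lambda,r}\!\left(\tfrac1q,\,[-k]_{\frac1q}\right)=\operatorname{ehr}_{\mathcal P^\circ}^\lambda(q,kp-r), \] where $\chi_{\mathcal P}^{\lambda,r}(\tfrac1q,\cdot)$ means substituting $1/q$ for $q$ in the coefficients.
   Context: A rational polytope is the convex hull of finitely many points of $\mathbb{Q}^d$; its denominator is the smallest positive integer $p$ such that $p\mathcal P$ has all vertices in $\mathbb{Z}^d$. $\mathcal P^\circ$ denotes the relative interior of $\mathcal P$. Two vertices are adjacent if they form an edge. An integral form is $\lambda(\mathbf m)=\lambda_1m_1+\dots+\lambda_dm_d$ with $\lambda_j\in\mathbb{Z}$; it is generic and positive w.r.t. $\mathcal P$ if $\lambda(\mathbf v)\ne\lambda(\mathbf w)$ for adjacent vertices and $\lambda(\mathbf v)\ge0$ for all vertices. $[k]_q=\frac{q^k-1}{q-1}$ (for any integer $k$, and with $q$ replaced by $1/q$ in $[\,\cdot\,]_{1/q}$). For a set $S$, $\operatorname{ehr}_{S}^\lambda(q,t)=\sum_{\mathbf m\in tS\cap\mathbb{Z}^d}q^{\lambda(\mathbf m)}$. For $0\le r<p$, $\chi_{\mathcal P}^{\lambda,r}(q,x)\in\mathbb{Q}(q)[x]$ is the (unique) polynomial with $\chi_{\mathcal P}^{\lambda,r}(q,[k]_q)=\operatorname{ehr}_{\mathcal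 P}^\lambda(q,kp+r)$ for all integers $k\ge0$. *)

theory Defs
  imports
    "HOL-Analysis.Analysis"
    "HOL-Computational_Algebra.Computational_Algebra"
    "HOL-Computational_Algebra.Field_as_Ring"
begin

section \<open>The field of rational functions in q\<close>

type_synonym ratfun = "rat poly fract"

definition const :: "rat \<Rightarrow> ratfun" where
  "const c = Fract [:c:] 1"

definition qvar :: ratfun where
  "qvar = Fract [:0, 1:] 1"

definition eval_inv_q :: "rat poly \<Rightarrow> ratfun" where
  "eval_inv_q a = poly (map_poly const a) (1 / qvar)"

text \<open>The substitution \<open>f(q) \<mapsto> f(1/q)\<close>. It is computed on the reduced representation of \<open>f\<close>;
  the lemma \<open>subst_inv_q_Fract\<close> below shows that any representation gives the same value.\<close>

definition subst_inv_q :: "ratfun \<Rightarrow> ratfun" where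
  "subst_inv_q f = eval_inv_q (fst (quot_of_fract f)) / eval_inv_q (snd (quot_of_fract f))"

text \<open>The q-integer \<open>[k]\<^sub>z\<close>, with \<open>k\<close> possibly negative.\<close>

definition qint :: "'a::field \<Rightarrow> int \<Rightarrow> 'a" where
  "qint z k = (z powi k - 1) / (z - 1)"

section \<open>Rational polytopes and integral forms\<close>

definition of_int_vec :: "int ^ 'n \<Rightarrow> real ^ 'n" where
  "of_int_vec m = (\<chi> i. real_of_int (m $ i))"

definition rational_polytope :: "(real ^ 'n) set \<Rightarrow> bool" where
  "rational_polytope P \<longleftrightarrow>
     (\<exists>V. finite V \<and> (\<forall>v\<in>V. \<forall>i. v $ i \<in> \<rat>) \<and> P = convex hull V)"

definition denominator :: "(real ^ 'n) set \<Rightarrow> nat" where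
  "denominator P =
     (LEAST p. p > 0 \<and>
        (\<forall>v. v extreme_point_of ((*\<^sub>R) (real p) ` P) \<longrightarrow> v \<in> range of_int_vec))"

definition adjacent_vertices :: "'a::euclidean_space set \<Rightarrow> 'a \<Rightarrow> 'a \<Rightarrow> bool" where
  "adjacent_vertices P v w \<longleftrightarrow>
     v extreme_point_of P \<and> w extreme_point_of P \<and> closed_segment v w edge_of P"

text \<open>The form with coefficient vector \<open>l\<close>, applied both to real and to integer vectors.\<close>

definition lin_form :: "int ^ 'n \<Rightarrow> 'a::ring_1 ^ 'n \<Rightarrow> 'a" where
  "lin_form l x = (\<Sum>i\<in>UNIV. of_int (l $ i) * x $ i)"

definition generic_form :: "int ^ 'n \<Rightarrow> (real ^ 'n) set \<Rightarrow> bool" where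
  "generic_form l P \<longleftrightarrow> (\<forall>v w. adjacent_vertices P v w \<longrightarrow> lin_form l v \<noteq> lin_form l w)"

definition positive_form :: "int ^ 'n \<Rightarrow> (real ^ 'n) set \<Rightarrow> bool" where
  "positive_form l P \<longleftrightarrow> (\<forall>v. v extreme_point_of P \<longrightarrow> lin_form l v \<ge> 0)"

section \<open>Weighted Ehrhart functions\<close>

text \<open>For bounded \<open>S\<close> the index set is finite. For \<open>t = 0\<close> the dilate of a nonempty \<open>S\<close>
  is \<open>{0}\<close>.\<close>

definition ehr :: "(real ^ 'n) set \<Rightarrow> int ^ 'n \<Rightarrow> int \<Rightarrow> ratfun" where
  "ehr S l t = (\<Sum>m | of_int_vec m \<in> (*\<^sub>R) (of_int t) ` S. qvar powi lin_form l m)"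

definition ehrhart_poly :: "(real ^ 'n) set \<Rightarrow> int ^ 'n \<Rightarrow> nat \<Rightarrow> ratfun poly" where
  "ehrhart_poly P l r =
     (THE c. \<forall>k::nat. poly c (qint qvar (int k)) = ehr P l (int (k * denominator P + r)))"

section \<open>Well-definedness of the substitution and uniqueness of the polynomial\<close>

lemma const_0 [simp]: "const 0 = 0"
  by (simp add: const_def fract_collapse)

lemma qvar_power: "qvar ^ n = Fract (monom 1 n) 1"
  by (induction n) (simp_all add: qvar_def One_fract_def monom_0 monom_Suc one_pCons)

lemma qvar_nz: "qvar \<noteq> 0"
  by (simp add: qvar_def Zero_fract_def eq_fract)

lemma Fract_add_1: "Fract (a + b) 1 = Fract a 1 + Fract b (1 :: 'a :: idom)"
  by simp

lemma Fract_sum: "Fract (\<Sum>i\<in>A. f i) 1 = (\<Sum>i\<in>A. Fract (f i) (1 :: 'a :: idom))"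
  by (induction A rule: infinite_finite_induct)
     (simp_all add: fract_collapse Fract_add_1 del: add_fract)

lemma eval_inv_q_altdef:
  "eval_inv_q a * qvar ^ degree a = Fract (\<Sum>i\<le>degree a. monom (coeff a i) (degree a - i)) 1"
proof -
  have "eval_inv_q a = (\<Sum>i\<le>degree a. const (coeff a i) * (1 / qvar) ^ i)"
  proof -
    have "degree (map_poly const a) = degree a"
      by (intro degree_map_poly) (simp add: const_def Zero_fract_def eq_fract)
    then show ?thesis
      by (simp add: eval_inv_q_def poly_altdef coeff_map_poly)
  qed
  then have "eval_inv_q a * qvar ^ degree a
      = (\<Sum>i\<le>degree a. const (coeff a i) * ((1 / qvar) ^ i * qvar ^ degree a))"
    by (simp add: sum_distrib_right mult.assoc)
  also have "\<dots> = (\<Sum>i\<le>degree a. const (coeff a i) * qvar ^ (degree a - i))"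
    by (intro sum.cong refl) (simp add: power_diff qvar_nz power_one_over)
  also have "\<dots> = (\<Sum>i\<le>degree a. Fract (monom (coeff a i) (degree a - i)) 1)"
    by (simp add: qvar_power const_def smult_monom)
  finally show ?thesis by (simp add: Fract_sum)
qed

lemma eval_inv_q_nz:
  assumes "a \<noteq> 0"
  shows "eval_inv_q a \<noteq> 0"
proof
  assume "eval_inv_q a = 0"
  then have "(\<Sum>i\<le>degree a. monom (coeff a i) (degree a - i)) = 0"
    using eval_inv_q_altdef[of a] by simp (simp add: Zero_fract_def eq_fract)
  then have "coeff (\<Sum>i\<le>degree a. monom (coeff a i) (degree a - i)) 0 = 0"
    by simp
  moreover have "coeff (\<Sum>i\<le>degree a. monom (coeff a i) (degree a - i)) 0
      = (\<Sum>i\<le>degree a. if i = degree a then coeff a i else 0)"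
    unfolding coeff_sum by (intro sum.cong) auto
  ultimately show False
    using assms by simp
qed

lemma eval_inv_q_mult: "eval_inv_q (a * b) = eval_inv_q a * eval_inv_q b"
proof -
  have "map_poly const (a * b) = map_poly const a * map_poly const b"
  proof (rule poly_eqI)
    fix n
    have const_mult: "const (x * y) = const x * const y" for x y
      by (simp add: const_def mult.commute)
    have const_add: "const (x + y) = const x + const y" for x y
      by (simp add: const_def flip: Fract_add_1)
    have const_sum: "const (\<Sum>i\<in>A. f i) = (\<Sum>i\<in>A. const (f i))" for f and A :: "nat set"
      by (induction A rule: infinite_finite_induct) (simp_all add: const_add)
    show "coeff (map_poly const (a * b)) n = coeff (map_poly const a * map_poly const b) n"
      by (simp add: coeff_map_poly coeff_mult const_sum const_mult)
  qed
  then show ?thesis by (simp add: eval_inv_q_def)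
qed

lemma subst_inv_q_Fract:
  assumes "b \<noteq> 0"
  shows "subst_inv_q (Fract a b) = eval_inv_q a / eval_inv_q b"
proof -
  define c d where "c = fst (quot_of_fract (Fract a b))" and "d = snd (quot_of_fract (Fract a b))"
  have d: "d \<noteq> 0" by (simp add: d_def)
  have "Fract c d = Fract a b" by (simp add: c_def d_def)
  then have "c * b = a * d" using assms d by (simp add: eq_fract)
  then have "eval_inv_q c * eval_inv_q b = eval_inv_q a * eval_inv_q d"
    by (metis eval_inv_q_mult)
  then show ?thesis
    using eval_inv_q_nz[OF assms] eval_inv_q_nz[OF d]
    by (simp add: subst_inv_q_def flip: c_def d_def) (simp add: field_simps)
qed

lemma qint_qvar_inj:
  assumes "qint qvar (int j) = qint qvar (int k)"
  shows "j = k"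
proof -
  have "qvar \<noteq> 1"
    by (simp add: qvar_def One_fract_def eq_fract one_pCons)
  then have "qvar ^ j = qvar ^ k"
    using assms by (simp add: qint_def)
  then show ?thesis
    by (simp add: qvar_power eq_fract monom_eq_iff')
qed

lemma ehrhart_poly_unique:
  assumes "\<forall>k::nat. poly c (qint qvar (int k)) = f k"
    and "\<forall>k::nat. poly d (qint qvar (int k)) = f k"
  shows "c = d"
proof (rule ccontr)
  assume "c \<noteq> d"
  then have "finite {x. poly (c - d) x = 0}"
    by (intro poly_roots_finite) simp
  moreover have "range (\<lambda>k::nat. qint qvar (int k)) \<subseteq> {x. poly (c - d) x = 0}"
    using assms by auto
  moreover have "infinite (range (\<lambda>k::nat. qint qvar (int k)))"
    by (intro range_inj_infinite injI qint_qvar_inj)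
  ultimately show False using finite_subset by blast
qed

lemma ehrhart_poly_eqI:
  assumes "\<And>k::nat. poly c (qint qvar (int k)) = ehr P l (int (k * denominator P + r))"
  shows "ehrhart_poly P l r = c"
  unfolding ehrhart_poly_def
proof (rule the_equality)
  show "d = c" if "\<forall>k::nat. poly d (qint qvar (int k)) = ehr P l (int (k * denominator P + r))" for d
    using that by (rule ehrhart_poly_unique) (simp add: assms)
qed (simp add: assms)

end

theory Submission
  imports Defs
begin

text \<open>For a vertex \<open>v\<close> let \<open>K\<^sub>v\<close> be the cone generated by \<open>P - v\<close>. Modulo functions on the lattice that
  are killed by products of operators \<open>1 - x\<^sup>u\<close>, \<open>u \<noteq> 0\<close>, the indicator of \<open>t P\<close> equals the sum of the
  indicators of the shifted cones \<open>t v + K\<^sub>v\<close> (Brion). As \<open>K\<^sub>v\<close> is generated by edge directions, on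
  which \<open>\<lambda>\<close> does not vanish, the indicator of \<open>r v + K\<^sub>v\<close> has a well-defined value \<open>c\<^sub>v\<close> in the field
  of rational functions, and \<open>t = k p + r\<close> gives \<open>\<Sum>\<^sub>v q\<^bsup>k \<lambda>(p v)\<^esup> c\<^sub>v\<close> for the Ehrhart function, i.e.
  \<open>\<chi>(q, x) = \<Sum>\<^sub>v (1 + (q - 1) x)\<^bsup>\<lambda>(p v)\<^esup> c\<^sub>v\<close>. The theorem then follows from reciprocity for the cones
  \<open>K\<^sub>v\<close> and from Brion's formula for the relative interior.

  Both facts reduce to simplicial cones by a signed decomposition with prescribed generators:
  pushing a point into a cone along a generic direction \<open>\<xi>\<close> of the cone gives half-open pieces that
  add up to the closed cone, and pushing along \<open>- \<xi>\<close> gives the complementary half-open pieces, which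
  add up to the relative interior.\<close>

section \<open>Cones and coordinates\<close>

text \<open>Genericity controls \<lambda> on edge directions only. Any further ray introduced by a
  triangulation could have \<lambda> = 0 and produce a denominator 1 - q^0. This is why the pieces
  may use given generators only, and why two notions stand side by side: \<open>has_value\<close>
  divides by 1 - x^u only if \<lambda>(u) is nonzero, whereas \<open>torsion\<close> admits every
  nonzero u, as the error terms in Brion's formula require. The two are compatible because a torsion
  function of finite support is zero, so any value of a torsion function is 0. A single direction
  \<xi> serves the cone over P and, after projection, every vertex cone, so that one test, "y -
  \<delta> \<xi> lies in the cone for some \<delta> > 0", describes all the open cones involved. The
  values c_v depend on r only: the dilation factor k p moves the cone by the lattice vector k p v.
  For t = k p - r the cone left over is shifted by - r v, and reciprocity relates its open version
  to the closed cone shifted by r v; so the same c_v govern both sides. Positivity makes \<lambda>(p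
  v) a natural number, hence a legitimate exponent of a polynomial in x, and 1 + (q - 1) x equals
  q^j at [j]_q for negative j too.\<close>

lemma convex_cone_hull_finite:
  assumes "finite U"
  shows "convex_cone hull U = {x. \<exists>c. (\<forall>u\<in>U. 0 \<le> c u) \<and> x = (\<Sum>u\<in>U. c u *\<^sub>R u)}"
    (is "_ = ?K")
proof
  show "convex_cone hull U \<subseteq> ?K"
  proof (rule hull_minimal)
    show "U \<subseteq> ?K"
    proof
      fix u assume "u \<in> U"
      then have "(\<Sum>v\<in>U. (if v = u then 1 else 0) *\<^sub>R v) = u"
        using assms by (simp add: if_distrib[of "\<lambda>t. t *\<^sub>R _"] cong: if_cong)
      then show "u \<in> ?K"
        by (intro CollectI exI[of _ "\<lambda>v. if v = u then 1 else 0"]) auto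
    qed
    show "convex_cone ?K"
      unfolding convex_cone_iff
    proof (intro conjI ballI allI impI)
      show "0 \<in> ?K" by (auto intro!: exI[of _ "\<lambda>_. 0"])
    next
      fix x y assume "x \<in> ?K" "y \<in> ?K"
      then obtain c d where "\<forall>u\<in>U. 0 \<le> c u" "x = (\<Sum>u\<in>U. c u *\<^sub>R u)"
        "\<forall>u\<in>U. 0 \<le> d u" "y = (\<Sum>u\<in>U. d u *\<^sub>R u)" by blast
      then show "x + y \<in> ?K"
        by (auto intro!: exI[of _ "\<lambda>u. c u + d u"] simp: scaleR_left_distrib sum.distrib)
    next
      fix x and t :: real assume "x \<in> ?K" "0 \<le> t"
      then obtain c where "\<forall>u\<in>U. 0 \<le> c u" "x = (\<Sum>u\<in>U. c u *\<^sub>R u)" by blast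
      with \<open>0 \<le> t\<close> show "t *\<^sub>R x \<in> ?K"
        by (auto intro!: exI[of _ "\<lambda>u. t * c u"] simp: scaleR_sum_right)
    qed
  qed
  show "?K \<subseteq> convex_cone hull U"
  proof
    fix x assume "x \<in> ?K"
    then obtain c where c: "\<forall>u\<in>U. 0 \<le> c u" and x: "x = (\<Sum>u\<in>U. c u *\<^sub>R u)" by blast
    have "(\<Sum>u\<in>V. c u *\<^sub>R u) \<in> convex_cone hull U" if "V \<subseteq> U" for V
      using finite_subset[OF that assms] that
    proof (induction V rule: finite_induct)
      case empty
      then show ?case by (simp add: convex_cone_hull_contains_0)
    next
      case (insert u V)
      then show ?case using c
        by (simp add: convex_cone_hull_add convex_cone_hull_mul hull_inc)
    qed
    then show "x \<in> convex_cone hull U" unfolding x by blast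
  qed
qed

lemma convex_cone_hull_subset_span: "convex_cone hull U \<subseteq> span U"
  by (rule hull_minimal) (auto simp: convex_cone_span intro: span_base)

lemma linear_convex_cone_hull_nonneg:
  fixes h :: "'a::real_vector \<Rightarrow> real"
  assumes "linear h" "\<And>u. u \<in> U \<Longrightarrow> 0 \<le> h u" "x \<in> convex_cone hull U"
  shows "0 \<le> h x"
proof -
  have "convex_cone {x. 0 \<le> h x}"
    using assms(1) by (auto simp: convex_cone_iff linear_add linear_scale linear_0)
  then have "convex_cone hull U \<subseteq> {x. 0 \<le> h x}"
    using assms(2) by (intro hull_minimal) auto
  with assms(3) show ?thesis by auto
qed

text \<open>A linear functional on the whole space; it computes coordinates only on \<open>span B\<close>.\<close>

definition coord :: "'a::real_vector set \<Rightarrow> 'a \<Rightarrow> 'a \<Rightarrow> real" where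
  "coord B b = (SOME f. linear f \<and> (\<forall>b'\<in>B. f b' = of_bool (b' = b)))"

lemma
  assumes "independent B"
  shows linear_coord: "linear (coord B b)"
    and coord_base: "b' \<in> B \<Longrightarrow> coord B b b' = of_bool (b' = b)"
proof -
  have "\<exists>f. linear f \<and> (\<forall>b'\<in>B. f b' = (of_bool (b' = b) :: real))"
    using linear_independent_extend[OF assms, of "\<lambda>b'. of_bool (b' = b)"] by auto
  from someI_ex[OF this]
  show "linear (coord B b)" "b' \<in> B \<Longrightarrow> coord B b b' = of_bool (b' = b)"
    by (auto simp: coord_def)
qed

lemma coord_sum:
  assumes "independent B" "finite B" "b \<in> B"
  shows "coord B b (\<Sum>b'\<in>B. c b' *\<^sub>R b') = c b"
proof -
  interpret linear "coord B b" using assms(1) by (rule linear_coord)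
  have "coord B b (\<Sum>b'\<in>B. c b' *\<^sub>R b') = (\<Sum>b'\<in>B. c b' * of_bool (b' = b))"
    using assms(1) by (simp add: sum scale coord_base)
  also have "\<dots> = c b" using assms(2,3) by (simp add: of_bool_def if_distrib cong: if_cong)
  finally show ?thesis .
qed

lemma sum_coord:
  assumes "independent B" "finite B" "x \<in> span B"
  shows "(\<Sum>b\<in>B. coord B b x *\<^sub>R b) = x"
proof -
  obtain c where "x = (\<Sum>b\<in>B. c b *\<^sub>R b)" using assms(3) span_finite[OF assms(2)] by auto
  with assms(1,2) show ?thesis by (simp add: coord_sum)
qed

lemma convex_cone_hull_independent:
  assumes "independent B" "finite B"
  shows "x \<in> convex_cone hull B \<longleftrightarrow> x \<in> span B \<and> (\<forall>b\<in>B. 0 \<le> coord B b x)"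
proof
  assume x: "x \<in> convex_cone hull B"
  then obtain c where "\<forall>b\<in>B. 0 \<le> c b" "x = (\<Sum>b\<in>B. c b *\<^sub>R b)"
    unfolding convex_cone_hull_finite[OF assms(2)] by blast
  then show "x \<in> span B \<and> (\<forall>b\<in>B. 0 \<le> coord B b x)"
    using x convex_cone_hull_subset_span assms by (auto simp: coord_sum)
next
  assume "x \<in> span B \<and> (\<forall>b\<in>B. 0 \<le> coord B b x)"
  then show "x \<in> convex_cone hull B"
    unfolding convex_cone_hull_finite[OF assms(2)]
    using sum_coord[OF assms, of x] by (auto intro!: exI[of _ "\<lambda>b. coord B b x"])
qed

text \<open>Only generators from \<open>U\<close> itself are allowed, so a form that is nonzero on
  every element of \<open>U\<close> stays nonzero on the generators of every simplicial
  piece.\<close>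

definition bases :: "'a::real_vector set \<Rightarrow> 'a set set" where
  "bases U = {B. B \<subseteq> U \<and> independent B \<and> span B = span U}"

lemma basesD:
  assumes "B \<in> bases U"
  shows "B \<subseteq> U" "independent B" "span B = span U"
  using assms by (auto simp: bases_def)

lemma finite_bases: "finite U \<Longrightarrow> finite (bases U)"
  by (rule finite_subset[of _ "Pow U"]) (auto simp: bases_def)

lemma finite_basis: "finite U \<Longrightarrow> B \<in> bases U \<Longrightarrow> finite B"
  using basesD(1) finite_subset by blast

text \<open>The points \<open>y\<close> with \<open>y + \<delta> \<xi>\<close> in the cone of \<open>B\<close> for all small \<open>\<delta> > 0\<close>. It is half-open:
  the facet opposite to \<open>b\<close> is excluded iff the \<open>b\<close>-coordinate of \<open>\<xi>\<close> is negative.\<close>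

definition half_open_cone :: "'a::real_vector set \<Rightarrow> 'a \<Rightarrow> 'a set" where
  "half_open_cone B \<xi> =
     {y \<in> span B. \<forall>b\<in>B. 0 < coord B b y \<or> (coord B b y = 0 \<and> 0 \<le> coord B b \<xi>)}"

lemma eventually_affine_nonneg:
  fixes a c :: real
  shows "eventually (\<lambda>\<delta>. (0 \<le> a + \<delta> * c) = (0 < a \<or> (a = 0 \<and> 0 \<le> c))) (at_right 0)"
proof -
  have "((\<lambda>\<delta>. a + \<delta> * c) \<longlongrightarrow> a + 0 * c) (at_right 0)" by (intro tendsto_intros)
  then have lim: "((\<lambda>\<delta>. a + \<delta> * c) \<longlongrightarrow> a) (at_right 0)" by simp
  consider "a > 0" | "a < 0" | "a = 0" by linarith
  then show ?thesis
  proof cases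
    case 1
    from order_tendstoD(1)[OF lim this] show ?thesis by eventually_elim (use 1 in auto)
  next
    case 2
    from order_tendstoD(2)[OF lim this] show ?thesis by eventually_elim (use 2 in auto)
  next
    case 3
    then show ?thesis
      using eventually_at_right_less[of "0::real"]
      by (auto elim!: eventually_mono simp: zero_le_mult_iff)
  qed
qed

lemma eventually_affine_nonzero:
  fixes a c :: real
  assumes "c \<noteq> 0"
  shows "eventually (\<lambda>\<delta>. a + \<delta> * c \<noteq> 0) (at_right 0)"
proof (cases "a = 0")
  case True
  then show ?thesis using eventually_at_right_less[of "0::real"] assms
    by (auto elim!: eventually_mono)
next
  case False
  have "((\<lambda>\<delta>. a + \<delta> * c) \<longlongrightarrow> a + 0 * c) (at_right 0)" by (intro tendsto_intros)
  then show ?thesis using False by (intro tendsto_imp_eventually_ne) auto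
qed

lemma eventually_half_open_cone:
  assumes "independent B" "finite B" "\<xi> \<in> span B"
  shows "eventually (\<lambda>\<delta>. y + \<delta> *\<^sub>R \<xi> \<in> convex_cone hull B \<longleftrightarrow> y \<in> half_open_cone B \<xi>) (at_right 0)"
proof -
  have "eventually (\<lambda>\<delta>. \<forall>b\<in>B. (0 \<le> coord B b y + \<delta> * coord B b \<xi>)
      = (0 < coord B b y \<or> (coord B b y = 0 \<and> 0 \<le> coord B b \<xi>))) (at_right 0)"
    using assms(2) by (simp add: eventually_ball_finite_distrib eventually_affine_nonneg)
  then show ?thesis
  proof eventually_elim
    case (elim \<delta>)
    have "y + \<delta> *\<^sub>R \<xi> \<in> span B \<longleftrightarrow> y \<in> span B"
      using assms(3) by (simp add: span_add_eq2 span_scale)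
    moreover have "coord B b (y + \<delta> *\<^sub>R \<xi>) = coord B b y + \<delta> * coord B b \<xi>" for b
      using linear_coord[OF assms(1)] by (simp add: linear_add linear_scale)
    ultimately show ?case
      using elim by (auto simp: convex_cone_hull_independent[OF assms(1,2)] half_open_cone_def)
  qed
qed

section \<open>Signed decomposition of a cone into simplicial cones\<close>

text \<open>The functionals stand for finitely many hyperplanes; a generator with
  \<open>f u \<noteq> 0\<close> ensures that the kernel is proper inside \<open>span U\<close>,
  which may be smaller than the whole space.\<close>

definition generic_for :: "'a::real_vector set \<Rightarrow> ('a \<Rightarrow> real) set \<Rightarrow> bool" where
  "generic_for U N \<longleftrightarrow> finite N \<and> (\<forall>f\<in>N. linear f \<and> (\<exists>u\<in>U. f u \<noteq> 0))"

lemma generic_for_Un: "generic_for U (M \<union> N) \<longleftrightarrow> generic_for U M \<and> generic_for U N"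
  by (auto simp: generic_for_def)

text \<open>Induction on \<open>N\<close>: a small step along a generator on which the new
  functional is nonzero repairs that functional without spoiling the earlier ones. Strictly positive
  coefficients are kept because the point must later represent a relatively interior
  direction.\<close>

lemma generic_point_exists:
  assumes "finite U" "generic_for U N"
  shows "\<exists>c. (\<forall>u\<in>U. 0 < c u) \<and> (\<forall>f\<in>N. f (\<Sum>u\<in>U. c u *\<^sub>R u) \<noteq> 0)"
proof -
  have "finite N" using assms(2) by (simp add: generic_for_def)
  then show ?thesis using assms(2)
  proof (induction N rule: finite_induct)
    case empty
    then show ?case by (auto intro!: exI[of _ "\<lambda>_. 1"])
  next
    case (insert f N)
    then obtain c where c: "\<forall>u\<in>U. 0 < c u" "\<forall>g\<in>N. g (\<Sum>u\<in>U. c u *\<^sub>R u) \<noteq> 0"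
      by (auto simp: generic_for_def)
    from insert.prems obtain u where u: "u \<in> U" "f u \<noteq> 0" and lin: "\<forall>g\<in>insert f N. linear g"
      by (auto simp: generic_for_def)
    define x where "x = (\<Sum>u\<in>U. c u *\<^sub>R u)"
    have "eventually (\<lambda>\<delta>. \<forall>g\<in>N. g x + \<delta> * g u \<noteq> 0) (at_right 0)"
    proof (intro eventually_ball_finite ballI)
      fix g assume "g \<in> N"
      have "((\<lambda>\<delta>. g x + \<delta> * g u) \<longlongrightarrow> g x + 0 * g u) (at_right 0)" by (intro tendsto_intros)
      then show "eventually (\<lambda>\<delta>. g x + \<delta> * g u \<noteq> 0) (at_right 0)"
        using c(2) \<open>g \<in> N\<close> by (intro tendsto_imp_eventually_ne) (auto simp: x_def)
    qed (use insert in auto)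
    with eventually_affine_nonzero[OF u(2), of "f x"] eventually_at_right_less[of "0::real"]
    have "eventually (\<lambda>\<delta>. 0 < \<delta> \<and> (\<forall>g\<in>insert f N. g x + \<delta> * g u \<noteq> 0)) (at_right 0)"
      by eventually_elim auto
    then obtain \<delta> where \<delta>: "0 < \<delta>" "\<forall>g\<in>insert f N. g x + \<delta> * g u \<noteq> 0"
      using eventually_happens'[OF trivial_limit_at_right_real] by blast
    let ?c = "\<lambda>v. c v + (if v = u then \<delta> else 0)"
    have "(\<Sum>v\<in>U. ?c v *\<^sub>R v) = x + (\<Sum>v\<in>U. if v = u then \<delta> *\<^sub>R v else 0)"
      unfolding x_def sum.distrib[symmetric] by (intro sum.cong) (auto simp: algebra_simps)
    also have "\<dots> = x + \<delta> *\<^sub>R u" using u assms(1) by simp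
    finally have eq: "(\<Sum>v\<in>U. ?c v *\<^sub>R v) = x + \<delta> *\<^sub>R u" .
    show ?case
    proof (intro exI[of _ ?c] conjI ballI)
      show "0 < ?c v" if "v \<in> U" for v using that c(1) \<delta>(1) by (auto simp: add_pos_pos)
      show "g (\<Sum>v\<in>U. ?c v *\<^sub>R v) \<noteq> 0" if "g \<in> insert f N" for g
      proof -
        have "linear g" "g x + \<delta> * g u \<noteq> 0" using that lin \<delta>(2) by auto
        then show ?thesis unfolding eq by (simp add: linear_add linear_scale)
      qed
    qed
  qed
qed

text \<open>If these functionals do not vanish at \<xi>, each facet of a half-open piece belongs to
  exactly one of the pieces for \<xi> and for - \<xi>.\<close>

definition coords :: "'a::real_vector set \<Rightarrow> ('a \<Rightarrow> real) set" where
  "coords U = (\<Union>B\<in>bases U. coord B ` B)"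

lemma generic_for_coords:
  assumes "finite U" shows "generic_for U (coords U)"
  unfolding generic_for_def
proof (intro conjI ballI)
  show "finite (coords U)"
    using finite_bases[OF assms] finite_basis[OF assms] by (auto simp: coords_def)
  fix f assume "f \<in> coords U"
  then obtain B b where B: "B \<in> bases U" "b \<in> B" "f = coord B b" by (auto simp: coords_def)
  show "linear f" using B basesD(2) linear_coord by auto
  show "\<exists>u\<in>U. f u \<noteq> 0"
    using B coord_base[OF basesD(2)[OF B(1)], of b b] basesD(1) by (intro bexI[of _ b]) auto
qed

text \<open>The identity is demanded off the hyperplanes of \<open>N\<close> only, so overlaps of
  pieces along common faces need no bookkeeping here.\<close>

definition dissection :: "'a::real_vector set \<Rightarrow> ('a set \<Rightarrow> int) \<Rightarrow> ('a \<Rightarrow> real) set \<Rightarrow> bool" where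
  "dissection U \<epsilon> N \<longleftrightarrow> generic_for U N \<and>
     (\<forall>x\<in>span U. (\<forall>f\<in>N. f x \<noteq> 0) \<longrightarrow>
        of_bool (x \<in> convex_cone hull U) = (\<Sum>B\<in>bases U. \<epsilon> B * of_bool (x \<in> convex_cone hull B)))"

text \<open>For small \<delta> > 0 the points y + \<delta> \<eta> avoid all hyperplanes of
  \<open>N\<close>, so the generic identity applies there; letting \<delta> tend to 0 with \<eta> =
  \<xi> or \<eta> = - \<xi> gives identities valid at every y.\<close>

lemma half_open_dissection:
  fixes U :: "'a::euclidean_space set"
  assumes "finite U" and dis: "dissection U \<epsilon> N"
    and \<xi>: "\<xi> \<in> convex_cone hull U" "\<forall>f\<in>N. f \<xi> \<noteq> 0"
  shows "of_bool (y \<in> convex_cone hull U) = (\<Sum>B\<in>bases U. \<epsilon> B * of_bool (y \<in> half_open_cone B \<xi>))"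
      (is ?closed)
    and "of_bool (\<exists>\<delta>>0. y - \<delta> *\<^sub>R \<xi> \<in> convex_cone hull U)
          = (\<Sum>B\<in>bases U. \<epsilon> B * of_bool (y \<in> half_open_cone B (- \<xi>)))" (is ?open)
proof -
  let ?K = "convex_cone hull U"
  have \<xi>span: "\<xi> \<in> span U" using \<xi>(1) convex_cone_hull_subset_span by auto
  have N: "finite N" "\<And>f. f \<in> N \<Longrightarrow> linear f" and
    D: "\<And>x. x \<in> span U \<Longrightarrow> (\<And>f. f \<in> N \<Longrightarrow> f x \<noteq> 0) \<Longrightarrow>
        of_bool (x \<in> ?K) = (\<Sum>B\<in>bases U. \<epsilon> B * of_bool (x \<in> convex_cone hull B))"
    using dis by (auto simp: dissection_def generic_for_def)
  have lim: "of_bool P = (\<Sum>B\<in>bases U. \<epsilon> B * of_bool (y \<in> half_open_cone B \<eta>))"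
    if \<eta>: "\<eta> \<in> span U" "\<And>f. f \<in> N \<Longrightarrow> f \<eta> \<noteq> 0"
      and P: "eventually (\<lambda>\<delta>. y + \<delta> *\<^sub>R \<eta> \<in> ?K \<longleftrightarrow> P) (at_right 0)" for P \<eta>
  proof (cases "y \<in> span U")
    case True
    have "eventually (\<lambda>\<delta>. \<forall>B\<in>bases U.
        y + \<delta> *\<^sub>R \<eta> \<in> convex_cone hull B \<longleftrightarrow> y \<in> half_open_cone B \<eta>) (at_right 0)"
      using \<eta>(1) assms(1)
      by (intro eventually_ball_finite ballI eventually_half_open_cone finite_bases)
         (auto dest: basesD finite_basis)
    moreover have "eventually (\<lambda>\<delta>. \<forall>f\<in>N. f y + \<delta> * f \<eta> \<noteq> 0) (at_right 0)"
      using \<eta>(2) N(1) by (intro eventually_ball_finite ballI eventually_affine_nonzero) auto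
    ultimately have "eventually (\<lambda>\<delta>. of_bool P
        = (\<Sum>B\<in>bases U. \<epsilon> B * of_bool (y \<in> half_open_cone B \<eta>))) (at_right (0::real))"
      using P
    proof eventually_elim
      case (elim \<delta>)
      have "y + \<delta> *\<^sub>R \<eta> \<in> span U" using True \<eta>(1) by (intro span_add span_scale)
      moreover have "f (y + \<delta> *\<^sub>R \<eta>) \<noteq> 0" if "f \<in> N" for f
        using elim(2) that N(2)[OF that] by (simp add: linear_add linear_scale)
      ultimately show ?case using D[of "y + \<delta> *\<^sub>R \<eta>"] elim by (simp cong: sum.cong)
    qed
    then show ?thesis by simp
  next
    case False
    have "y + \<delta> *\<^sub>R \<eta> \<notin> ?K" for \<delta>
    proof
      assume "y + \<delta> *\<^sub>R \<eta> \<in> ?K"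
      then have "y + \<delta> *\<^sub>R \<eta> \<in> span U" using convex_cone_hull_subset_span by auto
      with False \<eta>(1) show False by (simp add: span_add_eq2 span_scale)
    qed
    with P have "\<not> P" by (auto dest: eventually_happens)
    moreover have "y \<notin> half_open_cone B \<eta>" if "B \<in> bases U" for B
      using False basesD(3)[OF that] by (auto simp: half_open_cone_def)
    ultimately show ?thesis by simp
  qed
  show ?closed
  proof (rule lim)
    show "\<xi> \<in> span U" by (fact \<xi>span)
    show "f \<xi> \<noteq> 0" if "f \<in> N" for f using \<xi>(2) that by blast
    \<comment> \<open>Inside the cone, adding a multiple of \<xi> stays inside; outside, closedness
      keeps small pushes outside.\<close>
    show "eventually (\<lambda>\<delta>. y + \<delta> *\<^sub>R \<xi> \<in> ?K \<longleftrightarrow> y \<in> ?K) (at_right 0)"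
    proof (cases "y \<in> ?K")
      case True
      show ?thesis using eventually_at_right_less[of "0::real"]
        by eventually_elim (use True \<xi>(1) in \<open>simp add: convex_cone_hull_add convex_cone_hull_mul\<close>)
    next
      case False
      have "((\<lambda>\<delta>. y + \<delta> *\<^sub>R \<xi>) \<longlongrightarrow> y + 0 *\<^sub>R \<xi>) (at_right 0)" by (intro tendsto_intros)
      moreover have "open (- ?K)" using closed_convex_cone_hull[OF assms(1)] by (simp add: open_Compl)
      ultimately have "eventually (\<lambda>\<delta>. y + \<delta> *\<^sub>R \<xi> \<in> - ?K) (at_right 0)"
        using False by (intro topological_tendstoD) auto
      then show ?thesis by eventually_elim (use False in auto)
    qed
  qed
  show ?open
  proof (rule lim)
    show "- \<xi> \<in> span U" using \<xi>span by (rule span_neg)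
    show "f (- \<xi>) \<noteq> 0" if "f \<in> N" for f using \<xi>(2) that N(2)[OF that] by (simp add: linear_neg)
    \<comment> \<open>If one \<delta>0 works, so does every smaller \<delta>, because the difference
      is a nonnegative multiple of \<xi>.\<close>
    show "eventually (\<lambda>\<delta>. y + \<delta> *\<^sub>R (- \<xi>) \<in> ?K \<longleftrightarrow> (\<exists>\<delta>>0. y - \<delta> *\<^sub>R \<xi> \<in> ?K)) (at_right 0)"
    proof (cases "\<exists>\<delta>>0. y - \<delta> *\<^sub>R \<xi> \<in> ?K")
      case True
      then obtain \<delta>0 where \<delta>0: "\<delta>0 > 0" "y - \<delta>0 *\<^sub>R \<xi> \<in> ?K" by blast
      have "eventually (\<lambda>\<delta>::real. \<delta> \<in> {0<..<\<delta>0}) (at_right 0)"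
        by (rule eventually_at_rightI[OF _ \<delta>0(1)])
      then show ?thesis
      proof eventually_elim
        case (elim \<delta>)
        have "y + \<delta> *\<^sub>R (- \<xi>) = (y - \<delta>0 *\<^sub>R \<xi>) + (\<delta>0 - \<delta>) *\<^sub>R \<xi>" by (simp add: algebra_simps)
        also have "\<dots> \<in> ?K" using elim \<delta>0 \<xi>(1) by (intro convex_cone_hull_add convex_cone_hull_mul) auto
        finally show ?case using True by simp
      qed
    next
      case False
      show ?thesis using eventually_at_right_less[of "0::real"]
        by eventually_elim (use False in auto)
    qed
  qed
qed

text \<open>Different exchanges can lead to the same basis; their weights are collected into one
  coefficient per basis.\<close>

lemma dissectionI_indexed:
  assumes "finite U" "generic_for U N" "finite I" "\<And>i. i \<in> I \<Longrightarrow> g i \<in> bases U"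
    and "\<And>x. x \<in> span U \<Longrightarrow> (\<And>f. f \<in> N \<Longrightarrow> f x \<noteq> 0) \<Longrightarrow>
        of_bool (x \<in> convex_cone hull U) = (\<Sum>i\<in>I. w i * of_bool (x \<in> convex_cone hull g i))"
  shows "dissection U (\<lambda>B. \<Sum>i | i \<in> I \<and> g i = B. w i) N"
  unfolding dissection_def
proof (intro conjI ballI impI)
  fix x assume "x \<in> span U" "\<forall>f\<in>N. f x \<noteq> 0"
  then have "of_bool (x \<in> convex_cone hull U) = (\<Sum>i\<in>I. w i * of_bool (x \<in> convex_cone hull g i))"
    by (intro assms(5)) auto
  also have "\<dots> = (\<Sum>B\<in>bases U. \<Sum>i | i \<in> I \<and> g i = B. w i * of_bool (x \<in> convex_cone hull g i))"
    using assms by (intro sum.group[symmetric]) (auto simp: finite_bases)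
  also have "\<dots> = (\<Sum>B\<in>bases U. (\<Sum>i | i \<in> I \<and> g i = B. w i) * of_bool (x \<in> convex_cone hull B))"
    by (intro sum.cong refl) (simp add: sum_distrib_right)
  finally show "of_bool (x \<in> convex_cone hull U)
    = (\<Sum>B\<in>bases U. (\<Sum>i | i \<in> I \<and> g i = B. w i) * of_bool (x \<in> convex_cone hull B))" .
qed (fact assms(2))

section \<open>Exchanging one generator of a simplicial cone\<close>

lemma convex_cone_hull_insert:
  "x \<in> convex_cone hull (insert u S) \<longleftrightarrow> (\<exists>a\<ge>0. x - a *\<^sub>R u \<in> convex_cone hull S)"
proof
  assume "x \<in> convex_cone hull (insert u S)"
  then have "x \<in> convex_cone hull ({u} \<union> S)" by simp
  then obtain y z where "y \<in> convex_cone hull {u}" "z \<in> convex_cone hull S" "x = y + z"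
    unfolding convex_cone_hull_Un by auto
  moreover from this(1) obtain a where "a \<ge> 0" "y = a *\<^sub>R u"
    using convex_cone_hull_finite[of "{u}"] by auto
  ultimately show "\<exists>a\<ge>0. x - a *\<^sub>R u \<in> convex_cone hull S" by auto
next
  assume "\<exists>a\<ge>0. x - a *\<^sub>R u \<in> convex_cone hull S"
  then obtain a where a: "a \<ge> 0" "x - a *\<^sub>R u \<in> convex_cone hull S" by blast
  have "x - a *\<^sub>R u \<in> convex_cone hull (insert u S)"
    using a(2) hull_mono[of S "insert u S"] by blast
  moreover have "a *\<^sub>R u \<in> convex_cone hull (insert u S)"
    using a(1) by (intro convex_cone_hull_mul hull_inc) auto
  ultimately have "(x - a *\<^sub>R u) + a *\<^sub>R u \<in> convex_cone hull (insert u S)"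
    by (rule convex_cone_hull_add)
  then show "x \<in> convex_cone hull (insert u S)" by simp
qed

lemma coord_remove_eq_0:
  assumes "independent B" "y \<in> span (B - {b})"
  shows "coord B b y = 0"
  using linear_eq_0_on_span[OF linear_coord[OF assms(1), of b], of "B - {b}" y] assms
  by (auto simp: coord_base)

lemma convex_cone_hull_remove:
  assumes "independent B" "finite B" "b \<in> B"
  shows "y \<in> convex_cone hull (B - {b}) \<longleftrightarrow>
    y \<in> span B \<and> coord B b y = 0 \<and> (\<forall>c\<in>B - {b}. 0 \<le> coord B c y)"
proof
  assume y: "y \<in> convex_cone hull (B - {b})"
  then have "y \<in> convex_cone hull B" using hull_mono[of "B - {b}" B] by blast
  moreover have "coord B b y = 0"
    using y convex_cone_hull_subset_span by (intro coord_remove_eq_0 assms(1)) auto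
  ultimately show "y \<in> span B \<and> coord B b y = 0 \<and> (\<forall>c\<in>B - {b}. 0 \<le> coord B c y)"
    using convex_cone_hull_independent[OF assms(1,2)] by auto
next
  assume y: "y \<in> span B \<and> coord B b y = 0 \<and> (\<forall>c\<in>B - {b}. 0 \<le> coord B c y)"
  have "y = (\<Sum>c\<in>B. coord B c y *\<^sub>R c)" using sum_coord[OF assms(1,2)] y by simp
  also have "\<dots> = (\<Sum>c\<in>B - {b}. coord B c y *\<^sub>R c)"
    using y assms by (simp add: sum.remove)
  finally show "y \<in> convex_cone hull (B - {b})"
    using y assms(2) by (auto simp: convex_cone_hull_finite intro!: exI[of _ "\<lambda>c. coord B c y"])
qed

lemma exchange_bases:
  assumes "finite U" "B \<in> bases U" "b \<in> B" "u \<in> span U" "coord B b u \<noteq> 0"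
  shows "insert u (B - {b}) \<in> bases (insert u U)"
proof -
  note B = basesD[OF assms(2)] and fB = finite_basis[OF assms(1,2)]
  have indep: "independent (insert u (B - {b}))"
    using coord_remove_eq_0[OF B(2), of u b] assms(5) independent_mono[OF B(2), of "B - {b}"]
    by (intro independent_insertI) auto
  have "u = coord B b u *\<^sub>R b + (\<Sum>c\<in>B - {b}. coord B c u *\<^sub>R c)"
    using sum_coord[OF B(2) fB, of u] assms(3,4) B(3) fB by (simp add: sum.remove)
  then have "b = (1 / coord B b u) *\<^sub>R (u - (\<Sum>c\<in>B - {b}. coord B c u *\<^sub>R c))"
    using assms(5) by (metis add_diff_cancel_right' scaleR_scaleR nonzero_eq_divide_eq scaleR_one)
  also have "\<dots> \<in> span (insert u (B - {b}))"
    by (intro span_scale span_diff span_sum) (auto intro: span_base)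
  finally have "B \<subseteq> span (insert u (B - {b}))" by (auto intro: span_base)
  then have "span U \<subseteq> span (insert u (B - {b}))" using B(3) span_minimal subspace_span by metis
  moreover have "span (insert u (B - {b})) \<subseteq> span U"
    using assms(4) B(1) by (intro span_minimal) (auto intro: span_base)
  moreover have "span (insert u U) = span U" using assms(4) by (simp add: span_redundant)
  ultimately show ?thesis using indep B(1) by (auto simp: bases_def)
qed

text \<open>Membership means that the ray from x in direction - u meets the facet of the cone of
  \<open>B\<close> opposite to \<open>b\<close>. The hyperplane of that facet is crossed at the
  single parameter \<open>s\<close>.\<close>

lemma exchange_cone:
  assumes "finite U" "B \<in> bases U" "b \<in> B" "u \<in> span U" "coord B b u \<noteq> 0" "x \<in> span U"
  defines "s \<equiv> coord B b x / coord B b u"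
  shows "x \<in> convex_cone hull (insert u (B - {b})) \<longleftrightarrow>
    0 \<le> s \<and> (\<forall>c\<in>B - {b}. 0 \<le> coord B c x - s * coord B c u)"
proof -
  note B = basesD[OF assms(2)] and fB = finite_basis[OF assms(1,2)]
  have lin: "coord B c (x - a *\<^sub>R u) = coord B c x - a * coord B c u" for a c
    using linear_coord[OF B(2)] by (simp add: linear_diff linear_scale)
  have "coord B b x - a * coord B b u = 0 \<longleftrightarrow> a = s" for a
    using assms(5) by (auto simp: s_def field_simps)
  moreover have "x - a *\<^sub>R u \<in> span B" for a
    using assms(4,6) B(3) by (auto intro: span_diff span_scale)
  ultimately show ?thesis
    unfolding convex_cone_hull_insert convex_cone_hull_remove[OF B(2) fB assms(3)] lin by auto
qed

text \<open>Along the ray \<open>s \<mapsto> x - s u\<close>, \<open>s \<ge> 0\<close>, the indicator \<open>g\<close> of the closed bounded interval in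
  which the ray meets the cone of \<open>U\<close> satisfies \<open>(\<Sum>s. g s - g (s+)) = 1\<close> if the interval is
  nonempty, i.e. if \<open>x\<close> lies in the cone of \<open>insert u U\<close>. The same sum, evaluated on the half-open
  simplicial pieces, is a combination of the cones obtained from them by exchanging a
  generator for \<open>u\<close>.\<close>

lemma dissection_insert_in_span:
  fixes U :: "'a::euclidean_space set"
  assumes fU: "finite U" and dis: "dissection U \<epsilon> N" and u: "u \<in> span U"
    and h: "linear h" "\<And>v. v \<in> insert u U \<Longrightarrow> 0 < (h v :: real)"
  shows "\<exists>\<epsilon>' N'. dissection (insert u U) \<epsilon>' N'"
proof -
  let ?K = "convex_cone hull U"
  have N: "generic_for U N" using dis by (simp add: dissection_def)
  then have "generic_for U (N \<union> coords U)"
    using generic_for_coords[OF fU] by (simp add: generic_for_Un)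
  from generic_point_exists[OF fU this] obtain c where
    c: "\<forall>v\<in>U. 0 < c v" "\<forall>f\<in>N \<union> coords U. f (\<Sum>v\<in>U. c v *\<^sub>R v) \<noteq> 0" by blast
  define \<xi> where "\<xi> = (\<Sum>v\<in>U. c v *\<^sub>R v)"
  have \<xi>: "\<xi> \<in> ?K" "\<forall>f\<in>N. f \<xi> \<noteq> 0"
    unfolding \<xi>_def convex_cone_hull_finite[OF fU] using c by (auto intro!: exI[of _ c] less_imp_le)
  have decomp: "of_bool (y \<in> ?K) = (\<Sum>B\<in>bases U. \<epsilon> B * of_bool (y \<in> half_open_cone B \<xi>))" for y
    using half_open_dissection(1)[OF fU dis \<xi>] .
  \<comment> \<open>With denominators cleared, \<open>f (B, b, d) x \<noteq> 0\<close> says that the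
    ray crosses the hyperplanes opposite to \<open>b\<close> and \<open>d\<close> at different
    parameters. The value of this functional at the generator \<open>b\<close> is
    \<open>coord B d u\<close>, whence the condition in \<open>T\<close>.\<close>
  define f where "f = (\<lambda>(B, b, d) x. coord B b x * coord B d u - coord B d x * coord B b u)"
  define T where "T = (SIGMA B:bases U. SIGMA b:B. {d\<in>B. d \<noteq> b \<and> coord B d u \<noteq> 0})"
  define N' where "N' = coords U \<union> f ` T"
  have "generic_for U (f ` T)"
    unfolding generic_for_def
  proof (intro conjI ballI)
    show "finite (f ` T)"
      unfolding T_def using finite_bases[OF fU] finite_basis[OF fU]
      by (intro finite_imageI finite_SigmaI) auto
    fix k assume "k \<in> f ` T"
    then obtain B b d where B: "B \<in> bases U" "b \<in> B" "d \<in> B" "d \<noteq> b" "coord B d u \<noteq> 0"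
      "k = f (B, b, d)" by (auto simp: T_def)
    note BB = basesD[OF B(1)]
    show "linear k"
      unfolding B(6) f_def using linear_coord[OF BB(2)]
      by (intro linearI) (auto simp: linear_add linear_scale algebra_simps)
    show "\<exists>v\<in>U. k v \<noteq> 0"
      using B BB by (intro bexI[of _ b]) (auto simp: f_def coord_base)
  qed
  then have "generic_for U N'" using generic_for_coords[OF fU] by (simp add: N'_def generic_for_Un)
  then have gen: "generic_for (insert u U) N'" by (auto simp: generic_for_def)
  define I where "I = (SIGMA B:bases U. {b\<in>B. coord B b u \<noteq> 0})"
  \<comment> \<open>Jump of a half-open piece at the crossing of its facet opposite to
    \<open>b\<close>: the crossing point belongs to the piece iff the coordinate of \<xi> is
    nonnegative, the points just after it iff the b-coordinate grows along - u.\<close>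
  define w where "w = (\<lambda>(B, b). \<epsilon> B * (of_bool (0 \<le> coord B b \<xi>) - of_bool (coord B b u < 0)))"
  define G where "G = (\<lambda>(B, b). insert u (B - {b}))"
  have finI: "finite I"
    unfolding I_def using finite_bases[OF fU] finite_basis[OF fU] by (intro finite_SigmaI) auto
  have "dissection (insert u U) (\<lambda>B. \<Sum>i | i \<in> I \<and> G i = B. w i) N'"
  proof (rule dissectionI_indexed)
    show "finite (insert u U)" using fU by simp
    show "generic_for (insert u U) N'" by (fact gen)
    show "finite I" by (fact finI)
    show "G i \<in> bases (insert u U)" if "i \<in> I" for i
      using that exchange_bases[OF fU _ _ u] by (auto simp: I_def G_def)
  next
    fix x assume "x \<in> span (insert u U)" and x_gen: "\<And>k. k \<in> N' \<Longrightarrow> k x \<noteq> 0"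
    then have x: "x \<in> span U" using u by (simp add: span_redundant)
    have x_ne: "coord B b x \<noteq> 0" if "B \<in> bases U" "b \<in> B" for B b
      using x_gen[of "coord B b"] that by (auto simp: N'_def coords_def)
    define t where "t = (\<lambda>B b. coord B b x / coord B b u)"
    have t_ne: "t B b \<noteq> t B d"
      if "B \<in> bases U" "b \<in> B" "d \<in> B" "d \<noteq> b" "coord B b u \<noteq> 0" "coord B d u \<noteq> 0" for B b d
    proof -
      have "(B, b, d) \<in> T" using that by (auto simp: T_def)
      then have "f (B, b, d) x \<noteq> 0" by (intro x_gen) (auto simp: N'_def)
      then show ?thesis using that(5,6) by (auto simp: f_def t_def field_simps)
    qed
    define g :: "real \<Rightarrow> int" where "g s = of_bool (x - s *\<^sub>R u \<in> ?K)" for s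
    define \<phi> :: "'a set \<Rightarrow> real \<Rightarrow> int"
      where "\<phi> B s = of_bool (x - s *\<^sub>R u \<in> half_open_cone B \<xi>)" for B s
    \<comment> \<open>Right limit of \<open>\<phi> B\<close>: increasing s moves the point in
      direction - u, so ties are decided by - u instead of \<xi>.\<close>
    define \<phi>' :: "'a set \<Rightarrow> real \<Rightarrow> int"
      where "\<phi>' B s = of_bool (x - s *\<^sub>R u \<in> half_open_cone B (- u))" for B s
    define g' where "g' s = (\<Sum>B\<in>bases U. \<epsilon> B * \<phi>' B s)" for s
    have g_eq: "g s = (\<Sum>B\<in>bases U. \<epsilon> B * \<phi> B s)" for s
      by (simp add: g_def \<phi>_def decomp)
    have co: "coord B b (x - s *\<^sub>R u) = coord B b x - s * coord B b u" if "B \<in> bases U" for B b s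
      using linear_coord[OF basesD(2)[OF that]] by (simp add: linear_diff linear_scale)
    have in_span: "x - s *\<^sub>R u \<in> span B" if "B \<in> bases U" for s B
      using x u basesD(3)[OF that] by (auto intro: span_diff span_scale)
    have \<phi>_iff: "\<phi> B s = of_bool (\<forall>b\<in>B. 0 < coord B b x - s * coord B b u
        \<or> (coord B b x - s * coord B b u = 0 \<and> 0 \<le> coord B b \<xi>))" if "B \<in> bases U" for B s
      using in_span[OF that] by (simp add: \<phi>_def half_open_cone_def co[OF that])
    have \<phi>'_iff: "\<phi>' B s = of_bool (\<forall>b\<in>B. 0 < coord B b x - s * coord B b u
        \<or> (coord B b x - s * coord B b u = 0 \<and> 0 \<le> - coord B b u))" if "B \<in> bases U" for B s
      using in_span[OF that] linear_coord[OF basesD(2)[OF that]]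
      by (simp add: \<phi>'_def half_open_cone_def co[OF that] linear_neg)
    \<comment> \<open>For small \<delta> > 0 no coordinate of x - (s + \<delta>) u vanishes, also
      when that coordinate of u is 0, by genericity of x. So all tie-breaking rules agree
      there.\<close>
    have "eventually (\<lambda>\<delta>. g (s + \<delta>) = g' s) (at_right 0)" for s
    proof -
      have "eventually (\<lambda>\<delta>. \<forall>B\<in>bases U. \<forall>b\<in>B.
          (0 \<le> (coord B b x - s * coord B b u) + \<delta> * (- coord B b u)) =
          (0 < coord B b x - s * coord B b u \<or>
            (coord B b x - s * coord B b u = 0 \<and> 0 \<le> - coord B b u))) (at_right 0)"
        using finite_bases[OF fU] finite_basis[OF fU]
        by (intro eventually_ball_finite ballI eventually_affine_nonneg) auto
      moreover have "eventually (\<lambda>\<delta>. \<forall>B\<in>bases U. \<forall>b\<in>B.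
          (coord B b x - s * coord B b u) + \<delta> * (- coord B b u) \<noteq> 0) (at_right 0)"
      proof (intro eventually_ball_finite ballI)
        fix B b assume B: "B \<in> bases U" "b \<in> B"
        show "eventually (\<lambda>\<delta>. (coord B b x - s * coord B b u) + \<delta> * (- coord B b u) \<noteq> 0) (at_right 0)"
        proof (cases "coord B b u = 0")
          case True
          then show ?thesis using x_ne[OF B] by simp
        next
          case False
          then show ?thesis by (intro eventually_affine_nonzero) simp
        qed
      qed (use finite_bases[OF fU] finite_basis[OF fU] in auto)
      ultimately show ?thesis
      proof eventually_elim
        case (elim \<delta>)
        have "\<phi> B (s + \<delta>) = \<phi>' B s" if B: "B \<in> bases U" for B
        proof -
          have eq: "coord B b x - (s + \<delta>) * coord B b u
              = (coord B b x - s * coord B b u) + \<delta> * (- coord B b u)" for b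
            by (simp add: algebra_simps)
          show ?thesis unfolding \<phi>_iff[OF B] \<phi>'_iff[OF B] eq
            using elim B by (intro arg_cong[of _ _ of_bool] ball_cong refl) (metis less_eq_real_def)
        qed
        then show ?case unfolding g_eq g'_def by (intro sum.cong) auto
      qed
    qed
    note g_limit = this
    \<comment> \<open>The nonnegative crossing parameters, the only places s \<ge> 0 where g can
      differ from its right limit.\<close>
    define S where "S = {s \<in> (\<lambda>(B, b). t B b) ` I. 0 \<le> s}"
    have finS: "finite S" using finI by (simp add: S_def)
    have \<phi>_eq: "\<phi> B s = \<phi>' B s"
      if B: "B \<in> bases U" and s: "\<And>b. b \<in> B \<Longrightarrow> coord B b u \<noteq> 0 \<Longrightarrow> s \<noteq> t B b" for B s
    proof -
      have "coord B b x - s * coord B b u \<noteq> 0" if "b \<in> B" for b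
        using s[OF that] x_ne[OF B that] by (cases "coord B b u = 0") (auto simp: t_def field_simps)
      then show ?thesis unfolding \<phi>_iff[OF B] \<phi>'_iff[OF B] by auto
    qed
    have "of_bool (x \<in> convex_cone hull (insert u U)) = (\<Sum>s\<in>S. g s - g' s)"
    proof -
      define J where "J = {s. 0 \<le> s \<and> x - s *\<^sub>R u \<in> ?K}"
      have J_iff: "x \<in> convex_cone hull (insert u U) \<longleftrightarrow> J \<noteq> {}"
        by (auto simp: J_def convex_cone_hull_insert)
      \<comment> \<open>Pointedness enters here: the positive functional keeps the ray from staying
        in the cone forever.\<close>
      have "s \<le> h x / h u" if "s \<in> J" for s
      proof -
        have "0 \<le> h (x - s *\<^sub>R u)"
        proof (rule linear_convex_cone_hull_nonneg[OF h(1)])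
          show "0 \<le> h v" if "v \<in> U" for v using h(2)[of v] that by simp
          show "x - s *\<^sub>R u \<in> ?K" using that by (simp add: J_def)
        qed
        then have "s * h u \<le> h x" using h(1) by (simp add: linear_diff linear_scale)
        then show ?thesis using h(2)[of u] by (simp add: pos_le_divide_eq)
      qed
      then have "bounded J" unfolding J_def by (intro boundedI[of _ "h x / h u"]) auto
      moreover have "closed J"
      proof -
        have "closed ({0..} \<inter> (\<lambda>s. x - s *\<^sub>R u) -` ?K)"
          by (intro closed_Int closed_vimage closed_convex_cone_hull fU continuous_intros)
        then show ?thesis by (simp add: J_def vimage_def Collect_conj_eq atLeast_def)
      qed
      ultimately have "compact J" by (simp add: compact_eq_bounded_closed)
      have g'_eq: "g' s = v" if "eventually (\<lambda>\<delta>. g (s + \<delta>) = v) (at_right (0::real))" for s v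
      proof -
        have "eventually (\<lambda>\<delta>. g' s = v) (at_right (0::real))"
          using that g_limit[of s] by eventually_elim simp
        then show ?thesis by simp
      qed
      show ?thesis
      proof (cases "J = {}")
        case True
        then have g0: "g s = 0" if "0 \<le> s" for s using that by (auto simp: g_def J_def)
        have "g' s = 0" if "0 \<le> s" for s
          using eventually_at_right_less[of "0::real"]
          by (intro g'_eq, eventually_elim) (use that in \<open>auto intro!: g0\<close>)
        then show ?thesis using True J_iff g0 by (simp add: S_def)
      next
        case False
        with \<open>compact J\<close> obtain m where m: "m \<in> J" "\<And>s. s \<in> J \<Longrightarrow> s \<le> m"
          using compact_attains_sup[of J] by blast
        have gm: "g m = 1" using m(1) by (simp add: g_def J_def)
        have m0: "0 \<le> m" using m(1) by (simp add: J_def)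
        have beyond: "g (m + \<delta>) = 0" if "0 < \<delta>" for \<delta>
          using m(2)[of "m + \<delta>"] m0 that by (auto simp: g_def J_def)
        have g'm: "g' m = 0"
          using eventually_at_right_less[of "0::real"]
          by (intro g'_eq, eventually_elim) (rule beyond)
        \<comment> \<open>Away from crossing parameters every piece agrees with its right limit, but
          g drops from 1 to 0 at the endpoint m.\<close>
        have "m \<in> S"
        proof (rule ccontr)
          assume "m \<notin> S"
          then have "\<phi> B m = \<phi>' B m" if "B \<in> bases U" for B
            using that m0 by (intro \<phi>_eq) (auto simp: S_def I_def image_iff)
          then have "g m = g' m" unfolding g_eq g'_def by (intro sum.cong) auto
          then show False using gm g'm by simp
        qed
        moreover have "g s - g' s = 0" if "s \<in> S" "s \<noteq> m" for s
        proof -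
          have s0: "0 \<le> s" using that by (simp add: S_def)
          have "g' s = g s"
          proof (rule g'_eq)
            show "eventually (\<lambda>\<delta>. g (s + \<delta>) = g s) (at_right 0)"
            proof (cases "s < m \<and> s \<in> J")
              case True
              have "eventually (\<lambda>\<delta>::real. \<delta> \<in> {0<..<m - s}) (at_right 0)"
                using True by (intro eventually_at_rightI) auto
              then show ?thesis
              proof eventually_elim
                case (elim \<delta>)
                define \<theta> where "\<theta> = \<delta> / (m - s)"
                have \<theta>: "0 \<le> \<theta>" "0 \<le> 1 - \<theta>" "\<theta> * (m - s) = \<delta>"
                  using elim by (auto simp: \<theta>_def field_simps)
                have "x - (s + \<delta>) *\<^sub>R u = (1 - \<theta>) *\<^sub>R (x - s *\<^sub>R u) + \<theta> *\<^sub>R (x - m *\<^sub>R u)"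
                  unfolding \<theta>(3)[symmetric] by (simp add: algebra_simps)
                also have "\<dots> \<in> ?K" using \<theta> True m(1)
                  by (intro convex_cone_hull_add convex_cone_hull_mul) (auto simp: J_def)
                finally show ?case using True by (simp add: g_def J_def)
              qed
            next
              case False
              then have sJ: "s \<notin> J" using m(2) that(2) by force
              have "open (- J)" using \<open>closed J\<close> by (simp add: open_Compl)
              moreover have "((\<lambda>\<delta>. s + \<delta>) \<longlongrightarrow> s + 0) (at_right 0)" by (intro tendsto_intros)
              ultimately have "eventually (\<lambda>\<delta>. s + \<delta> \<in> - J) (at_right 0)"
                using sJ by (intro topological_tendstoD) auto
              with eventually_at_right_less[of "0::real"] show ?thesis
                by eventually_elim (use sJ s0 in \<open>auto simp: g_def J_def\<close>)
            qed
          qed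
          then show ?thesis by simp
        qed
        then have "(\<Sum>s\<in>S. g s - g' s) = (\<Sum>s\<in>S. if s = m then 1 else 0)"
          using gm g'm by (intro sum.cong) auto
        ultimately show ?thesis using False J_iff finS by simp
      qed
    qed
    also have "\<dots> = (\<Sum>s\<in>S. \<Sum>B\<in>bases U. \<epsilon> B * (\<phi> B s - \<phi>' B s))"
      by (simp add: g_eq g'_def sum_subtractf right_diff_distrib)
    also have "\<dots> = (\<Sum>B\<in>bases U. \<epsilon> B * (\<Sum>s\<in>S. \<phi> B s - \<phi>' B s))"
      by (subst sum.swap) (simp add: sum_distrib_left)
    also have "\<dots> = (\<Sum>B\<in>bases U. \<Sum>b | b \<in> B \<and> coord B b u \<noteq> 0.
        w (B, b) * of_bool (x \<in> convex_cone hull G (B, b)))"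
    proof (rule sum.cong[OF refl])
      fix B assume B: "B \<in> bases U"
      note BB = basesD[OF B] and fB = finite_basis[OF fU B]
      let ?R = "{b \<in> B. coord B b u \<noteq> 0}" and ?Q = "{b \<in> B. coord B b u \<noteq> 0 \<and> 0 \<le> t B b}"
      \<comment> \<open>At this parameter the b-coordinate vanishes and, by genericity, no other one
        does; the signs of the others decide membership in the exchanged cone.\<close>
      have jump: "\<phi> B (t B b) - \<phi>' B (t B b) = of_bool (x \<in> convex_cone hull G (B, b)) *
          (of_bool (0 \<le> coord B b \<xi>) - of_bool (coord B b u < 0))"
        if b: "b \<in> ?Q" for b
      proof -
        have zero: "coord B b x - t B b * coord B b u = 0" using b by (simp add: t_def)
        have ne: "coord B c x - t B b * coord B c u \<noteq> 0" if "c \<in> B - {b}" for c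
          using that b t_ne[OF B, of b c] x_ne[OF B, of c]
          by (cases "coord B c u = 0") (auto simp: t_def[of ] field_simps)
        have inG: "x \<in> convex_cone hull G (B, b) \<longleftrightarrow>
            (\<forall>c\<in>B - {b}. 0 < coord B c x - t B b * coord B c u)"
        proof -
          have "x \<in> convex_cone hull G (B, b) \<longleftrightarrow>
            (\<forall>c\<in>B - {b}. 0 \<le> coord B c x - t B b * coord B c u)"
            using exchange_cone[OF fU B _ u _ x, of b] b by (simp add: G_def t_def)
          then show ?thesis using ne by (force simp: less_le)
        qed
        have split: "(\<forall>c\<in>B. P c) \<longleftrightarrow> P b \<and> (\<forall>c\<in>B - {b}. P c)" for P using b by auto
        have "\<phi> B (t B b) = of_bool (0 \<le> coord B b \<xi> \<and> x \<in> convex_cone hull G (B, b))"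
          unfolding \<phi>_iff[OF B] split inG zero using ne by auto
        moreover have "\<phi>' B (t B b) = of_bool (coord B b u < 0 \<and> x \<in> convex_cone hull G (B, b))"
          unfolding \<phi>'_iff[OF B] split inG zero using ne b by auto
        ultimately show ?thesis by auto
      qed
      \<comment> \<open>Parameters at which the ray crosses only hyperplanes of other bases produce
        no jump of this piece.\<close>
      have "(\<Sum>s\<in>S. \<phi> B s - \<phi>' B s) = (\<Sum>s\<in>t B ` ?Q. \<phi> B s - \<phi>' B s)"
      proof (rule sum.mono_neutral_right[OF finS])
        show "t B ` ?Q \<subseteq> S" using B by (auto simp: S_def I_def image_iff)
        show "\<forall>s\<in>S - t B ` ?Q. \<phi> B s - \<phi>' B s = 0"
          using B by (auto simp: S_def image_iff intro!: \<phi>_eq)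
      qed
      also have "\<dots> = (\<Sum>b\<in>?Q. \<phi> B (t B b) - \<phi>' B (t B b))"
        using t_ne[OF B] by (intro sum.reindex_cong[OF _ refl refl]) (auto simp: inj_on_def)
      also have "\<dots> = (\<Sum>b\<in>?Q. of_bool (x \<in> convex_cone hull G (B, b)) *
          (of_bool (0 \<le> coord B b \<xi>) - of_bool (coord B b u < 0)))"
        using jump by (intro sum.cong) auto
      also have "\<dots> = (\<Sum>b\<in>?R. of_bool (x \<in> convex_cone hull G (B, b)) *
          (of_bool (0 \<le> coord B b \<xi>) - of_bool (coord B b u < 0)))"
      proof (rule sum.mono_neutral_left)
        show "\<forall>b\<in>?R - ?Q. of_bool (x \<in> convex_cone hull G (B, b)) *
          (of_bool (0 \<le> coord B b \<xi>) - of_bool (coord B b u < 0)) = (0::int)"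
        proof
          fix b assume b: "b \<in> ?R - ?Q"
          then have "x \<notin> convex_cone hull G (B, b)"
            using exchange_cone[OF fU B _ u _ x, of b] by (auto simp: G_def t_def)
          then show "of_bool (x \<in> convex_cone hull G (B, b)) *
            (of_bool (0 \<le> coord B b \<xi>) - of_bool (coord B b u < 0)) = (0::int)" by simp
        qed
      qed (use fB in auto)
      finally have eq: "(\<Sum>s\<in>S. \<phi> B s - \<phi>' B s) =
          (\<Sum>b\<in>?R. of_bool (x \<in> convex_cone hull G (B, b)) *
            (of_bool (0 \<le> coord B b \<xi>) - of_bool (coord B b u < 0)))" .
      show "\<epsilon> B * (\<Sum>s\<in>S. \<phi> B s - \<phi>' B s) = (\<Sum>b\<in>?R.
          w (B, b) * of_bool (x \<in> convex_cone hull G (B, b)))"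
        unfolding eq sum_distrib_left by (intro sum.cong refl) (simp add: w_def)
    qed
    also have "\<dots> = (\<Sum>i\<in>I. w i * of_bool (x \<in> convex_cone hull G i))"
      unfolding I_def using finite_bases[OF fU] finite_basis[OF fU]
      by (subst sum.Sigma) (auto intro!: sum.cong)
    finally show "of_bool (x \<in> convex_cone hull (insert u U))
        = (\<Sum>i\<in>I. w i * of_bool (x \<in> convex_cone hull G i))" .
  qed
  then show ?thesis by blast
qed

text \<open>The enlarged cone is the direct sum of the old cone and the ray of \<open>u\<close>, so
  every piece just acquires the generator \<open>u\<close>. The functional \<open>f\<close> is the
  u-coordinate and \<open>pr\<close> the projection along \<open>u\<close>.\<close>

lemma dissection_insert_not_in_span:
  fixes U :: "'a::euclidean_space set"
  assumes fU: "finite U" and dis: "dissection U \<epsilon> N" and u: "u \<notin> span U"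
  shows "\<exists>\<epsilon>' N'. dissection (insert u U) \<epsilon>' N'"
proof -
  obtain B0 where B0: "B0 \<subseteq> U" "independent B0" and sub: "U \<subseteq> span B0"
    by (rule basis_exists[of U])
  have "span B0 = span U" using span_mono[OF B0(1)] span_minimal[OF sub] by auto
  note B0 = B0 this
  have "independent (insert u B0)" using B0 u by (intro independent_insertI) auto
  from linear_independent_extend[OF this, of "\<lambda>v. if v = u then 1 else 0 :: real"]
  obtain f :: "'a \<Rightarrow> real" where f: "linear f" "f u = 1" "\<forall>v\<in>B0. f v = (if v = u then 1 else 0)" by auto
  have "u \<notin> B0" using B0 u span_base by blast
  have f0: "f y = 0" if "y \<in> span U" for y
  proof (rule linear_eq_0_on_span[OF f(1)])
    show "f v = 0" if "v \<in> B0" for v using f(3) that \<open>u \<notin> B0\<close> by auto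
    show "y \<in> span B0" using that B0 by simp
  qed
  define pr where "pr x = x - f x *\<^sub>R u" for x
  have lin_pr: "linear pr"
    unfolding pr_def using f(1)
    by (intro linearI) (auto simp: linear_add linear_scale algebra_simps)
  have pr_id: "pr y = y" if "y \<in> span U" for y using f0[OF that] by (simp add: pr_def)
  have pr_u: "pr u = 0" using f(2) by (simp add: pr_def)
  have pr_span: "pr x \<in> span U" if "x \<in> span (insert u U)" for x
  proof -
    have "pr x \<in> span (pr ` insert u U)" using that linear_span_image[OF lin_pr] by blast
    also have "\<dots> \<subseteq> span U" using pr_u
      by (intro span_minimal) (auto simp: span_zero pr_id span_base)
    finally show ?thesis .
  qed
  have mem: "x \<in> convex_cone hull (insert u V) \<longleftrightarrow> 0 \<le> f x \<and> pr x \<in> convex_cone hull V"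
    if "V \<subseteq> U" for V x
  proof -
    have "a = f x" if "x - a *\<^sub>R u \<in> convex_cone hull V" for a
    proof -
      have "x - a *\<^sub>R u \<in> span U"
        using that \<open>V \<subseteq> U\<close> convex_cone_hull_subset_span span_mono by blast
      from f0[OF this] show ?thesis using f(1,2) by (simp add: linear_diff linear_scale)
    qed
    then show ?thesis unfolding convex_cone_hull_insert pr_def by auto
  qed
  have N: "generic_for U N" using dis by (simp add: dissection_def)
  define N' where "N' = insert f ((\<lambda>k. k \<circ> pr) ` N)"
  have "dissection (insert u U) (\<lambda>B. \<Sum>i | i \<in> bases U \<and> insert u i = B. \<epsilon> i) N'"
  proof (rule dissectionI_indexed)
    show "finite (insert u U)" "finite (bases U)" using fU finite_bases by auto
    show "generic_for (insert u U) N'"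
      unfolding generic_for_def
    proof (intro conjI ballI)
      show "finite N'" using N by (simp add: N'_def generic_for_def)
      fix k assume "k \<in> N'"
      then consider "k = f" | k0 where "k0 \<in> N" "k = k0 \<circ> pr" by (auto simp: N'_def)
      then show "linear k" "\<exists>v\<in>insert u U. k v \<noteq> 0"
      proof (atomize (full), cases)
        case 1
        then show "linear k \<and> (\<exists>v\<in>insert u U. k v \<noteq> 0)" using f by auto
      next
        case (2 k0)
        then obtain v where "v \<in> U" "k0 v \<noteq> 0" "linear k0" using N by (auto simp: generic_for_def)
        then have "linear k" "k v = k0 v"
          using 2 linear_compose[OF lin_pr] by (auto simp: pr_id span_base)
        then show "linear k \<and> (\<exists>v\<in>insert u U. k v \<noteq> 0)"
          using \<open>v \<in> U\<close> \<open>k0 v \<noteq> 0\<close> by (metis insertCI)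
      qed
    qed
    show "insert u B \<in> bases (insert u U)" if "B \<in> bases U" for B
    proof -
      note B = basesD[OF that]
      have "independent (insert u B)" using B u by (intro independent_insertI) auto
      moreover have "span (insert u B) = span (insert u U)" using B(3) by (simp add: span_insert)
      ultimately show ?thesis using B(1) by (auto simp: bases_def)
    qed
  next
    fix x assume x: "x \<in> span (insert u U)" and gen: "\<And>k. k \<in> N' \<Longrightarrow> k x \<noteq> 0"
    have "k (pr x) \<noteq> 0" if "k \<in> N" for k using gen[of "k \<circ> pr"] that by (auto simp: N'_def)
    then have "of_bool (pr x \<in> convex_cone hull U)
        = (\<Sum>B\<in>bases U. \<epsilon> B * of_bool (pr x \<in> convex_cone hull B))"
      using dis pr_span[OF x] by (simp add: dissection_def)
    then have "of_bool (0 \<le> f x) * of_bool (pr x \<in> convex_cone hull U)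
        = (\<Sum>B\<in>bases U. \<epsilon> B * of_bool (0 \<le> f x \<and> pr x \<in> convex_cone hull B))"
      by (simp add: sum_distrib_left of_bool_conj mult_ac)
    then show "of_bool (x \<in> convex_cone hull (insert u U))
        = (\<Sum>B\<in>bases U. \<epsilon> B * of_bool (x \<in> convex_cone hull (insert u B)))"
      by (simp add: mem basesD(1) of_bool_conj cong: sum.cong)
  qed
  then show ?thesis by blast
qed

theorem dissection_exists:
  fixes U :: "'a::euclidean_space set"
  assumes "finite U" "linear h" "\<And>u. u \<in> U \<Longrightarrow> 0 < (h u :: real)"
  shows "\<exists>\<epsilon> N. dissection U \<epsilon> N"
  using assms
proof (induction U rule: finite_induct)
  case empty
  have "bases ({} :: 'a set) = {{}}" by (auto simp: bases_def independent_empty)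
  then have "dissection ({} :: 'a set) (\<lambda>_. 1) {}"
    by (auto simp: dissection_def generic_for_def)
  then show ?case by blast
next
  case (insert u U)
  then obtain \<epsilon> N where "dissection U \<epsilon> N" by auto
  then show ?case
    using insert dissection_insert_in_span[of U \<epsilon> N u h] dissection_insert_not_in_span[of U \<epsilon> N u]
    by blast
qed

section \<open>The substitution q to 1/q is a field homomorphism\<close>

lemma const_1 [simp]: "const 1 = 1"
  by (simp add: const_def One_fract_def one_pCons)

lemma const_add: "const (x + y) = const x + const y"
  by (simp add: const_def flip: Fract_add_1)

lemma eval_inv_q_add: "eval_inv_q (a + b) = eval_inv_q a + eval_inv_q b"
proof -
  have "map_poly const (a + b) = map_poly const a + map_poly const b"
    by (rule poly_eqI) (simp add: coeff_map_poly const_add)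
  then show ?thesis by (simp add: eval_inv_q_def)
qed

lemma eval_inv_q_1 [simp]: "eval_inv_q 1 = 1"
  by (simp add: eval_inv_q_def map_poly_1)

lemma subst_inv_q_1 [simp]: "subst_inv_q 1 = 1"
  using subst_inv_q_Fract[of 1 1] by (simp add: One_fract_def)

lemma subst_inv_q_0 [simp]: "subst_inv_q 0 = 0"
  using subst_inv_q_Fract[of 1 0] by (simp add: Zero_fract_def eval_inv_q_def)

lemma subst_inv_q_add: "subst_inv_q (x + y) = subst_inv_q x + subst_inv_q y"
proof (cases x, cases y)
  fix a b c d assume "x = Fract a b" "b \<noteq> 0" "y = Fract c d" "d \<noteq> 0"
  then show ?thesis
    by (simp add: subst_inv_q_Fract eval_inv_q_add eval_inv_q_mult eval_inv_q_nz field_simps)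
qed

lemma subst_inv_q_mult: "subst_inv_q (x * y) = subst_inv_q x * subst_inv_q y"
proof (cases x, cases y)
  fix a b c d assume "x = Fract a b" "b \<noteq> 0" "y = Fract c d" "d \<noteq> 0"
  then show ?thesis by (simp add: subst_inv_q_Fract eval_inv_q_mult)
qed

lemma subst_inv_q_minus: "subst_inv_q (- x) = - subst_inv_q x"
  using subst_inv_q_add[of "- x" x] by (simp add: add_eq_0_iff2)

lemma subst_inv_q_diff: "subst_inv_q (x - y) = subst_inv_q x - subst_inv_q y"
  using subst_inv_q_add[of x "- y"] by (simp add: subst_inv_q_minus)

lemma subst_inv_q_inverse: "subst_inv_q (inverse x) = inverse (subst_inv_q x)"
proof (cases "x = 0")
  case False
  then have "subst_inv_q (inverse x) * subst_inv_q x = 1"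
    by (simp flip: subst_inv_q_mult)
  then show ?thesis by (metis inverse_unique mult.commute)
qed simp

lemma subst_inv_q_divide: "subst_inv_q (x / y) = subst_inv_q x / subst_inv_q y"
  by (simp add: divide_inverse subst_inv_q_mult subst_inv_q_inverse)

lemma subst_inv_q_qvar [simp]: "subst_inv_q qvar = 1 / qvar"
proof -
  have "eval_inv_q [:0, 1:] = 1 / qvar" by (simp add: eval_inv_q_def map_poly_pCons)
  then show ?thesis using subst_inv_q_Fract[of 1 "[:0, 1:]"] by (simp add: qvar_def)
qed

lemma subst_inv_q_power: "subst_inv_q (x ^ n) = subst_inv_q x ^ n"
  by (induction n) (simp_all add: subst_inv_q_mult)

lemma subst_inv_q_power_int: "subst_inv_q (x powi k) = subst_inv_q x powi k"
  by (simp add: power_int_def subst_inv_q_power subst_inv_q_inverse)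

lemma subst_inv_q_qvar_power_int: "subst_inv_q (qvar powi k) = qvar powi (- k)"
  by (simp add: subst_inv_q_power_int power_int_minus divide_inverse flip: power_int_inverse)

lemma subst_inv_q_sum: "subst_inv_q (\<Sum>i\<in>A. f i) = (\<Sum>i\<in>A. subst_inv_q (f i))"
  by (induction A rule: infinite_finite_induct) (simp_all add: subst_inv_q_add)

lemma subst_inv_q_prod: "subst_inv_q (\<Prod>i\<in>A. f i) = (\<Prod>i\<in>A. subst_inv_q (f i))"
  by (induction A rule: infinite_finite_induct) (simp_all add: subst_inv_q_mult)

lemma subst_inv_q_of_nat: "subst_inv_q (of_nat n) = of_nat n"
  by (induction n) (simp_all add: subst_inv_q_add)

lemma subst_inv_q_of_int: "subst_inv_q (of_int k) = of_int k"
  by (cases k rule: int_cases2) (simp_all add: subst_inv_q_of_nat subst_inv_q_minus)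

lemma poly_map_subst_inv_q:
  "poly (map_poly subst_inv_q c) (subst_inv_q x) = subst_inv_q (poly c x)"
  by (induction c) (simp_all add: map_poly_pCons subst_inv_q_add subst_inv_q_mult)

lemma qvar_power_int_neq_1:
  assumes "k \<noteq> 0"
  shows "qvar powi k \<noteq> 1"
proof -
  have *: "qvar ^ n \<noteq> 1" if "n > 0" for n
  proof
    assume "qvar ^ n = 1"
    then have "monom 1 n = (1 :: rat poly)" by (simp add: qvar_power One_fract_def eq_fract)
    then show False using that by (metis degree_1 degree_monom_eq less_irrefl one_neq_zero)
  qed
  show ?thesis
  proof (cases "k > 0")
    case True
    then show ?thesis using *[of "nat k"] by (simp add: power_int_def)
  next
    case False
    then show ?thesis using assms *[of "nat (- k)"] by (simp add: power_int_def power_inverse)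
  qed
qed

section \<open>Values of functions on the lattice\<close>

lemma lin_form_add: "lin_form l (x + y) = lin_form l x + lin_form l y"
  by (simp add: lin_form_def distrib_left sum.distrib)

lemma lin_form_diff: "lin_form l (x - y) = lin_form l x - lin_form l y"
  by (simp add: lin_form_def right_diff_distrib sum_subtractf)

lemma lin_form_0 [simp]: "lin_form l 0 = 0"
  by (simp add: lin_form_def)

lemma lin_form_of_int_vec: "lin_form l (of_int_vec m :: real ^ 'n) = of_int (lin_form l m)"
  by (simp add: lin_form_def of_int_vec_def)

definition qweight :: "int ^ 'n \<Rightarrow> int ^ 'n \<Rightarrow> ratfun" where
  "qweight l m = qvar powi lin_form l m"

lemma qweight_nonzero [simp]: "qweight l m \<noteq> 0"
  by (simp add: qweight_def qvar_nz)

lemma qweight_add: "qweight l (x + y) = qweight l x * qweight l y"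
  by (simp add: qweight_def lin_form_add power_int_add qvar_nz)

lemma qweight_diff: "qweight l (x - y) = qweight l x / qweight l y"
  by (simp add: qweight_def lin_form_diff power_int_diff qvar_nz)

lemma qweight_sum: "qweight l (\<Sum>i\<in>A. f i) = (\<Prod>i\<in>A. qweight l (f i))"
  by (induction A rule: infinite_finite_induct) (simp_all add: qweight_add, simp_all add: qweight_def)

lemma qweight_neq_1: "lin_form l m \<noteq> 0 \<Longrightarrow> qweight l m \<noteq> 1"
  by (simp add: qweight_def qvar_power_int_neq_1)

lemma subst_inv_q_qweight: "subst_inv_q (qweight l m) = inverse (qweight l m)"
  by (simp add: qweight_def subst_inv_q_qvar_power_int power_int_minus)

text \<open>\<open>F m\<close> is the coefficient of the monomial x^m in a formal series, with no
  restriction on the support. Such series cannot be multiplied in general, but Laurent polynomials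
  act on them.\<close>

type_synonym 'n lattice_fun = "int ^ 'n \<Rightarrow> ratfun"

definition supp :: "'n lattice_fun \<Rightarrow> (int ^ 'n) set" where
  "supp F = {m. F m \<noteq> 0}"

text \<open>Specialization of x^m to q^\<lambda>(m). It is meaningful for finite support; otherwise
  the sum has the default value 0.\<close>

definition fsum :: "int ^ 'n \<Rightarrow> 'n lattice_fun \<Rightarrow> ratfun" where
  "fsum l F = (\<Sum>m\<in>supp F. F m * qweight l m)"

lemma fsum_superset:
  assumes "finite S" "supp F \<subseteq> S"
  shows "fsum l F = (\<Sum>m\<in>S. F m * qweight l m)"
  unfolding fsum_def using assms by (intro sum.mono_neutral_left) (auto simp: supp_def)

lemma fsum_add:
  assumes "finite (supp F)" "finite (supp G)"
  shows "fsum l (\<lambda>m. F m + G m) = fsum l F + fsum l G"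
proof -
  have "supp (\<lambda>m. F m + G m) \<subseteq> supp F \<union> supp G" by (auto simp: supp_def)
  then show ?thesis
    using assms fsum_superset[of "supp F \<union> supp G"] by (simp add: sum.distrib distrib_right)
qed

lemma fsum_scale: "fsum l (\<lambda>m. a * F m) = a * fsum l F"
proof (cases "a = 0")
  case False
  then have "supp (\<lambda>m. a * F m) = supp F" by (auto simp: supp_def)
  then show ?thesis by (simp add: fsum_def sum_distrib_left mult.assoc)
qed (simp add: fsum_def supp_def)

lemma supp_shift: "supp (\<lambda>m. F (m - z)) = (\<lambda>m. m + z) ` supp F"
  unfolding supp_def by (auto simp: image_iff) (metis diff_add_cancel)

lemma fsum_shift: "fsum l (\<lambda>m. F (m - z)) = qweight l z * fsum l F"
  unfolding fsum_def supp_shift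
  by (subst sum.reindex) (auto simp: inj_on_def qweight_add sum_distrib_left mult_ac)

text \<open>Multiplication by the Laurent polynomial 1 - x^u.\<close>

definition diff_op :: "int ^ 'n \<Rightarrow> 'n lattice_fun \<Rightarrow> 'n lattice_fun" where
  "diff_op u F m = F m - F (m - u)"

abbreviation diff_ops :: "(int ^ 'n) list \<Rightarrow> 'n lattice_fun \<Rightarrow> 'n lattice_fun" where
  "diff_ops us F \<equiv> foldr diff_op us F"

lemma diff_op_commute: "diff_op u (diff_op v F) = diff_op v (diff_op u F)"
  by (auto simp: diff_op_def fun_eq_iff algebra_simps)

lemma diff_ops_diff_op: "diff_ops us (diff_op v F) = diff_op v (diff_ops us F)"
  by (induction us) (simp_all add: diff_op_commute)

lemma diff_ops_commute: "diff_ops us (diff_ops vs F) = diff_ops vs (diff_ops us F)"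
  by (induction us) (simp_all add: diff_ops_diff_op)

lemma diff_ops_add: "diff_ops us (\<lambda>m. F m + G m) = (\<lambda>m. diff_ops us F m + diff_ops us G m)"
  by (induction us) (auto simp: diff_op_def fun_eq_iff)

lemma diff_ops_scale: "diff_ops us (\<lambda>m. a * F m) = (\<lambda>m. a * diff_ops us F m)"
  by (induction us) (auto simp: diff_op_def fun_eq_iff algebra_simps)

lemma diff_ops_zero: "diff_ops us (\<lambda>_. 0) = (\<lambda>_. 0)"
  by (induction us) (auto simp: diff_op_def fun_eq_iff)

lemma diff_ops_shift: "diff_ops us (\<lambda>m. F (m - z)) = (\<lambda>m. diff_ops us F (m - z))"
  by (induction us) (auto simp: diff_op_def fun_eq_iff algebra_simps)

lemma finite_supp_diff_op:
  assumes "finite (supp F)"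
  shows "finite (supp (diff_op u F))"
proof -
  have "supp (diff_op u F) \<subseteq> supp F \<union> supp (\<lambda>m. F (m - u))"
    by (auto simp: supp_def diff_op_def)
  then show ?thesis using assms finite_subset by (fastforce simp: supp_shift)
qed

lemma finite_supp_diff_ops: "finite (supp F) \<Longrightarrow> finite (supp (diff_ops us F))"
  by (induction us) (simp_all add: finite_supp_diff_op)

lemma fsum_diff_op:
  assumes "finite (supp F)"
  shows "fsum l (diff_op u F) = (1 - qweight l u) * fsum l F"
proof -
  have "finite (supp (\<lambda>m. F (m - u)))" using assms by (simp add: supp_shift)
  then have "finite (supp (\<lambda>m. (-1) * F (m - u)))" by (simp add: supp_def)
  from fsum_add[OF assms this, of l] show ?thesis
    unfolding fsum_scale fsum_shift by (simp add: diff_op_def[abs_def] algebra_simps)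
qed

definition denom :: "int ^ 'n \<Rightarrow> (int ^ 'n) list \<Rightarrow> ratfun" where
  "denom l us = (\<Prod>u\<leftarrow>us. 1 - qweight l u)"

lemma denom_append: "denom l (us @ vs) = denom l us * denom l vs"
  by (simp add: denom_def)

lemma fsum_diff_ops:
  assumes "finite (supp F)"
  shows "fsum l (diff_ops us F) = denom l us * fsum l F"
  by (induction us) (simp_all add: denom_def fsum_diff_op finite_supp_diff_ops assms)

definition nonvanishing :: "int ^ 'n \<Rightarrow> (int ^ 'n) list \<Rightarrow> bool" where
  "nonvanishing l us \<longleftrightarrow> (\<forall>u\<in>set us. lin_form l u \<noteq> (0::int))"

lemma denom_nonzero: "nonvanishing l us \<Longrightarrow> denom l us \<noteq> 0"
  using qweight_neq_1 by (induction us) (auto simp: denom_def nonvanishing_def)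

text \<open>\<open>F\<close> may have infinite support; \<open>c\<close> is the value at \<open>q\<^sup>\<lambda>\<close> of a rational function of which \<open>F\<close>
  is a formal Laurent expansion.\<close>

definition has_value :: "int ^ 'n \<Rightarrow> 'n lattice_fun \<Rightarrow> ratfun \<Rightarrow> bool" where
  "has_value l F c \<longleftrightarrow> (\<exists>us. nonvanishing l us \<and>
     finite (supp (diff_ops us F)) \<and> fsum l (diff_ops us F) = denom l us * c)"

lemma has_value_finite: "finite (supp F) \<Longrightarrow> has_value l F (fsum l F)"
  unfolding has_value_def by (intro exI[of _ "[]"]) (simp add: denom_def nonvanishing_def)

text \<open>The two lists of operators are concatenated into a common denominator; commutation lets
  each summand see its own list first.\<close>

lemma has_value_add:
  assumes "has_value l F c" "has_value l G d"
  shows "has_value l (\<lambda>m. F m + G m) (c + d)"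
proof -
  obtain us vs where us: "nonvanishing l us" "finite (supp (diff_ops us F))"
      "fsum l (diff_ops us F) = denom l us * c"
    and vs: "nonvanishing l vs" "finite (supp (diff_ops vs G))"
      "fsum l (diff_ops vs G) = denom l vs * d"
    using assms by (auto simp: has_value_def)
  have fin: "finite (supp (diff_ops vs (diff_ops us F)))" "finite (supp (diff_ops us (diff_ops vs G)))"
    using us vs by (auto intro: finite_supp_diff_ops)
  have eq: "diff_ops (us @ vs) (\<lambda>m. F m + G m)
      = (\<lambda>m. diff_ops vs (diff_ops us F) m + diff_ops us (diff_ops vs G) m)"
    by (simp add: diff_ops_add diff_ops_commute[of us vs F])
  show ?thesis
    unfolding has_value_def
  proof (intro exI[of _ "us @ vs"] conjI)
    show "nonvanishing l (us @ vs)" using us vs by (auto simp: nonvanishing_def)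
    have "supp (diff_ops (us @ vs) (\<lambda>m. F m + G m))
        \<subseteq> supp (diff_ops vs (diff_ops us F)) \<union> supp (diff_ops us (diff_ops vs G))"
      unfolding eq by (auto simp: supp_def)
    then show "finite (supp (diff_ops (us @ vs) (\<lambda>m. F m + G m)))"
      using fin finite_subset by blast
    show "fsum l (diff_ops (us @ vs) (\<lambda>m. F m + G m)) = denom l (us @ vs) * (c + d)"
      unfolding eq fsum_add[OF fin] fsum_diff_ops[OF us(2)] fsum_diff_ops[OF vs(2)] us vs denom_append
      by (simp add: algebra_simps)
  qed
qed

lemma has_value_scale:
  assumes "has_value l F c"
  shows "has_value l (\<lambda>m. a * F m) (a * c)"
proof -
  obtain us where us: "nonvanishing l us" "finite (supp (diff_ops us F))"
      "fsum l (diff_ops us F) = denom l us * c"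
    using assms by (auto simp: has_value_def)
  have "supp (\<lambda>m. a * diff_ops us F m) \<subseteq> supp (diff_ops us F)" by (auto simp: supp_def)
  then show ?thesis
    unfolding has_value_def using us finite_subset
    by (intro exI[of _ us]) (auto simp: diff_ops_scale fsum_scale)
qed

lemma has_value_zero: "has_value l (\<lambda>_. 0) 0"
  using has_value_finite[of "\<lambda>_. 0" l] by (simp add: fsum_def supp_def)

lemma has_value_sum:
  assumes "\<And>i. i \<in> I \<Longrightarrow> has_value l (F i) (c i)"
  shows "has_value l (\<lambda>m. \<Sum>i\<in>I. F i m) (\<Sum>i\<in>I. c i)"
  using assms
proof (induction I rule: infinite_finite_induct)
  case (insert i I)
  then show ?case using has_value_add[of l "F i" "c i"] by simp
qed (simp_all add: has_value_zero)

lemma has_value_shift: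
  assumes "has_value l F c"
  shows "has_value l (\<lambda>m. F (m - z)) (qweight l z * c)"
proof -
  obtain us where us: "nonvanishing l us" "finite (supp (diff_ops us F))"
      "fsum l (diff_ops us F) = denom l us * c"
    using assms by (auto simp: has_value_def)
  then show ?thesis
    unfolding has_value_def diff_ops_shift
    by (intro exI[of _ us]) (simp add: supp_shift fsum_shift)
qed

text \<open>Unlike in \<open>has_value\<close>, the directions are only required to be nonzero:
  periods will be differences of arbitrary vertices, also non-adjacent ones, on which \<lambda> may
  vanish.\<close>

definition torsion :: "'n::finite lattice_fun \<Rightarrow> bool" where
  "torsion F \<longleftrightarrow> (\<exists>us. 0 \<notin> set us \<and> diff_ops us F = (\<lambda>_. 0))"

lemma torsion_periodic:
  assumes "u \<noteq> 0" "\<And>m. F (m - u) = F m"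
  shows "torsion F"
  unfolding torsion_def using assms by (intro exI[of _ "[u]"]) (auto simp: diff_op_def)

lemma torsion_add:
  assumes "torsion F" "torsion G"
  shows "torsion (\<lambda>m. F m + G m)"
proof -
  obtain us vs where us: "0 \<notin> set us" "diff_ops us F = (\<lambda>_. 0)"
    and vs: "0 \<notin> set vs" "diff_ops vs G = (\<lambda>_. 0)" using assms by (auto simp: torsion_def)
  have "diff_ops (us @ vs) (\<lambda>m. F m + G m)
      = (\<lambda>m. diff_ops vs (diff_ops us F) m + diff_ops us (diff_ops vs G) m)"
    by (simp add: diff_ops_add diff_ops_commute[of us vs F])
  then show ?thesis
    unfolding torsion_def using us vs by (intro exI[of _ "us @ vs"]) (auto simp: diff_ops_zero)
qed

lemma torsion_scale: "torsion F \<Longrightarrow> torsion (\<lambda>m. a * F m)"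
  unfolding torsion_def by (auto simp: diff_ops_scale)

lemma torsion_zero: "torsion (\<lambda>_. 0)"
  unfolding torsion_def by (intro exI[of _ "[]"]) simp

lemma torsion_sum: "(\<And>i. i \<in> I \<Longrightarrow> torsion (F i)) \<Longrightarrow> torsion (\<lambda>m. \<Sum>i\<in>I. F i m)"
  by (induction I rule: infinite_finite_induct) (simp_all add: torsion_add torsion_zero)

text \<open>Such an F is constant along m, m - u, m - 2u, and so on, an infinite set of lattice
  points.\<close>

lemma diff_op_eq_0_finite_supp:
  assumes "finite (supp F)" "u \<noteq> 0" "diff_op u F = (\<lambda>_. 0)"
  shows "F = (\<lambda>_. 0)"
proof (rule ccontr)
  assume "F \<noteq> (\<lambda>_. 0)"
  then obtain m where m: "F m \<noteq> 0" by auto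
  have step: "F x = F (x - u)" for x using fun_cong[OF assms(3), of x] by (simp add: diff_op_def)
  define p where "p n = (\<chi> i. m $ i - int n * u $ i)" for n
  have "p (Suc n) = p n - u" for n by (auto simp: p_def vec_eq_iff algebra_simps)
  then have "F (p n) = F m" for n
    by (induction n) (auto simp: step[symmetric], simp add: p_def)
  with m have "range p \<subseteq> supp F" by (auto simp: supp_def)
  moreover have "inj p"
  proof (rule injI)
    fix a b assume "p a = p b"
    obtain i where "u $ i \<noteq> 0" using assms(2) by (metis vec_eq_iff zero_index)
    moreover have "p a $ i = p b $ i" using \<open>p a = p b\<close> by simp
    ultimately show "a = b" by (simp add: p_def)
  qed
  ultimately show False using assms(1) finite_subset range_inj_infinite by blast
qed

lemma torsion_finite_supp:
  assumes "finite (supp F)" "torsion F"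
  shows "F = (\<lambda>_. 0)"
proof -
  obtain us where "0 \<notin> set us" "diff_ops us F = (\<lambda>_. 0)" using assms(2) by (auto simp: torsion_def)
  then show ?thesis
  proof (induction us)
    case (Cons u us)
    have "diff_ops us F = (\<lambda>_. 0)"
    proof (rule diff_op_eq_0_finite_supp[of _ u])
      show "finite (supp (diff_ops us F))" using assms(1) by (rule finite_supp_diff_ops)
      show "u \<noteq> 0" using Cons.prems(1) by auto
      show "diff_op u (diff_ops us F) = (\<lambda>_. 0)" using Cons.prems(2) by simp
    qed
    moreover have "0 \<notin> set us" using Cons.prems(1) by simp
    ultimately show ?case using Cons.IH by blast
  qed simp
qed

text \<open>Clearing the denominators of the value makes the support finite and keeps the function
  torsion, hence makes it zero; the denominator is nonzero, so c is 0. Applied to differences, this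
  yields uniqueness of values.\<close>

lemma torsion_value_zero:
  assumes "torsion F" "has_value l F c"
  shows "c = 0"
proof -
  obtain us where us: "nonvanishing l us" "finite (supp (diff_ops us F))"
      "fsum l (diff_ops us F) = denom l us * c"
    using assms(2) by (auto simp: has_value_def)
  obtain vs where vs: "0 \<notin> set vs" "diff_ops vs F = (\<lambda>_. 0)"
    using assms(1) by (auto simp: torsion_def)
  have "torsion (diff_ops us F)"
    unfolding torsion_def using vs by (intro exI[of _ vs]) (simp add: diff_ops_commute[of vs us] diff_ops_zero)
  from torsion_finite_supp[OF us(2) this] have "diff_ops us F = (\<lambda>_. 0)" .
  then have "fsum l (diff_ops us F) = 0" by (simp add: fsum_def supp_def)
  then show ?thesis using us denom_nonzero by auto
qed

section \<open>Reciprocity for simplicial cones\<close>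

lemma of_int_vec_add: "of_int_vec (x + y) = of_int_vec x + of_int_vec y"
  by (simp add: of_int_vec_def vec_eq_iff)

lemma of_int_vec_diff: "of_int_vec (x - y) = of_int_vec x - of_int_vec y"
  by (simp add: of_int_vec_def vec_eq_iff)

lemma of_int_vec_0: "of_int_vec 0 = 0"
  by (simp add: of_int_vec_def vec_eq_iff)

lemma of_int_vec_sum: "of_int_vec (\<Sum>i\<in>A. f i) = (\<Sum>i\<in>A. of_int_vec (f i))"
  by (induction A rule: infinite_finite_induct) (simp_all add: of_int_vec_add of_int_vec_0)

lemma inj_of_int_vec: "inj of_int_vec"
  by (auto simp: inj_def of_int_vec_def vec_eq_iff)

lemma finite_lattice_points:
  fixes S :: "(real ^ 'n) set"
  assumes "bounded S"
  shows "finite {m. of_int_vec m \<in> S}"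
proof -
  obtain b where b: "\<And>x. x \<in> S \<Longrightarrow> norm x \<le> b" using assms by (auto simp: bounded_iff)
  let ?R = "{- \<lceil>b\<rceil>..\<lceil>b\<rceil>}"
  have "vec_nth ` {m :: int ^ 'n. of_int_vec m \<in> S} \<subseteq> PiE UNIV (\<lambda>_. ?R)"
  proof
    fix f assume "f \<in> vec_nth ` {m :: int ^ 'n. of_int_vec m \<in> S}"
    then obtain m :: "int ^ 'n" where m: "of_int_vec m \<in> S" and f: "f = vec_nth m" by auto
    have "m $ i \<in> ?R" for i
    proof -
      have "\<bar>of_int_vec m $ i\<bar> \<le> b" using b[OF m] component_le_norm_cart[of "of_int_vec m" i] by linarith
      then show ?thesis unfolding of_int_vec_def vec_lambda_beta atLeastAtMost_iff by linarith
    qed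
    then show "f \<in> PiE UNIV (\<lambda>_. ?R)" by (simp add: f PiE_UNIV_domain Pi_iff)
  qed
  moreover have "finite (PiE (UNIV :: 'n set) (\<lambda>_. ?R))" by (intro finite_PiE) auto
  ultimately have "finite (vec_nth ` {m :: int ^ 'n. of_int_vec m \<in> S})" by (rule finite_subset)
  then show ?thesis by (rule finite_imageD) (simp add: inj_on_def vec_nth_inject)
qed

text \<open>Multiplying the indicator of the cone by all 1 - x^a leaves the indicator of the
  half-open fundamental parallelepiped. The reflection m \<mapsto> s - m, with s the sum of the
  generators, carries the parallelepiped for (w, \<eta>) to that for (- w, - \<eta>).\<close>

lemma simplicial_reciprocity:
  fixes A :: "(int ^ 'n) set" and w \<eta> :: "real ^ 'n"
  assumes fin: "finite A" and ind: "independent (of_int_vec ` A)"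
    and l: "\<And>a. a \<in> A \<Longrightarrow> lin_form l a \<noteq> (0::int)"
    and \<eta>: "\<And>b. b \<in> of_int_vec ` A \<Longrightarrow> coord (of_int_vec ` A) b \<eta> \<noteq> 0"
  shows "\<exists>c. has_value l (\<lambda>m. of_bool (of_int_vec m - w \<in> half_open_cone (of_int_vec ` A) \<eta>)) c \<and>
      has_value l (\<lambda>m. of_bool (of_int_vec m + w \<in> half_open_cone (of_int_vec ` A) (- \<eta>)))
        ((-1) ^ card A * subst_inv_q c)"
proof -
  let ?A = "of_int_vec ` A"
  define co where "co a = coord ?A (of_int_vec a)" for a
  have fA: "finite ?A" using fin by simp
  have lin: "linear (co a)" for a unfolding co_def using ind by (rule linear_coord)
  note [simp] = linear_add[OF lin] linear_diff[OF lin] linear_neg[OF lin]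
  have co_base: "co a (of_int_vec b) = of_bool (a = b)" if "a \<in> A" "b \<in> A" for a b
    using coord_base[OF ind, of "of_int_vec b" "of_int_vec a"] that inj_of_int_vec
    by (auto simp: co_def inj_def)
  have vec_span: "of_int_vec a \<in> span ?A" if "a \<in> A" for a using that by (auto intro: span_base)
  define H where "H \<eta> a t \<longleftrightarrow> 0 < t \<or> (t = 0 \<and> 0 \<le> co a \<eta>)" for \<eta> a and t :: real
  have cone_iff: "y \<in> half_open_cone ?A \<eta> \<longleftrightarrow> y \<in> span ?A \<and> (\<forall>a\<in>A. H \<eta> a (co a y))" for y \<eta>
    by (auto simp: half_open_cone_def H_def co_def)
  \<comment> \<open>\<open>A0\<close> collects the generators along which the cone has been cut off
    at length one: the empty set gives the cone, all of \<open>A\<close> the parallelepiped.\<close>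
  define inpar where "inpar w \<eta> A0 m \<longleftrightarrow> of_int_vec m - w \<in> span ?A \<and>
      (\<forall>a\<in>A. H \<eta> a (co a (of_int_vec m - w))) \<and> (\<forall>a\<in>A0. \<not> H \<eta> a (co a (of_int_vec m - w) - 1))"
    for w \<eta> A0 m
  define par :: "real ^ 'n \<Rightarrow> real ^ 'n \<Rightarrow> (int ^ 'n) set \<Rightarrow> 'n lattice_fun"
    where "par w \<eta> A0 m = of_bool (inpar w \<eta> A0 m)" for w \<eta> A0 m
  \<comment> \<open>The translate by u consists of the points whose u-coordinate still qualifies
    after subtracting 1; subtracting it cuts these off.\<close>
  have par_insert: "diff_op u (par w \<eta> A0) = par w \<eta> (insert u A0)"
    if u: "u \<in> A" "u \<notin> A0" "A0 \<subseteq> A" for u w \<eta> A0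
  proof
    fix m
    define y where "y = of_int_vec m - w"
    have y': "of_int_vec (m - u) - w = y - of_int_vec u" by (simp add: y_def of_int_vec_diff)
    have sp: "y - of_int_vec u \<in> span ?A \<longleftrightarrow> y \<in> span ?A"
      using span_add_eq2[OF vec_span[OF u(1)], of "y - of_int_vec u"] by simp
    have co': "co a (y - of_int_vec u) = co a y - of_bool (a = u)" if "a \<in> A" for a
      using co_base[OF that u(1)] by simp
    have others: "(\<forall>a\<in>A. H \<eta> a (co a (y - of_int_vec u))) \<longleftrightarrow>
        H \<eta> u (co u y - 1) \<and> (\<forall>a\<in>A - {u}. H \<eta> a (co a y))"
      using u(1) co' by (auto simp del: linear_diff[OF lin])
    have mono: "H \<eta> u (t - 1) \<Longrightarrow> H \<eta> u t" for t by (auto simp: H_def)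
    have A0: "(\<forall>a\<in>A0. \<not> H \<eta> a (co a (y - of_int_vec u) - 1)) \<longleftrightarrow> (\<forall>a\<in>A0. \<not> H \<eta> a (co a y - 1))"
    proof (intro ball_cong refl)
      fix a assume "a \<in> A0"
      then have "co a (y - of_int_vec u) = co a y" using u co'[of a] by auto
      then show "(\<not> H \<eta> a (co a (y - of_int_vec u) - 1)) = (\<not> H \<eta> a (co a y - 1))" by simp
    qed
    have "inpar w \<eta> A0 (m - u) \<longleftrightarrow> inpar w \<eta> A0 m \<and> H \<eta> u (co u y - 1)"
      unfolding inpar_def y' y_def[symmetric] sp others A0 using mono u(1) by blast
    moreover have "inpar w \<eta> (insert u A0) m \<longleftrightarrow> inpar w \<eta> A0 m \<and> \<not> H \<eta> u (co u y - 1)"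
      unfolding inpar_def y_def by blast
    ultimately show "diff_op u (par w \<eta> A0) m = par w \<eta> (insert u A0) m"
      by (auto simp: diff_op_def par_def)
  qed
  obtain as where as: "set as = A" "distinct as" using finite_distinct_list[OF fin] by blast
  have "diff_ops bs (par w \<eta> {}) = par w \<eta> (set bs)" if "set bs \<subseteq> A" "distinct bs" for bs w \<eta>
    using that by (induction bs) (simp_all add: par_insert)
  from this[of as] have ops: "diff_ops as (par w \<eta> {}) = par w \<eta> A" for w \<eta> using as by simp
  have fin_par: "finite (supp (par w \<eta> A))" for w \<eta>
  proof -
    define b where "b = (\<Sum>v\<in>?A. norm v) + norm w"
    have "supp (par w \<eta> A) \<subseteq> {m. of_int_vec m \<in> cball 0 b}"
    proof
      fix m assume "m \<in> supp (par w \<eta> A)"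
      then have m: "inpar w \<eta> A m" by (auto simp: supp_def par_def)
      define y where "y = of_int_vec m - w"
      have "\<bar>coord ?A v y\<bar> \<le> 1" if "v \<in> ?A" for v
        using m that by (fastforce simp: inpar_def H_def y_def co_def)
      then have "norm (\<Sum>v\<in>?A. coord ?A v y *\<^sub>R v) \<le> (\<Sum>v\<in>?A. norm v)"
        by (intro sum_norm_le) (simp add: mult_left_le_one_le)
      moreover have "(\<Sum>v\<in>?A. coord ?A v y *\<^sub>R v) = y"
        using m by (intro sum_coord ind fA) (simp add: inpar_def y_def)
      ultimately have "norm (y + w) \<le> b" unfolding b_def using norm_triangle_ineq[of y w] by simp
      then show "m \<in> {m. of_int_vec m \<in> cball 0 b}" by (simp add: y_def)
    qed
    then show ?thesis using finite_lattice_points[of "cball 0 b"] finite_subset by blast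
  qed
  have nv: "nonvanishing l as" using l as by (auto simp: nonvanishing_def)
  have val: "has_value l (par w \<eta> {}) (fsum l (par w \<eta> A) / denom l as)" for w \<eta>
    unfolding has_value_def using nv fin_par denom_nonzero[OF nv]
    by (intro exI[of _ as]) (simp add: ops)
  have denom: "denom l as = (\<Prod>a\<in>A. 1 - qweight l a)"
    unfolding denom_def as(1)[symmetric] by (rule prod.distinct_set_conv_list[OF as(2), symmetric])
  define s where "s = \<Sum>A"
  have inpar_reflect: "inpar (- w) (- \<eta>) A m \<longleftrightarrow> inpar w \<eta> A (s - m)" for m
  proof -
    define y where "y = of_int_vec (s - m) - w"
    have vs: "of_int_vec s = (\<Sum>a\<in>A. of_int_vec a)" by (simp add: s_def of_int_vec_sum)
    have y': "of_int_vec m - - w = of_int_vec s - y" by (simp add: y_def of_int_vec_diff)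
    have "of_int_vec s \<in> span ?A" unfolding vs by (intro span_sum vec_span)
    then have sp: "of_int_vec s - y \<in> span ?A \<longleftrightarrow> y \<in> span ?A"
      using span_diff[of "of_int_vec s" ?A y] span_diff[of "of_int_vec s" ?A "of_int_vec s - y"] by auto
    have "co a (of_int_vec s) = 1" if "a \<in> A" for a
    proof -
      have "co a (of_int_vec s) = (\<Sum>b\<in>A. of_bool (a = b))"
        unfolding vs linear_sum[OF lin] using that by (intro sum.cong refl co_base)
      also have "\<dots> = 1" using that fin by simp
      finally show ?thesis .
    qed
    then have co': "co a (of_int_vec s - y) = 1 - co a y" if "a \<in> A" for a using that by simp
    \<comment> \<open>Each coordinate ranges over [0,1) or (0,1] according to the sign of
      \<open>co a \<eta>\<close>; t \<mapsto> 1 - t swaps the two, which is where the sign must not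
      be 0.\<close>
    have "H (- \<eta>) a (1 - t) \<and> \<not> H (- \<eta>) a (1 - t - 1) \<longleftrightarrow> H \<eta> a t \<and> \<not> H \<eta> a (t - 1)"
      if "a \<in> A" for a t
    proof -
      have "co a \<eta> \<noteq> 0" using \<eta>[of "of_int_vec a"] that by (simp add: co_def)
      then show ?thesis by (auto simp: H_def)
    qed
    then have "H (- \<eta>) a (co a (of_int_vec s - y)) \<and> \<not> H (- \<eta>) a (co a (of_int_vec s - y) - 1) \<longleftrightarrow>
        H \<eta> a (co a y) \<and> \<not> H \<eta> a (co a y - 1)" if "a \<in> A" for a
      using that unfolding co'[OF that] by blast
    then show ?thesis
      unfolding inpar_def y' sp y_def[symmetric] by blast
  qed
  have supp_par: "supp (par w \<eta> A) = {m. inpar w \<eta> A m}" for w \<eta> by (auto simp: supp_def par_def)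
  have "fsum l (par (- w) (- \<eta>) A) = (\<Sum>m | inpar w \<eta> A (s - m). qweight l m)"
    unfolding fsum_def supp_par inpar_reflect by (intro sum.cong refl) (simp add: par_def inpar_reflect)
  also have "\<dots> = (\<Sum>m | inpar w \<eta> A m. qweight l (s - m))"
    by (rule sum.reindex_bij_witness[of _ "\<lambda>m. s - m" "\<lambda>m. s - m"]) auto
  also have "\<dots> = qweight l s * subst_inv_q (\<Sum>m | inpar w \<eta> A m. qweight l m)"
    by (simp add: qweight_diff subst_inv_q_sum subst_inv_q_qweight sum_distrib_left divide_inverse)
  also have "(\<Sum>m | inpar w \<eta> A m. qweight l m) = fsum l (par w \<eta> A)"
    unfolding fsum_def supp_par by (intro sum.cong refl) (simp add: par_def)
  finally have fsum_refl: "fsum l (par (- w) (- \<eta>) A) = qweight l s * subst_inv_q (fsum l (par w \<eta> A))" .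
  \<comment> \<open>Each factor satisfies 1 - 1/y = - (1/y) (1 - y). The signs give the power of -1,
    and the monomial cancels the one coming from the reflection.\<close>
  have "subst_inv_q (denom l as) = (\<Prod>a\<in>A. (- 1) * inverse (qweight l a) * (1 - qweight l a))"
    unfolding denom subst_inv_q_prod
    by (intro prod.cong refl) (simp add: subst_inv_q_diff subst_inv_q_qweight algebra_simps)
  also have "\<dots> = (- 1) ^ card A * inverse (qweight l s) * denom l as"
    unfolding prod.distrib denom s_def qweight_sum prod_inversef[symmetric] by simp
  finally have denom_refl: "subst_inv_q (denom l as) = (- 1) ^ card A * inverse (qweight l s) * denom l as" .
  have "(-1) ^ card A * subst_inv_q (fsum l (par w \<eta> A) / denom l as)
      = fsum l (par (- w) (- \<eta>) A) / denom l as"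
    unfolding subst_inv_q_divide denom_refl fsum_refl
    using denom_nonzero[OF nv] by (simp add: field_simps)
  moreover have "(\<lambda>m. of_bool (of_int_vec m - w \<in> half_open_cone ?A \<eta>)) = par w \<eta> {}"
    "(\<lambda>m. of_bool (of_int_vec m + w \<in> half_open_cone ?A (- \<eta>))) = par (- w) (- \<eta>) {}"
    by (auto simp: par_def inpar_def cone_iff)
  ultimately show ?thesis using val[of w \<eta>] val[of "- w" "- \<eta>"] by auto
qed

section \<open>Reciprocity for rational cones\<close>

text \<open>The closed cone and its inward-pushed version decompose with the same coefficients
  \<epsilon>, into half-open pieces for \<eta> and - \<eta>. All bases have the same cardinality, so
  the signs agree and simplicial reciprocity adds up.\<close>

lemma cone_reciprocity:
  fixes E :: "(int ^ 'n) set" and w \<eta> :: "real ^ 'n"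
  assumes fin: "finite E" and l: "\<And>a. a \<in> E \<Longrightarrow> lin_form l a \<noteq> (0::int)"
    and dis: "dissection (of_int_vec ` E) \<epsilon> N"
    and \<eta>: "\<eta> \<in> convex_cone hull (of_int_vec ` E)" "\<forall>f \<in> N \<union> coords (of_int_vec ` E). f \<eta> \<noteq> 0"
  shows "\<exists>c. has_value l (\<lambda>m. of_bool (of_int_vec m - w \<in> convex_cone hull (of_int_vec ` E))) c \<and>
      has_value l (\<lambda>m. of_bool (\<exists>\<delta>>0. of_int_vec m + w - \<delta> *\<^sub>R \<eta> \<in> convex_cone hull (of_int_vec ` E)))
        ((-1) ^ dim (of_int_vec ` E) * subst_inv_q c)"
proof -
  let ?E = "of_int_vec ` E"
  have fE: "finite ?E" using fin by simp
  have "\<exists>c. has_value l (\<lambda>m. of_bool (of_int_vec m - w \<in> half_open_cone B \<eta>)) c \<and>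
      has_value l (\<lambda>m. of_bool (of_int_vec m + w \<in> half_open_cone B (- \<eta>)))
        ((-1) ^ dim ?E * subst_inv_q c)" if B: "B \<in> bases ?E" for B
  proof -
    obtain A where A: "A \<subseteq> E" "B = of_int_vec ` A" using basesD(1)[OF B] by (auto simp: subset_image_iff)
    have "card A = card B" unfolding A(2) using inj_of_int_vec
      by (intro card_image[symmetric]) (auto simp: inj_on_def inj_def)
    also have "\<dots> = dim ?E" using basesD[OF B] by (metis dim_span_eq_card_independent dim_span)
    finally have "card A = dim ?E" .
    moreover have "coord B b \<eta> \<noteq> 0" if "b \<in> B" for b using \<eta>(2) B that by (auto simp: coords_def)
    ultimately show ?thesis
      using simplicial_reciprocity[of A l \<eta> w] basesD(2)[OF B] A l finite_subset[OF A(1) fin] by auto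
  qed
  then obtain c where c: "\<And>B. B \<in> bases ?E \<Longrightarrow>
        has_value l (\<lambda>m. of_bool (of_int_vec m - w \<in> half_open_cone B \<eta>)) (c B)"
      "\<And>B. B \<in> bases ?E \<Longrightarrow> has_value l (\<lambda>m. of_bool (of_int_vec m + w \<in> half_open_cone B (- \<eta>)))
        ((-1) ^ dim ?E * subst_inv_q (c B))"
    by metis
  have N: "\<forall>f\<in>N. f \<eta> \<noteq> 0" using \<eta>(2) by auto
  note decomp = half_open_dissection[OF fE dis \<eta>(1) N]
  have "of_bool (y \<in> convex_cone hull ?E)
      = (\<Sum>B\<in>bases ?E. of_int (\<epsilon> B) * of_bool (y \<in> half_open_cone B \<eta>) :: ratfun)" for y
    using arg_cong[OF decomp(1)[of y], of of_int] by simp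
  then have "has_value l (\<lambda>m. of_bool (of_int_vec m - w \<in> convex_cone hull ?E))
      (\<Sum>B\<in>bases ?E. of_int (\<epsilon> B) * c B)"
    using c(1) by (simp add: has_value_sum has_value_scale)
  moreover have "of_bool (\<exists>\<delta>>0. y - \<delta> *\<^sub>R \<eta> \<in> convex_cone hull ?E)
      = (\<Sum>B\<in>bases ?E. of_int (\<epsilon> B) * of_bool (y \<in> half_open_cone B (- \<eta>)) :: ratfun)" for y
    using arg_cong[OF decomp(2)[of y], of of_int] by simp
  then have "has_value l (\<lambda>m. of_bool (\<exists>\<delta>>0. of_int_vec m + w - \<delta> *\<^sub>R \<eta> \<in> convex_cone hull ?E))
      (\<Sum>B\<in>bases ?E. of_int (\<epsilon> B) * ((-1) ^ dim ?E * subst_inv_q (c B)))"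
    using c(2) by (simp add: has_value_sum has_value_scale)
  then have "has_value l (\<lambda>m. of_bool (\<exists>\<delta>>0. of_int_vec m + w - \<delta> *\<^sub>R \<eta> \<in> convex_cone hull ?E))
      ((-1) ^ dim ?E * subst_inv_q (\<Sum>B\<in>bases ?E. of_int (\<epsilon> B) * c B))"
    by (simp add: subst_inv_q_sum subst_inv_q_mult subst_inv_q_of_int sum_distrib_left mult_ac)
  ultimately show ?thesis by blast
qed

section \<open>Brion's formula modulo torsion\<close>

text \<open>The constraint on the b-coordinate is dropped, which adds the line through b to the
  half-open cone. If all generators have height 1, the slice at height t is, up to boundary, the
  tangent cone at a vertex of the t-dilated simplex.\<close>

definition tangent_cone :: "'a::real_vector set \<Rightarrow> 'a \<Rightarrow> 'a \<Rightarrow> 'a set" where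
  "tangent_cone B \<sigma> b = {y \<in> span B. \<forall>b'\<in>B - {b}. 0 < coord B b' y \<or> (coord B b' y = 0 \<and> 0 \<le> coord B b' \<sigma>)}"

text \<open>Not all generator coordinates of a point of nonnegative height are negative. Expanding the
  product of the complementary indicators gives Brion's formula for a simplex, up to the
  indicators of regions that contain a line.\<close>

lemma simplex_brion:
  fixes B :: "((real ^ 'n) \<times> real) set" and z :: "(real ^ 'n) \<times> real \<Rightarrow> int ^ 'n"
  assumes ind: "independent B" and fin: "finite B" and ht: "\<And>b. b \<in> B \<Longrightarrow> snd b = 1"
    and p: "p > 0" and z: "\<And>b. b \<in> B \<Longrightarrow> of_int_vec (z b) = p *\<^sub>R fst b"
    and t: "0 < t \<or> (t = 0 \<and> (\<exists>b\<in>B. 0 \<le> coord B b \<sigma>))"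
  shows "torsion (\<lambda>m. of_bool ((of_int_vec m, t) \<in> half_open_cone B \<sigma>)
           - (\<Sum>b\<in>B. of_bool ((of_int_vec m, t) \<in> tangent_cone B \<sigma> b)))"
proof -
  define y where "y m = (of_int_vec m :: real ^ 'n, t)" for m
  define H where "H b m \<longleftrightarrow> 0 < coord B b (y m) \<or> (coord B b (y m) = 0 \<and> 0 \<le> coord B b \<sigma>)" for b m
  define h :: "((real ^ 'n) \<times> real) set \<Rightarrow> 'n lattice_fun"
    where "h I m = of_bool (y m \<in> span B) * (\<Prod>b\<in>I. of_bool (H b m))" for I m
  \<comment> \<open>The subsets of \<open>B\<close> that omit at least two generators.\<close>
  define R where "R = Pow B - insert B ((\<lambda>b. B - {b}) ` B)"
  \<comment> \<open>All generators have height 1, so the coordinates sum to the height t and cannot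
    all be negative. If t = 0 and all of them vanish, the assumption on \<sigma> settles the
    tie.\<close>
  have H_ex: "\<exists>b\<in>B. H b m" if "y m \<in> span B" for m
  proof (rule ccontr)
    assume "\<not> (\<exists>b\<in>B. H b m)"
    then have neg: "coord B b (y m) \<le> 0" "coord B b (y m) = 0 \<Longrightarrow> coord B b \<sigma> < 0" if "b \<in> B" for b
      using that by (force simp: H_def not_less not_le)+
    have "t = snd (\<Sum>b\<in>B. coord B b (y m) *\<^sub>R b)"
      using sum_coord[OF ind fin that] by (simp add: y_def)
    also have "\<dots> = (\<Sum>b\<in>B. coord B b (y m))" using ht by (simp add: snd_sum)
    finally have sum: "t = (\<Sum>b\<in>B. coord B b (y m))" .
    moreover have "(\<Sum>b\<in>B. coord B b (y m)) \<le> 0" using neg by (intro sum_nonpos) auto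
    ultimately have "t = 0" using t by auto
    then have "\<forall>b\<in>B. coord B b (y m) = 0"
      using sum sum_nonneg_eq_0_iff[OF fin, of "\<lambda>b. - coord B b (y m)"] neg by (auto simp: sum_negf)
    then show False using t neg(2) \<open>t = 0\<close> by force
  qed
  have vanish: "(\<Sum>I\<in>Pow B. (-1) ^ card I * h I m) = 0" for m
  proof (cases "y m \<in> span B")
    case True
    then have "(0::ratfun) = (\<Prod>b\<in>B. 1 - of_bool (H b m))"
      using H_ex[OF True] fin by (auto intro!: prod_zero[symmetric])
    also have "\<dots> = (\<Sum>I\<in>Pow B. (-1) ^ card I * (\<Prod>b\<in>I. of_bool (H b m)) * (\<Prod>b\<in>B - I. 1))"
      by (rule prod_diff_conv_sum[OF fin])
    finally show ?thesis using True by (simp add: h_def)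
  qed (simp add: h_def)
  have h_eq: "h I m = of_bool (y m \<in> span B \<and> (\<forall>b\<in>I. H b m))" if "I \<subseteq> B" for I m
  proof (cases "\<forall>b\<in>I. H b m")
    case False
    moreover have "finite I" using that fin by (rule finite_subset)
    ultimately have "(\<Prod>b\<in>I. of_bool (H b m)) = (0 :: ratfun)" by (intro prod_zero) auto
    with False show ?thesis by (simp only: h_def) auto
  qed (simp add: h_def)
  have h_B: "h B m = of_bool (y m \<in> half_open_cone B \<sigma>)" for m
    by (subst h_eq) (simp_all add: half_open_cone_def H_def)
  have h_remove: "h (B - {b}) m = of_bool (y m \<in> tangent_cone B \<sigma> b)" for b m
    by (subst h_eq) (auto simp: tangent_cone_def H_def)
  have "torsion (h I)" if I: "I \<in> R" for I
  proof -
    have sub: "I \<subseteq> B" "I \<noteq> B" "\<And>b. b \<in> B \<Longrightarrow> I \<noteq> B - {b}" using I by (auto simp: R_def)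
    then obtain b1 where b1: "b1 \<in> B" "b1 \<notin> I" by blast
    with sub obtain b2 where b2: "b2 \<in> B" "b2 \<notin> I" "b2 \<noteq> b1" by blast
    \<comment> \<open>The difference of two omitted generators is horizontal and leaves the
      coordinates in \<open>I\<close> unchanged. Scaled by p it becomes a lattice vector, hence a
      period of the region.\<close>
    have "fst b1 \<noteq> fst b2" using b1 b2 ht by (metis prod_eqI)
    then have "of_int_vec (z b1) \<noteq> of_int_vec (z b2)" using z b1 b2 p by simp
    then have ne: "z b1 - z b2 \<noteq> 0" by auto
    have shift: "y (m - (z b1 - z b2)) = y m - p *\<^sub>R (b1 - b2)" for m
      using b1 b2 ht z by (simp add: y_def of_int_vec_diff of_int_vec_add prod_eq_iff algebra_simps)
    have "p *\<^sub>R (b1 - b2) \<in> span B" using b1 b2 by (intro span_scale span_diff span_base)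
    then have sp: "y m - p *\<^sub>R (b1 - b2) \<in> span B \<longleftrightarrow> y m \<in> span B" for m
      using span_add_eq2[of "p *\<^sub>R (b1 - b2)" B "y m - p *\<^sub>R (b1 - b2)"] by simp
    have "coord B b (y m - p *\<^sub>R (b1 - b2)) = coord B b (y m)" if "b \<in> I" for b m
      using linear_coord[OF ind, of b] b1 b2 that ind
      by (auto simp: linear_diff linear_scale coord_base)
    then have "h I (m - (z b1 - z b2)) = h I m" for m
      unfolding h_def H_def shift sp by (intro arg_cong2[of _ _ _ _ "(*)"] prod.cong refl) simp
    then show ?thesis by (rule torsion_periodic[OF ne])
  qed
  then have "torsion (\<lambda>m. (-1) ^ (card B + 1) * (\<Sum>I\<in>R. (-1) ^ card I * h I m))"
    by (intro torsion_scale torsion_sum)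
  \<comment> \<open>The vanishing alternating sum is solved for the full set and the sets with one
    generator omitted, which carry opposite signs.\<close>
  moreover have "(-1) ^ (card B + 1) * (\<Sum>I\<in>R. (-1) ^ card I * h I m)
      = of_bool (y m \<in> half_open_cone B \<sigma>) - (\<Sum>b\<in>B. of_bool (y m \<in> tangent_cone B \<sigma> b))" for m
  proof -
    let ?f = "\<lambda>I. (-1) ^ card I * h I m"
    have notin: "B \<notin> (\<lambda>b. B - {b}) ` B" by auto
    have "0 = (\<Sum>I\<in>R. ?f I) + (\<Sum>I\<in>insert B ((\<lambda>b. B - {b}) ` B). ?f I)"
      unfolding vanish[of m, symmetric] R_def using fin by (intro sum.subset_diff) auto
    also have "(\<Sum>I\<in>insert B ((\<lambda>b. B - {b}) ` B). ?f I) = ?f B + (\<Sum>I\<in>(\<lambda>b. B - {b}) ` B. ?f I)"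
      using fin notin by (intro sum.insert) auto
    also have "(\<Sum>I\<in>(\<lambda>b. B - {b}) ` B. ?f I) = (\<Sum>b\<in>B. ?f (B - {b}))"
    proof (rule sum.reindex_cong[OF _ refl refl])
      show "inj_on (\<lambda>b. B - {b}) B"
      proof (rule inj_onI)
        fix x y assume xy: "x \<in> B" "B - {x} = B - {y}"
        have "x \<notin> B - {x}" by simp
        then show "x = y" unfolding xy(2) using xy(1) by simp
      qed
    qed
    also have "(\<Sum>b\<in>B. ?f (B - {b})) = (\<Sum>b\<in>B. - ((-1) ^ card B) * of_bool (y m \<in> tangent_cone B \<sigma> b))"
    proof (rule sum.cong[OF refl])
      fix b assume "b \<in> B"
      then have eq: "card B = Suc (card (B - {b}))" by (rule card.remove[OF fin])
      then show "?f (B - {b}) = - ((-1) ^ card B) * of_bool (y m \<in> tangent_cone B \<sigma> b)"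
        unfolding h_remove eq by (simp only: power_Suc mult_minus1 minus_minus)
    qed
    also have "\<dots> = - ((-1) ^ card B) * (\<Sum>b\<in>B. of_bool (y m \<in> tangent_cone B \<sigma> b))"
      by (simp add: sum_distrib_left sum_negf)
    finally have "(\<Sum>I\<in>R. ?f I) = - ((-1) ^ card B) * (of_bool (y m \<in> half_open_cone B \<sigma>)
        - (\<Sum>b\<in>B. of_bool (y m \<in> tangent_cone B \<sigma> b)))"
      unfolding h_B by (simp add: algebra_simps)
    then show ?thesis by (simp add: power_add[symmetric] flip: mult.assoc power_mult_distrib)
  qed
  ultimately show ?thesis by (simp add: y_def)
qed

text \<open>The decomposition is evaluated at y + s v for large s. If v is in \<open>B\<close>, its
  coordinate becomes positive and that constraint disappears. Otherwise v lies outside the cone of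
  \<open>B\<close>, so some coordinate of v is negative and the piece is eventually left.\<close>

lemma tangent_cone_sum:
  fixes U :: "'a::real_vector set"
  assumes fin: "finite U" and v: "v \<in> U" "v \<notin> convex_cone hull (U - {v})"
    and X: "\<And>y. of_bool (X y) = (\<Sum>B\<in>bases U. \<epsilon> B * of_bool (y \<in> half_open_cone B \<sigma>))"
    and Q: "eventually (\<lambda>s. X (y + s *\<^sub>R v) = Q) at_top"
  shows "of_bool Q = (\<Sum>B | B \<in> bases U \<and> v \<in> B. \<epsilon> B * of_bool (y \<in> tangent_cone B \<sigma> v) :: int)"
proof -
  have "eventually (\<lambda>s. y + s *\<^sub>R v \<in> half_open_cone B \<sigma> \<longleftrightarrow> v \<in> B \<and> y \<in> tangent_cone B \<sigma> v) at_top"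
    if B: "B \<in> bases U" for B
  proof -
    note BB = basesD[OF B] and fB = finite_basis[OF fin B]
    have vs: "v \<in> span B" using v(1) BB(3) by (auto intro: span_base)
    have sp: "y + s *\<^sub>R v \<in> span B \<longleftrightarrow> y \<in> span B" for s
      using vs by (simp add: span_add_eq2 span_scale)
    have co: "coord B b (y + s *\<^sub>R v) = coord B b y + s * coord B b v" for b s
      using linear_coord[OF BB(2)] by (simp add: linear_add linear_scale)
    show ?thesis
    proof (cases "v \<in> B")
      case True
      have "eventually (\<lambda>s. - coord B v y < s) at_top" by (rule eventually_gt_at_top)
      then show ?thesis
      proof eventually_elim
        case (elim s)
        have "coord B b (y + s *\<^sub>R v) = coord B b y" if "b \<in> B - {v}" for b
          using that True BB(2) by (auto simp: co coord_base)
        moreover have "coord B v (y + s *\<^sub>R v) = coord B v y + s"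
          using True BB(2) by (simp add: co coord_base)
        moreover have "(\<forall>b\<in>B. P b) \<longleftrightarrow> P v \<and> (\<forall>b\<in>B - {v}. P b)" for P using True by auto
        ultimately show ?case
          using True elim by (simp add: half_open_cone_def tangent_cone_def sp)
      qed
    next
      case False
      then have "convex_cone hull B \<subseteq> convex_cone hull (U - {v})" using BB(1) by (intro hull_mono) auto
      then obtain b where b: "b \<in> B" "coord B b v < 0"
        using v(2) vs convex_cone_hull_independent[OF BB(2) fB, of v] by (meson not_le subsetD)
      have "eventually (\<lambda>s. coord B b y / (- coord B b v) < s) at_top" by (rule eventually_gt_at_top)
      then show ?thesis
      proof eventually_elim
        case (elim s)
        then have "coord B b (y + s *\<^sub>R v) < 0" using b(2) by (simp add: co field_simps)
        then have "y + s *\<^sub>R v \<notin> half_open_cone B \<sigma>" using b(1) by (force simp: half_open_cone_def)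
        then show ?case using False by blast
      qed
    qed
  qed
  then have "eventually (\<lambda>s. \<forall>B\<in>bases U. y + s *\<^sub>R v \<in> half_open_cone B \<sigma> \<longleftrightarrow>
      v \<in> B \<and> y \<in> tangent_cone B \<sigma> v) at_top"
    by (intro eventually_ball_finite finite_bases fin) auto
  with Q have "eventually (\<lambda>s::real. of_bool Q =
      (\<Sum>B\<in>bases U. \<epsilon> B * of_bool (v \<in> B \<and> y \<in> tangent_cone B \<sigma> v))) at_top"
  proof eventually_elim
    case (elim s)
    then show ?case using X[of "y + s *\<^sub>R v"] by (simp cong: sum.cong)
  qed
  then have "of_bool Q = (\<Sum>B\<in>bases U. \<epsilon> B * of_bool (v \<in> B \<and> y \<in> tangent_cone B \<sigma> v))" by simp
  also have "\<dots> = (\<Sum>B | B \<in> bases U \<and> v \<in> B. \<epsilon> B * of_bool (y \<in> tangent_cone B \<sigma> v))"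
    using finite_bases[OF fin] by (intro sum.mono_neutral_cong_right) auto
  finally show ?thesis .
qed

lemma brion_torsion:
  fixes \<epsilon> :: "((real ^ 'n) \<times> real) set \<Rightarrow> int" and U :: "((real ^ 'n) \<times> real) set" and z :: "(real ^ 'n) \<times> real \<Rightarrow> int ^ 'n"
  assumes fin: "finite U" and ht: "\<And>b. b \<in> U \<Longrightarrow> snd b = 1"
    and vert: "\<And>v. v \<in> U \<Longrightarrow> v \<notin> convex_cone hull (U - {v})"
    and p: "p > 0" and z: "\<And>b. b \<in> U \<Longrightarrow> of_int_vec (z b) = p *\<^sub>R fst b"
    and t: "0 < t \<or> (t = 0 \<and> (\<forall>B\<in>bases U. \<exists>b\<in>B. 0 \<le> coord B b \<sigma>))"
    and X: "\<And>y. of_bool (X y) = (\<Sum>B\<in>bases U. \<epsilon> B * of_bool (y \<in> half_open_cone B \<sigma>))"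
    and Q: "\<And>v m. v \<in> U \<Longrightarrow> eventually (\<lambda>s. X ((of_int_vec m, t) + s *\<^sub>R v) = Q v m) at_top"
  shows "torsion (\<lambda>m. of_bool (X (of_int_vec m, t)) - (\<Sum>v\<in>U. of_bool (Q v m)))"
proof -
  have "torsion (\<lambda>m. \<Sum>B\<in>bases U. of_int (\<epsilon> B) * (of_bool ((of_int_vec m, t) \<in> half_open_cone B \<sigma>)
      - (\<Sum>b\<in>B. of_bool ((of_int_vec m, t) \<in> tangent_cone B \<sigma> b))))"
  proof (intro torsion_sum torsion_scale)
    fix B assume B: "B \<in> bases U"
    note BB = basesD[OF B]
    show "torsion (\<lambda>m. of_bool ((of_int_vec m, t) \<in> half_open_cone B \<sigma>)
        - (\<Sum>b\<in>B. of_bool ((of_int_vec m, t) \<in> tangent_cone B \<sigma> b)))"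
    proof (rule simplex_brion[OF BB(2) finite_basis[OF fin B] _ p])
      show "snd b = 1" "of_int_vec (z b) = p *\<^sub>R fst b" if "b \<in> B" for b
        using ht[of b] z[of b] that BB(1) by blast+
      show "0 < t \<or> (t = 0 \<and> (\<exists>b\<in>B. 0 \<le> coord B b \<sigma>))" using t B by blast
    qed
  qed
  moreover have "(\<Sum>B\<in>bases U. of_int (\<epsilon> B) * (of_bool (y \<in> half_open_cone B \<sigma>)
      - (\<Sum>b\<in>B. of_bool (y \<in> tangent_cone B \<sigma> b)))) =
      (of_bool (X y) - (\<Sum>v\<in>U. of_bool (Q v m)) :: ratfun)" if y: "y = (of_int_vec m, t)" for m y
  proof -
    have "(\<Sum>v\<in>U. of_bool (Q v m)) = (\<Sum>v\<in>U. \<Sum>B | B \<in> bases U \<and> v \<in> B.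
        \<epsilon> B * of_bool (y \<in> tangent_cone B \<sigma> v))"
      using tangent_cone_sum[OF fin _ vert X Q] y by (intro sum.cong) auto
    also have "\<dots> = (\<Sum>B\<in>bases U. \<Sum>v | v \<in> U \<and> v \<in> B. \<epsilon> B * of_bool (y \<in> tangent_cone B \<sigma> v))"
      by (rule sum.swap_restrict[OF fin finite_bases[OF fin]])
    also have "\<dots> = (\<Sum>B\<in>bases U. \<Sum>v\<in>B. \<epsilon> B * of_bool (y \<in> tangent_cone B \<sigma> v))"
      using basesD(1) by (intro sum.cong) auto
    finally have "of_bool (X y) - (\<Sum>v\<in>U. of_bool (Q v m)) =
        (\<Sum>B\<in>bases U. \<epsilon> B * (of_bool (y \<in> half_open_cone B \<sigma>)
        - (\<Sum>b\<in>B. of_bool (y \<in> tangent_cone B \<sigma> b))))"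
      unfolding X by (simp add: sum_subtractf right_diff_distrib sum_distrib_left)
    from arg_cong[OF this, of "of_int :: int \<Rightarrow> ratfun"] show ?thesis by simp
  qed
  ultimately show ?thesis by simp
qed

section \<open>The cone at a vertex is generated by the edges\<close>

lemma extreme_point_notin_hull:
  assumes "v extreme_point_of (convex hull V)"
  shows "v \<notin> convex hull (V - {v})"
proof -
  have "convex hull (V - {v}) \<subseteq> convex hull V - {v}"
    using assms extreme_point_of_stillconvex[of "convex hull V" v] hull_subset[of V convex]
    by (intro hull_minimal) auto
  then show ?thesis by auto
qed

lemma extreme_point_functional:
  fixes V :: "'a::euclidean_space set"
  assumes "finite V" "v extreme_point_of (convex hull V)"
  shows "\<exists>h. linear h \<and> (\<forall>w\<in>V - {v}. 0 < (h (w - v) :: real))"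
proof -
  have "v \<notin> convex hull (V - {v})" using assms(2) by (rule extreme_point_notin_hull)
  moreover have "closed (convex hull (V - {v}))"
    using assms(1) by (intro compact_imp_closed finite_imp_compact_convex_hull) auto
  ultimately obtain a b where ab: "a \<bullet> v < b" "\<forall>x\<in>convex hull (V - {v}). b < a \<bullet> x"
    using separating_hyperplane_closed_point[of "convex hull (V - {v})" v] by auto
  show ?thesis
  proof (intro exI[of _ "\<lambda>x. a \<bullet> x"] conjI ballI)
    show "linear (\<lambda>x. a \<bullet> x)" by (simp add: bounded_linear.linear bounded_linear_inner_right)
    fix w assume "w \<in> V - {v}"
    then have "b < a \<bullet> w" using ab(2) by (simp add: hull_inc)
    then show "0 < a \<bullet> (w - v)" using ab(1) by (simp add: inner_diff_right)
  qed
qed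

lemma exists_minimal_generators:
  assumes "finite D"
  shows "\<exists>G\<subseteq>D. convex_cone hull G = convex_cone hull D \<and> (\<forall>g\<in>G. g \<notin> convex_cone hull (G - {g}))"
  using assms
proof (induction D rule: finite_psubset_induct)
  case (psubset D)
  show ?case
  proof (cases "\<exists>g\<in>D. g \<in> convex_cone hull (D - {g})")
    case True
    then obtain g where g: "g \<in> D" "g \<in> convex_cone hull (D - {g})" by blast
    have "D - {g} \<subset> D" using g(1) by auto
    then obtain G where G: "G \<subseteq> D - {g}" "convex_cone hull G = convex_cone hull (D - {g})"
      "\<forall>g\<in>G. g \<notin> convex_cone hull (G - {g})" using psubset.IH[OF \<open>D - {g} \<subset> D\<close>] by metis
    have "D \<subseteq> convex_cone hull (D - {g})" using g(2) by (auto intro: hull_inc)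
    then have "convex_cone hull D \<subseteq> convex_cone hull (D - {g})"
      by (rule hull_minimal) (rule convex_cone_convex_cone_hull)
    moreover have "convex_cone hull (D - {g}) \<subseteq> convex_cone hull D" by (intro hull_mono) auto
    ultimately have "convex_cone hull (D - {g}) = convex_cone hull D" by (rule antisym[rotated])
    with G show ?thesis by (intro exI[of _ G]) auto
  qed blast
qed

text \<open>Collecting the g-terms of a + b = s g expresses r g by the other generators with
  nonnegative coefficients. Minimality of g excludes r > 0, and positivity of h then forces all
  those coefficients to vanish.\<close>

lemma minimal_generator_extreme_ray:
  fixes h :: "'a::real_vector \<Rightarrow> real"
  assumes "finite G" "g \<in> G" "g \<notin> convex_cone hull (G - {g})"
    and h: "linear h" "\<And>x. x \<in> G \<Longrightarrow> 0 < h x"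
    and ab: "a \<in> convex_cone hull G" "b \<in> convex_cone hull G" "a + b = s *\<^sub>R g"
  shows "\<exists>t\<ge>0. a = t *\<^sub>R g"
proof -
  obtain c d where c: "\<forall>u\<in>G. 0 \<le> c u" "a = (\<Sum>u\<in>G. c u *\<^sub>R u)"
    and d: "\<forall>u\<in>G. 0 \<le> d u" "b = (\<Sum>u\<in>G. d u *\<^sub>R u)"
    using ab(1,2) unfolding convex_cone_hull_finite[OF assms(1)] by blast
  define r where "r = s - c g - d g"
  have "a + b = (c g + d g) *\<^sub>R g + (\<Sum>u\<in>G - {g}. (c u + d u) *\<^sub>R u)"
    unfolding c(2) d(2) using assms(1,2)
    by (simp add: sum.remove[of G g] sum.distrib scaleR_add_left)
  then have eq: "r *\<^sub>R g = (\<Sum>u\<in>G - {g}. (c u + d u) *\<^sub>R u)"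
    unfolding ab(3) r_def by (simp add: algebra_simps)
  have "r \<le> 0"
  proof (rule ccontr)
    assume "\<not> r \<le> 0"
    then have "g = (1 / r) *\<^sub>R (\<Sum>u\<in>G - {g}. (c u + d u) *\<^sub>R u)" unfolding eq[symmetric] by simp
    also have "(\<Sum>u\<in>G - {g}. (c u + d u) *\<^sub>R u) \<in> convex_cone hull (G - {g})"
      using assms(1) c(1) d(1) by (auto simp: convex_cone_hull_finite intro!: exI[of _ "\<lambda>u. c u + d u"])
    then have "(1 / r) *\<^sub>R (\<Sum>u\<in>G - {g}. (c u + d u) *\<^sub>R u) \<in> convex_cone hull (G - {g})"
      using \<open>\<not> r \<le> 0\<close> by (intro convex_cone_hull_mul) auto
    finally show False using assms(3) by simp
  qed
  have "r * h g = (\<Sum>u\<in>G - {g}. (c u + d u) * h u)"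
    using arg_cong[OF eq, of h] h(1) by (simp add: linear_scale linear_sum)
  moreover have "r * h g \<le> 0" using \<open>r \<le> 0\<close> h(2)[OF assms(2)] by (simp add: mult_nonpos_nonneg)
  moreover have nonneg: "\<forall>u\<in>G - {g}. 0 \<le> (c u + d u) * h u"
  proof
    fix u assume "u \<in> G - {g}"
    then have "0 \<le> c u + d u" "0 \<le> h u" using c(1) d(1) h(2)[of u] by auto
    then show "0 \<le> (c u + d u) * h u" by (rule mult_nonneg_nonneg)
  qed
  ultimately have "(\<Sum>u\<in>G - {g}. (c u + d u) * h u) = 0"
    using sum_nonneg[of "G - {g}" "\<lambda>u. (c u + d u) * h u"] by force
  then have "\<forall>u\<in>G - {g}. (c u + d u) * h u = 0"
    using nonneg assms(1) by (subst (asm) sum_nonneg_eq_0_iff) auto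
  then have "c u = 0" if "u \<in> G - {g}" for u
    using that h(2)[of u] c(1) d(1) by (auto simp: add_nonneg_eq_0_iff)
  then have "a = c g *\<^sub>R g" unfolding c(2) using assms(1,2) by (simp add: sum.remove[of G g])
  then show ?thesis using c(1) assms(2) by auto
qed

lemma vertex_cone_contains:
  assumes "finite V" "x \<in> convex hull V"
  shows "x - v \<in> convex_cone hull ((\<lambda>w. w - v) ` V)"
proof -
  have "(+) (- v) ` (convex hull V) = convex hull ((+) (- v) ` V)" by (rule convex_hull_translation[symmetric])
  then have "x - v \<in> convex hull ((\<lambda>w. w - v) ` V)"
    using assms(2) by (auto simp: image_iff)
  then show ?thesis using convex_hull_subset_convex_cone_hull by blast
qed

text \<open>A minimal generator of the cone spans an extreme ray, so the ray from v in its direction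
  cuts P in a face; that face is an edge, and its far end is an adjacent vertex.\<close>

lemma vertex_cone_edges:
  fixes P :: "'a::euclidean_space set"
  assumes V: "V = {v. v extreme_point_of P}" and fin: "finite V" and P: "P = convex hull V"
    and v: "v \<in> V"
  shows "convex_cone hull ((\<lambda>w. w - v) ` V)
    = convex_cone hull ((\<lambda>w. w - v) ` {w. adjacent_vertices P v w})" (is "?K = ?L")
proof
  have "{w. adjacent_vertices P v w} \<subseteq> V" by (auto simp: adjacent_vertices_def V)
  then show "?L \<subseteq> ?K" by (intro hull_mono image_mono)
next
  \<comment> \<open>The zero vector coming from w = v is left out so that h is strictly positive on
    all generators.\<close>
  let ?D = "(\<lambda>w. w - v) ` (V - {v})"
  have convP: "convex P" and compP: "compact P" unfolding P by (simp_all add: fin finite_imp_compact_convex_hull)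
  obtain h where h: "linear h" "\<And>w. w \<in> V - {v} \<Longrightarrow> 0 < (h (w - v) :: real)"
    using extreme_point_functional[OF fin, of v] v P V by blast
  obtain G where G: "G \<subseteq> ?D" "convex_cone hull G = convex_cone hull ?D"
    "\<And>g. g \<in> G \<Longrightarrow> g \<notin> convex_cone hull (G - {g})"
    using exists_minimal_generators[of ?D] fin by auto
  have finG: "finite G" using G(1) fin finite_subset by blast
  have hG: "0 < h g" if "g \<in> G" for g using that G(1) h(2) by auto
  have "(\<lambda>w. w - v) ` V \<subseteq> convex_cone hull ?D"
  proof (clarify)
    fix w assume "w \<in> V"
    then show "w - v \<in> convex_cone hull ?D"
      by (cases "w = v") (auto simp: convex_cone_hull_contains_0 intro: hull_inc)
  qed
  then have "?K \<subseteq> convex_cone hull ?D" by (rule hull_minimal) (rule convex_cone_convex_cone_hull)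
  then have KG: "?K \<subseteq> convex_cone hull G" using G(2) by simp
  have "G \<subseteq> ?L"
  proof
    fix g assume g: "g \<in> G"
    then obtain w0 where w0: "w0 \<in> V" "w0 \<noteq> v" "g = w0 - v" using G(1) by auto
    define F where "F = P \<inter> {x. \<exists>s\<ge>0. x = v + s *\<^sub>R g}"
    have vP: "v \<in> P" and w0P: "w0 \<in> P" using v w0 P by (auto intro: hull_inc)
    have vF: "v \<in> F" unfolding F_def using vP by (auto intro!: exI[of _ 0])
    have w0F: "w0 \<in> F" unfolding F_def using w0P w0 by (auto intro!: exI[of _ 1])
    have "F face_of P"
      unfolding face_of_def
    proof (intro conjI ballI impI)
      show "F \<subseteq> P" by (auto simp: F_def)
      have "convex {x. \<exists>s\<ge>0. x = v + s *\<^sub>R g}"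
      proof (rule convexI)
        fix x y and \<alpha> \<beta> :: real
        assume "x \<in> {x. \<exists>s\<ge>0. x = v + s *\<^sub>R g}" "y \<in> {x. \<exists>s\<ge>0. x = v + s *\<^sub>R g}"
          and \<alpha>: "0 \<le> \<alpha>" "0 \<le> \<beta>" "\<alpha> + \<beta> = 1"
        then obtain s t where st: "0 \<le> s" "0 \<le> t" "x = v + s *\<^sub>R g" "y = v + t *\<^sub>R g" by blast
        have "\<alpha> *\<^sub>R x + \<beta> *\<^sub>R y = (\<alpha> + \<beta>) *\<^sub>R v + (\<alpha> * s + \<beta> * t) *\<^sub>R g"
          unfolding st by (simp add: algebra_simps)
        then show "\<alpha> *\<^sub>R x + \<beta> *\<^sub>R y \<in> {x. \<exists>s\<ge>0. x = v + s *\<^sub>R g}"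
          using \<alpha> st by (auto intro!: exI[of _ "\<alpha> * s + \<beta> * t"])
      qed
      then show "convex F" unfolding F_def using convP by (intro convex_Int)
    next
      fix a b x assume ab: "a \<in> P" "b \<in> P" and x: "x \<in> F" "x \<in> open_segment a b"
      obtain \<theta> where \<theta>: "0 < \<theta>" "\<theta> < 1" "x = (1 - \<theta>) *\<^sub>R a + \<theta> *\<^sub>R b"
        using x(2) by (auto simp: in_segment)
      obtain s where s: "x = v + s *\<^sub>R g" using x(1) by (auto simp: F_def)
      \<comment> \<open>A convex decomposition of x, seen from v, is a decomposition of a point of
        the ray into two elements of the cone; extremality puts both on the ray.\<close>
      define a' b' where "a' = (1 - \<theta>) *\<^sub>R (a - v)" and "b' = \<theta> *\<^sub>R (b - v)"
      have "a - v \<in> convex_cone hull G" "b - v \<in> convex_cone hull G"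
        using vertex_cone_contains[OF fin, of _ v] ab P KG by auto
      then have cone: "a' \<in> convex_cone hull G" "b' \<in> convex_cone hull G"
        unfolding a'_def b'_def using \<theta> by (auto intro: convex_cone_hull_mul)
      have sum: "a' + b' = s *\<^sub>R g"
      proof -
        have "a' + b' = x - v" unfolding \<theta>(3) a'_def b'_def by (simp add: algebra_simps)
        then show ?thesis using s by simp
      qed
      note ray = minimal_generator_extreme_ray[OF finG g G(3)[OF g] h(1) hG]
      obtain t1 where t1: "t1 \<ge> 0" "a' = t1 *\<^sub>R g" using ray[OF _ cone sum] by blast
      obtain t2 where t2: "t2 \<ge> 0" "b' = t2 *\<^sub>R g" using ray[OF _ cone(2,1)] sum by (auto simp: add.commute)
      have "a - v = (1 / (1 - \<theta>)) *\<^sub>R a'" using \<theta> by (simp add: a'_def)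
      then have "a = v + (t1 / (1 - \<theta>)) *\<^sub>R g" unfolding t1(2) by (simp add: algebra_simps)
      moreover have "b - v = (1 / \<theta>) *\<^sub>R b'" using \<theta> by (simp add: b'_def)
      then have "b = v + (t2 / \<theta>) *\<^sub>R g" unfolding t2(2) by (simp add: algebra_simps)
      moreover have "0 \<le> t1 / (1 - \<theta>)" "0 \<le> t2 / \<theta>" using \<theta> t1(1) t2(1) by auto
      ultimately show "a \<in> F" "b \<in> F" using ab unfolding F_def by blast+
    qed
    define W where "W = {x. x extreme_point_of F}"
    have WV: "W \<subseteq> V \<inter> F"
      using extreme_point_of_face[OF \<open>F face_of P\<close>] by (auto simp: W_def V)
    then have finW: "finite W" using fin finite_subset by blast
    have FW: "F = convex hull W"
      unfolding W_def
      by (rule Krein_Milman_Minkowski[OF face_of_imp_compact[OF convP compP \<open>F face_of P\<close>]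
            face_of_imp_convex[OF \<open>F face_of P\<close>]])
    have "W \<noteq> {}" using FW w0F by auto
    \<comment> \<open>h increases along the ray, so a maximizer among the extreme points of F is the
      end of F away from v.\<close>
    define M where "M = Max ((\<lambda>x. h (x - v)) ` W)"
    have "M \<in> (\<lambda>x. h (x - v)) ` W" unfolding M_def using finW \<open>W \<noteq> {}\<close> by (intro Max_in) auto
    then obtain w where w: "w \<in> W" "h (w - v) = M" by auto
    have wmax: "h (x - v) \<le> h (w - v)" if "x \<in> W" for x
      unfolding w(2) M_def using finW that by simp
    obtain r where r: "r \<ge> 0" "w = v + r *\<^sub>R g" using w(1) WV by (auto simp: F_def)
    have hr: "h (w - v) = r * h g" using h(1) by (simp add: r linear_scale)
    have seg: "W \<subseteq> closed_segment v w"
    proof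
      fix x assume x: "x \<in> W"
      then obtain s where s: "s \<ge> 0" "x = v + s *\<^sub>R g" using WV by (auto simp: F_def)
      have "s * h g \<le> r * h g" using wmax[OF x] h(1) hr by (simp add: s linear_scale)
      then have "s \<le> r" using hG[OF g] by simp
      show "x \<in> closed_segment v w"
      proof (cases "r = 0")
        case True
        then show ?thesis using \<open>s \<le> r\<close> s by simp
      next
        case False
        then have "x = (1 - s / r) *\<^sub>R v + (s / r) *\<^sub>R w" unfolding s r by (simp add: algebra_simps)
        then show ?thesis
          unfolding in_segment using s r False \<open>s \<le> r\<close> by (intro exI[of _ "s / r"]) auto
      qed
    qed
    have "F = closed_segment v w"
    proof
      show "F \<subseteq> closed_segment v w" unfolding FW using seg by (intro hull_minimal) auto
      show "closed_segment v w \<subseteq> F"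
        using vF w(1) WV face_of_imp_convex[OF \<open>F face_of P\<close>] by (intro closed_segment_subset) auto
    qed
    have "w \<noteq> v"
    proof
      assume "w = v"
      with \<open>F = closed_segment v w\<close> w0F w0 show False by simp
    qed
    then have "aff_dim (closed_segment v w) = 1"
      unfolding segment_convex_hull aff_dim_convex_hull by simp
    then have "adjacent_vertices P v w"
      using v w(1) WV \<open>F face_of P\<close> \<open>F = closed_segment v w\<close>
      by (auto simp: adjacent_vertices_def edge_of_def V)
    then have "w - v \<in> ?L" by (auto intro: hull_inc)
    then have "(1 / r) *\<^sub>R (w - v) \<in> ?L" using r(1) by (intro convex_cone_hull_mul) auto
    moreover have "(1 / r) *\<^sub>R (w - v) = g" using r \<open>w \<noteq> v\<close> by auto
    ultimately show "g \<in> ?L" by simp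
  qed
  then have "convex_cone hull G \<subseteq> ?L" by (rule hull_minimal) (rule convex_cone_convex_cone_hull)
  with KG show "?K \<subseteq> ?L" by blast
qed

section \<open>Scaling of generators and the dimension of a vertex cone\<close>

lemma convex_cone_hull_scaleR:
  assumes "0 < p"
  shows "convex_cone hull ((*\<^sub>R) p ` S) = convex_cone hull S"
proof
  show "convex_cone hull ((*\<^sub>R) p ` S) \<subseteq> convex_cone hull S"
    using assms by (intro hull_minimal convex_cone_convex_cone_hull) (auto intro: convex_cone_hull_mul hull_inc)
  have "x \<in> convex_cone hull ((*\<^sub>R) p ` S)" if "x \<in> S" for x
  proof -
    have "(1 / p) *\<^sub>R (p *\<^sub>R x) \<in> convex_cone hull ((*\<^sub>R) p ` S)"
      using that assms by (intro convex_cone_hull_mul hull_inc) auto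
    then show ?thesis using assms by simp
  qed
  then show "convex_cone hull S \<subseteq> convex_cone hull ((*\<^sub>R) p ` S)"
    by (intro hull_minimal convex_cone_convex_cone_hull) auto
qed

lemma span_convex_cone_hull: "span (convex_cone hull S) = span S"
proof
  show "span (convex_cone hull S) \<subseteq> span S"
    using convex_cone_hull_subset_span by (intro span_minimal) auto
  show "span S \<subseteq> span (convex_cone hull S)" by (intro span_mono hull_subset)
qed

lemma aff_dim_vertex_cone:
  fixes V :: "'a::euclidean_space set"
  assumes "v \<in> V" "convex_cone hull S = convex_cone hull ((\<lambda>w. w - v) ` V)"
  shows "aff_dim (convex hull V) = int (dim S)"
proof -
  have "span S = span ((\<lambda>w. w - v) ` V)" using assms(2) span_convex_cone_hull by metis
  then have "dim S = dim ((\<lambda>w. w - v) ` V)" by (metis dim_span)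
  moreover have "(+) (- v) ` V = (\<lambda>w. w - v) ` V" by (intro image_cong) auto
  ultimately show ?thesis
    using assms(1) by (simp add: aff_dim_convex_hull aff_dim_eq_dim[of v] hull_inc)
qed

section \<open>The cone over a polytope\<close>

abbreviation homogenize :: "'a::real_vector \<Rightarrow> 'a \<times> real" where
  "homogenize v \<equiv> (v, 1)"

lemma convex_cone_hull_sum:
  "(\<And>i. i \<in> I \<Longrightarrow> f i \<in> convex_cone hull S) \<Longrightarrow> (\<Sum>i\<in>I. f i) \<in> convex_cone hull S"
  by (induction I rule: infinite_finite_induct)
     (simp_all add: convex_cone_hull_contains_0 convex_cone_hull_add)

lemma convex_cone_hull_finite_image:
  assumes "finite V" "inj_on f V"
  shows "x \<in> convex_cone hull (f ` V) \<longleftrightarrow> (\<exists>c. (\<forall>v\<in>V. 0 \<le> c v) \<and> x = (\<Sum>v\<in>V. c v *\<^sub>R f v))"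
proof
  assume "x \<in> convex_cone hull (f ` V)"
  then obtain c where c: "\<forall>u\<in>f ` V. 0 \<le> c u" "x = (\<Sum>u\<in>f ` V. c u *\<^sub>R u)"
    unfolding convex_cone_hull_finite[OF finite_imageI[OF assms(1)]] by blast
  then show "\<exists>c. (\<forall>v\<in>V. 0 \<le> c v) \<and> x = (\<Sum>v\<in>V. c v *\<^sub>R f v)"
    by (intro exI[of _ "c \<circ> f"]) (simp add: sum.reindex[OF assms(2)])
next
  assume "\<exists>c. (\<forall>v\<in>V. 0 \<le> c v) \<and> x = (\<Sum>v\<in>V. c v *\<^sub>R f v)"
  then show "x \<in> convex_cone hull (f ` V)"
    by (auto intro!: convex_cone_hull_sum convex_cone_hull_mul intro: hull_inc)
qed

lemma mem_cone_over:
  assumes "finite V"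
  shows "(x, t) \<in> convex_cone hull (homogenize ` V) \<longleftrightarrow>
    (\<exists>c. (\<forall>v\<in>V. 0 \<le> c v) \<and> x = (\<Sum>v\<in>V. c v *\<^sub>R v) \<and> t = (\<Sum>v\<in>V. c v))"
  by (subst convex_cone_hull_finite_image[OF assms])
     (auto simp: inj_on_def prod_eq_iff fst_sum snd_sum)

lemma mem_cone_over_dilate:
  assumes "finite V" "V \<noteq> {}"
  shows "(x, t) \<in> convex_cone hull (homogenize ` V) \<longleftrightarrow> 0 \<le> t \<and> x \<in> (*\<^sub>R) t ` (convex hull V)"
  unfolding mem_cone_over[OF assms(1)]
proof
  assume "\<exists>c. (\<forall>v\<in>V. 0 \<le> c v) \<and> x = (\<Sum>v\<in>V. c v *\<^sub>R v) \<and> t = (\<Sum>v\<in>V. c v)"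
  then obtain c where c: "\<forall>v\<in>V. 0 \<le> c v" "x = (\<Sum>v\<in>V. c v *\<^sub>R v)" "t = (\<Sum>v\<in>V. c v)" by blast
  have "0 \<le> t" unfolding c(3) using c(1) by (intro sum_nonneg) auto
  moreover have "x \<in> (*\<^sub>R) t ` (convex hull V)"
  proof (cases "t = 0")
    case True
    then have "\<forall>v\<in>V. c v = 0" using c assms(1) sum_nonneg_eq_0_iff[of V c] by auto
    then have "x = 0" using c by simp
    obtain v where "v \<in> V" using assms(2) by blast
    then have "v \<in> convex hull V" by (rule hull_inc)
    then show ?thesis using True \<open>x = 0\<close> by (auto simp: image_iff)
  next
    case False
    then have "x = t *\<^sub>R (\<Sum>v\<in>V. (c v / t) *\<^sub>R v)" by (simp add: c(2) scaleR_sum_right)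
    moreover have "(\<Sum>v\<in>V. (c v / t) *\<^sub>R v) \<in> convex hull V"
      unfolding convex_hull_finite[OF assms(1)] using c(1) \<open>0 \<le> t\<close> False c(3)
      by (intro CollectI exI[of _ "\<lambda>v. c v / t"]) (auto simp flip: sum_divide_distrib)
    ultimately show ?thesis by blast
  qed
  ultimately show "0 \<le> t \<and> x \<in> (*\<^sub>R) t ` (convex hull V)" by blast
next
  assume "0 \<le> t \<and> x \<in> (*\<^sub>R) t ` (convex hull V)"
  then obtain c where "0 \<le> t" "\<forall>v\<in>V. 0 \<le> c v" "sum c V = 1" "x = t *\<^sub>R (\<Sum>v\<in>V. c v *\<^sub>R v)"
    unfolding convex_hull_finite[OF assms(1)] by auto
  then show "\<exists>c. (\<forall>v\<in>V. 0 \<le> c v) \<and> x = (\<Sum>v\<in>V. c v *\<^sub>R v) \<and> t = (\<Sum>v\<in>V. c v)"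
    by (intro exI[of _ "\<lambda>v. t * c v"]) (auto simp: scaleR_sum_right simp flip: sum_distrib_left)
qed

text \<open>Prolongation criterion: every segment from a point y of the hull to the given point can
  be prolonged by the factor 1 + m, where m is the least coefficient, since the coefficients of y
  are at most 1.\<close>

lemma positive_combination_rel_interior:
  fixes V :: "'a::euclidean_space set"
  assumes fin: "finite V" and c: "\<And>v. v \<in> V \<Longrightarrow> 0 < c v" "sum c V = 1"
  shows "(\<Sum>v\<in>V. c v *\<^sub>R v) \<in> rel_interior (convex hull V)" (is "?x \<in> _")
proof -
  have ne: "V \<noteq> {}" using c(2) by auto
  define m where "m = Min (c ` V)"
  have m: "0 < m" "\<And>v. v \<in> V \<Longrightarrow> m \<le> c v"
    unfolding m_def using fin ne c(1) by (auto simp: Min_gr_iff)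
  have "\<exists>e. 1 < e \<and> (1 - e) *\<^sub>R y + e *\<^sub>R ?x \<in> convex hull V" if y: "y \<in> convex hull V" for y
  proof -
    obtain a where a: "\<forall>v\<in>V. 0 \<le> a v" "sum a V = 1" "y = (\<Sum>v\<in>V. a v *\<^sub>R v)"
      using y unfolding convex_hull_finite[OF fin] by auto
    have "(1 - (1 + m)) *\<^sub>R y + (1 + m) *\<^sub>R ?x = (\<Sum>v\<in>V. ((1 + m) * c v - m * a v) *\<^sub>R v)"
      unfolding a(3) scaleR_sum_right sum.distrib[symmetric]
      by (intro sum.cong) (auto simp: algebra_simps)
    moreover have "\<dots> \<in> convex hull V"
      unfolding convex_hull_finite[OF fin]
    proof (intro CollectI exI[of _ "\<lambda>v. (1 + m) * c v - m * a v"] conjI ballI refl)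
      fix v assume v: "v \<in> V"
      have "a v \<le> sum a V" using fin v a(1) by (intro member_le_sum) auto
      then have "m * a v \<le> m" using a(2) m(1) by simp
      moreover have "0 \<le> m * c v" using m(1) c(1)[OF v] by simp
      ultimately show "0 \<le> (1 + m) * c v - m * a v" using m(2)[OF v] by (simp add: algebra_simps)
    next
      show "(\<Sum>v\<in>V. (1 + m) * c v - m * a v) = 1"
        using a(2) c(2) by (simp add: sum_subtractf flip: sum_distrib_left)
    qed
    ultimately show ?thesis using m(1) by (intro exI[of _ "1 + m"]) auto
  qed
  then show ?thesis using ne by (subst convex_rel_interior_iff) auto
qed

text \<open>Subtracting a multiple of \<xi> at height t amounts to moving x / t away from the
  relatively interior point x0 = fst \<xi> / snd \<xi>. That this is possible inside the hull
  characterizes the relative interior.\<close>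

lemma rel_interior_cone_over:
  fixes V :: "'a::euclidean_space set"
  assumes fin: "finite V" and ne: "V \<noteq> {}" and c: "\<And>v. v \<in> V \<Longrightarrow> 0 < c v" and t: "0 < t"
  defines "\<xi> \<equiv> (\<Sum>v\<in>V. c v *\<^sub>R v, \<Sum>v\<in>V. c v)"
  shows "x \<in> (*\<^sub>R) t ` rel_interior (convex hull V) \<longleftrightarrow>
    (\<exists>\<delta>>0. (x, t) - \<delta> *\<^sub>R \<xi> \<in> convex_cone hull (homogenize ` V))"
proof -
  define T where "T = (\<Sum>v\<in>V. c v)"
  have T: "0 < T" unfolding T_def using fin ne c by (intro sum_pos) auto
  define x0 where "x0 = (\<Sum>v\<in>V. (c v / T) *\<^sub>R v)"
  have x0: "x0 \<in> rel_interior (convex hull V)"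
    unfolding x0_def using fin c T
    by (intro positive_combination_rel_interior) (auto simp: T_def simp flip: sum_divide_distrib)
  have \<xi>: "\<xi> = (T *\<^sub>R x0, T)"
    using T by (simp add: \<xi>_def x0_def scaleR_sum_right T_def[symmetric])
  have iff: "(x, t) - \<delta> *\<^sub>R \<xi> \<in> convex_cone hull (homogenize ` V) \<longleftrightarrow>
      0 \<le> t - \<delta> * T \<and> x - (\<delta> * T) *\<^sub>R x0 \<in> (*\<^sub>R) (t - \<delta> * T) ` (convex hull V)" for \<delta>
    by (simp add: \<xi> mem_cone_over_dilate[OF fin ne])
  show ?thesis unfolding iff
  proof
    assume "x \<in> (*\<^sub>R) t ` rel_interior (convex hull V)"
    then obtain y where y: "y \<in> rel_interior (convex hull V)" "x = t *\<^sub>R y" by blast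
    have "x0 \<in> convex hull V" using x0 rel_interior_subset by blast
    then obtain e where e: "e > 1" "(1 - e) *\<^sub>R x0 + e *\<^sub>R y \<in> convex hull V"
      using y(1) convex_rel_interior_iff[of "convex hull V" y] ne by auto
    \<comment> \<open>Chosen so that the remaining height is t / e and the remaining point is t / e
      times the prolonged point.\<close>
    define \<delta> where "\<delta> = t * (e - 1) / (e * T)"
    have \<delta>: "\<delta> > 0" "\<delta> * T = t * (e - 1) / e" using e(1) T t by (auto simp: \<delta>_def)
    have "t - \<delta> * T = t / e" unfolding \<delta>(2) using e(1) by (simp add: field_simps)
    moreover have "x - (\<delta> * T) *\<^sub>R x0 = (t / e) *\<^sub>R ((1 - e) *\<^sub>R x0 + e *\<^sub>R y)"
    proof -
      have "(t / e) * (1 - e) = - (t * (e - 1) / e)" "(t / e) * e = t" using e(1) by (auto simp: field_simps)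
      then show ?thesis unfolding y(2) \<delta>(2) scaleR_add_right scaleR_scaleR by simp
    qed
    ultimately show "\<exists>\<delta>>0. 0 \<le> t - \<delta> * T \<and> x - (\<delta> * T) *\<^sub>R x0 \<in> (*\<^sub>R) (t - \<delta> * T) ` (convex hull V)"
      using e t \<delta>(1) by (intro exI[of _ \<delta>]) auto
  next
    assume "\<exists>\<delta>>0. 0 \<le> t - \<delta> * T \<and> x - (\<delta> * T) *\<^sub>R x0 \<in> (*\<^sub>R) (t - \<delta> * T) ` (convex hull V)"
    then obtain \<delta> y where \<delta>: "0 < \<delta>" "0 \<le> t - \<delta> * T" "y \<in> convex hull V"
      "x - (\<delta> * T) *\<^sub>R x0 = (t - \<delta> * T) *\<^sub>R y" by auto
    define e where "e = \<delta> * T / t"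
    have e: "0 < e" "e \<le> 1" using \<delta>(1,2) T t by (auto simp: e_def)
    have "y - e *\<^sub>R (y - x0) \<in> rel_interior (convex hull V)"
      by (rule rel_interior_convex_shrink[OF convex_convex_hull x0 \<delta>(3) e])
    moreover have "x = t *\<^sub>R (y - e *\<^sub>R (y - x0))"
    proof -
      have "t * e = \<delta> * T" using t by (simp add: e_def)
      have "x = (t - \<delta> * T) *\<^sub>R y + (\<delta> * T) *\<^sub>R x0" using \<delta>(4) by (simp add: algebra_simps)
      also have "\<dots> = t *\<^sub>R (y - e *\<^sub>R (y - x0))"
        unfolding \<open>t * e = \<delta> * T\<close>[symmetric] by (simp add: algebra_simps)
      finally show ?thesis .
    qed
    ultimately show "x \<in> (*\<^sub>R) t ` rel_interior (convex hull V)" by blast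
  qed
qed

text \<open>Adding a large multiple of (v, 1) frees the coefficient of v from its sign condition, so
  only the directions w - v matter. This supplies the condition on \<open>Q\<close> in
  \<open>brion_torsion\<close>.\<close>

lemma cone_over_translate_vertex:
  assumes fin: "finite V" and v: "v \<in> V"
  shows "eventually (\<lambda>s. (x, t) + s *\<^sub>R (v, 1) \<in> convex_cone hull (homogenize ` V) \<longleftrightarrow>
    x - t *\<^sub>R v \<in> convex_cone hull ((\<lambda>w. w - v) ` V)) at_top" (is ?closed)
    and "eventually (\<lambda>s. (\<exists>\<delta>>0. (x, t) + s *\<^sub>R (v, 1) - \<delta> *\<^sub>R \<xi> \<in> convex_cone hull (homogenize ` V)) \<longleftrightarrow>
      (\<exists>\<delta>>0. x - t *\<^sub>R v - \<delta> *\<^sub>R (fst \<xi> - snd \<xi> *\<^sub>R v) \<in> convex_cone hull ((\<lambda>w. w - v) ` V))) at_top"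
      (is ?open)
proof -
  let ?C = "convex_cone hull (homogenize ` V)" and ?K = "convex_cone hull ((\<lambda>w. w - v) ` V)"
  have K: "x \<in> ?K \<longleftrightarrow> (\<exists>c. (\<forall>w\<in>V. 0 \<le> c w) \<and> x = (\<Sum>w\<in>V. c w *\<^sub>R (w - v)))" for x
    by (rule convex_cone_hull_finite_image[OF fin]) (simp add: inj_on_def)
  have into: "x - t *\<^sub>R v \<in> ?K" if "(x, t) + s *\<^sub>R (v, 1) \<in> ?C" for x t s
  proof -
    obtain c where c: "\<forall>w\<in>V. 0 \<le> c w" "x + s *\<^sub>R v = (\<Sum>w\<in>V. c w *\<^sub>R w)" "t + s = (\<Sum>w\<in>V. c w)"
      using \<open>(x, t) + s *\<^sub>R (v, 1) \<in> ?C\<close> by (auto simp: mem_cone_over[OF fin])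
    have "x - t *\<^sub>R v = (x + s *\<^sub>R v) - (t + s) *\<^sub>R v" by (simp add: algebra_simps)
    also have "\<dots> = (\<Sum>w\<in>V. c w *\<^sub>R (w - v))"
      unfolding c(2,3) by (simp add: scaleR_diff_right sum_subtractf scaleR_sum_left)
    finally show ?thesis unfolding K using c(1) by blast
  qed
  have from_local: "\<exists>s0. \<forall>s\<ge>s0. (x, t) + s *\<^sub>R (v, 1) \<in> ?C" if xK: "x - t *\<^sub>R v \<in> ?K" for x t
  proof -
    obtain c where c: "\<forall>w\<in>V. 0 \<le> c w" "x - t *\<^sub>R v = (\<Sum>w\<in>V. c w *\<^sub>R (w - v))"
      using xK unfolding K by blast
    \<comment> \<open>Turning the combination of the w - v into one of the vertices w raises the
      height to the total weight; s0 is the amount missing from t.\<close>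
    define s0 where "s0 = (\<Sum>w\<in>V. c w) - t"
    have base: "(x, t) + s0 *\<^sub>R (v, 1) \<in> ?C"
    proof -
      have "x + s0 *\<^sub>R v = (x - t *\<^sub>R v) + (\<Sum>w\<in>V. c w) *\<^sub>R v" by (simp add: s0_def algebra_simps)
      also have "\<dots> = (\<Sum>w\<in>V. c w *\<^sub>R w)"
        unfolding c(2) by (simp add: scaleR_diff_right sum_subtractf scaleR_sum_left)
      finally show ?thesis using c(1) by (auto simp: mem_cone_over[OF fin] s0_def)
    qed
    have split: "(x, t) + s *\<^sub>R (v, 1) = ((x, t) + s0 *\<^sub>R (v, 1)) + (s - s0) *\<^sub>R (v, 1)" for s
      by (simp add: algebra_simps)
    have "(x, t) + s *\<^sub>R (v, 1) \<in> ?C" if "s \<ge> s0" for s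
    proof -
      have "(s - s0) *\<^sub>R (v, 1) \<in> ?C" using that v by (intro convex_cone_hull_mul hull_inc) auto
      with base show ?thesis unfolding split[of s] by (rule convex_cone_hull_add)
    qed
    then show ?thesis by blast
  qed
  show ?closed
  proof (cases "x - t *\<^sub>R v \<in> ?K")
    case True
    from from_local[OF this] True show ?thesis unfolding eventually_at_top_linorder by blast
  next
    case False
    then show ?thesis using into by (intro always_eventually) blast
  qed
  have shift: "(x, t) + s *\<^sub>R (v, 1) - \<delta> *\<^sub>R \<xi>
      = (x - \<delta> *\<^sub>R fst \<xi>, t - \<delta> * snd \<xi>) + s *\<^sub>R (v, 1)" for s \<delta>
    by (simp add: prod_eq_iff)
  have loc: "x - t *\<^sub>R v - \<delta> *\<^sub>R (fst \<xi> - snd \<xi> *\<^sub>R v)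
      = (x - \<delta> *\<^sub>R fst \<xi>) - (t - \<delta> * snd \<xi>) *\<^sub>R v" for \<delta>
    by (simp add: algebra_simps)
  show ?open
  proof (cases "\<exists>\<delta>>0. x - t *\<^sub>R v - \<delta> *\<^sub>R (fst \<xi> - snd \<xi> *\<^sub>R v) \<in> ?K")
    case True
    then obtain \<delta> s0 where "\<delta> > 0" "\<forall>s\<ge>s0. (x, t) + s *\<^sub>R (v, 1) - \<delta> *\<^sub>R \<xi> \<in> ?C"
      unfolding loc shift using from_local by blast
    then have "eventually (\<lambda>s. \<exists>\<delta>>0. (x, t) + s *\<^sub>R (v, 1) - \<delta> *\<^sub>R \<xi> \<in> ?C) at_top"
      unfolding eventually_at_top_linorder by blast
    then show ?thesis by eventually_elim (use True in simp)
  next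
    case False
    then have "\<not> (\<exists>\<delta>>0. (x, t) + s *\<^sub>R (v, 1) - \<delta> *\<^sub>R \<xi> \<in> ?C)" for s
      unfolding loc shift using into by blast
    then show ?thesis using False by (intro always_eventually) blast
  qed
qed

section \<open>Denominators\<close>

lemma common_denominator:
  assumes "finite Q" "Q \<subseteq> \<rat>"
  shows "\<exists>n::nat. 0 < n \<and> (\<forall>x\<in>Q. real n * x \<in> \<int>)"
  using assms
proof (induction Q rule: finite_induct)
  case (insert x Q)
  then obtain n where n: "0 < n" "\<forall>x\<in>Q. real n * x \<in> \<int>" by auto
  obtain a b where ab: "b > 0" "x = of_int a / of_int b"
    using insert.prems by (metis Rats_cases' insert_subset)
  have "real (n * nat b) * y \<in> \<int>" if y: "y \<in> insert x Q" for y
  proof (cases "y = x")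
    case True
    then have "real (n * nat b) * y = of_int (int n * a)" using ab by simp
    then show ?thesis by (metis Ints_of_int)
  next
    case False
    then have "of_int b * (real n * y) \<in> \<int>" using y n by (intro Ints_mult[OF Ints_of_int]) auto
    moreover have "real (n * nat b) * y = of_int b * (real n * y)" using ab(1) by simp
    ultimately show ?thesis by metis
  qed
  moreover have "0 < n * nat b" using n ab by simp
  ultimately show ?case by blast
qed auto

lemma denominator_vertices:
  fixes P :: "(real ^ 'n) set"
  assumes "rational_polytope P"
  shows "0 < denominator P"
    and "v extreme_point_of P \<Longrightarrow> real (denominator P) *\<^sub>R v \<in> range of_int_vec"
proof -
  have ext: "u extreme_point_of ((*\<^sub>R) (real p) ` P) \<longleftrightarrow> (\<exists>v. v extreme_point_of P \<and> u = real p *\<^sub>R v)"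
    if "p > 0" for u :: "real ^ 'n" and p :: nat
  proof -
    have lin: "linear ((*\<^sub>R) (real p) :: real ^ 'n \<Rightarrow> _)" by (intro linearI) (auto simp: algebra_simps)
    have inj: "inj ((*\<^sub>R) (real p) :: real ^ 'n \<Rightarrow> _)" using that by (auto simp: inj_def)
    have "(real p *\<^sub>R v) extreme_point_of ((*\<^sub>R) (real p) ` P) \<longleftrightarrow> v extreme_point_of P" for v
      using face_of_linear_image[OF lin inj, of "{v}" P] by (simp add: face_of_singleton)
    moreover have "u = real p *\<^sub>R ((1 / real p) *\<^sub>R u)" using that by simp
    ultimately show ?thesis by metis
  qed
  obtain V :: "(real ^ 'n) set" where V: "finite V" "\<forall>v\<in>V. \<forall>i. v $ i \<in> \<rat>" "P = convex hull V"
    using assms by (auto simp: rational_polytope_def)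
  have "finite (\<Union>v\<in>V. range (vec_nth v))" "(\<Union>v\<in>V. range (vec_nth v)) \<subseteq> \<rat>" using V by auto
  then obtain n where n: "0 < n" "\<forall>x\<in>\<Union>v\<in>V. range (vec_nth v). real n * x \<in> \<int>"
    using common_denominator by blast
  have "real n *\<^sub>R v \<in> range of_int_vec" if "v extreme_point_of P" for v
  proof -
    have "v \<in> V" using that V(3) extreme_point_of_convex_hull by auto
    then have "\<forall>i. \<exists>k. real n * v $ i = of_int k" using n(2) by (auto elim!: Ints_cases)
    then obtain k where "\<And>i. real n * v $ i = of_int (k i)" by metis
    then have "real n *\<^sub>R v = of_int_vec (\<chi> i. k i)" by (simp add: of_int_vec_def vec_eq_iff)
    then show ?thesis by blast
  qed
  with n(1) have "n > 0 \<and> (\<forall>v. v extreme_point_of ((*\<^sub>R) (real n) ` P) \<longrightarrow> v \<in> range of_int_vec)"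
    using ext by auto
  from LeastI[of "\<lambda>p. p > 0 \<and> (\<forall>v. v extreme_point_of ((*\<^sub>R) (real p) ` P) \<longrightarrow> v \<in> range of_int_vec)", OF this]
  have "0 < denominator P" and
    "\<forall>v. v extreme_point_of ((*\<^sub>R) (real (denominator P)) ` P) \<longrightarrow> v \<in> range of_int_vec"
    unfolding denominator_def by auto
  then show "0 < denominator P"
    "v extreme_point_of P \<Longrightarrow> real (denominator P) *\<^sub>R v \<in> range of_int_vec"
    using ext by auto
qed

section \<open>The expansion over the vertices\<close>

lemma ehr_eq_fsum: "ehr S l t = fsum l (\<lambda>m. of_bool (of_int_vec m \<in> (*\<^sub>R) (of_int t) ` S))"
  unfolding ehr_def fsum_def by (intro sum.cong) (auto simp: supp_def qweight_def)

text \<open>The dilate is bounded, so its indicator has the Ehrhart sum as a value. The difference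
  from the vertex terms is torsion and has a value, which must then be 0.\<close>

lemma ehr_eq_vertex_sum:
  fixes S :: "(real ^ 'n) set"
  assumes "bounded S"
    and tors: "torsion (\<lambda>m. of_bool (of_int_vec m \<in> (*\<^sub>R) (of_int t) ` S) - (\<Sum>v\<in>V. F v m))"
    and val: "\<And>v. v \<in> V \<Longrightarrow> has_value l (F v) (c v)"
  shows "ehr S l t = (\<Sum>v\<in>V. c v)"
proof -
  let ?f = "\<lambda>m. of_bool (of_int_vec m \<in> (*\<^sub>R) (of_int t) ` S) :: ratfun"
  have "supp ?f = {m. of_int_vec m \<in> (*\<^sub>R) (of_int t) ` S}" by (auto simp: supp_def)
  moreover have "bounded ((*\<^sub>R) (of_int t) ` S)" using assms(1) by (rule bounded_scaling)
  ultimately have "finite (supp ?f)" using finite_lattice_points by simp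
  then have "has_value l ?f (ehr S l t)" unfolding ehr_eq_fsum by (rule has_value_finite)
  moreover have "has_value l (\<lambda>m. (-1) * (\<Sum>v\<in>V. F v m)) ((-1) * (\<Sum>v\<in>V. c v))"
    by (intro has_value_scale has_value_sum val)
  ultimately have "has_value l (\<lambda>m. ?f m + (-1) * (\<Sum>v\<in>V. F v m)) (ehr S l t + (-1) * (\<Sum>v\<in>V. c v))"
    by (rule has_value_add)
  then have "has_value l (\<lambda>m. ?f m - (\<Sum>v\<in>V. F v m)) (ehr S l t - (\<Sum>v\<in>V. c v))" by simp
  from torsion_value_zero[OF tors this] show ?thesis by simp
qed

text \<open>Both expansions come from Brion's formula for the cone over P. Their common coefficients
  c are the values of the vertex cones shifted by r v, and a v = \<lambda>(p v).\<close>

lemma vertex_expansion: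
  fixes P :: "(real ^ 'n) set"
  assumes rat: "rational_polytope P" and gen: "generic_form l P" and pos: "positive_form l P"
    and ne: "P \<noteq> {}"
  obtains V :: "(real ^ 'n) set" and a c where "\<And>v. v \<in> V \<Longrightarrow> (0::int) \<le> a v"
    and "\<And>k. ehr P l (int (k * denominator P + r)) = (\<Sum>v\<in>V. qvar powi (int k * a v) * c v)"
    and "\<And>k. r < k * denominator P \<Longrightarrow> ehr (rel_interior P) l (int (k * denominator P) - int r)
      = (-1) powi aff_dim P * (\<Sum>v\<in>V. qvar powi (int k * a v) * subst_inv_q (c v))"
proof -
  define p where "p = denominator P"
  define V where "V = {v. v extreme_point_of P}"
  obtain V0 where V0: "finite V0" "P = convex hull V0" using rat by (auto simp: rational_polytope_def)
  have "V \<subseteq> V0" unfolding V_def V0(2) using extreme_point_of_convex_hull by blast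
  then have fin: "finite V" using V0(1) finite_subset by blast
  have P: "P = convex hull V"
    unfolding V_def V0(2) using V0(1)
    by (intro Krein_Milman_Minkowski finite_imp_compact_convex_hull) auto
  have "V \<noteq> {}" using ne P by auto
  have ext: "v extreme_point_of (convex hull V)" if "v \<in> V" for v
    using that unfolding P[symmetric] by (simp add: V_def)
  have p: "0 < real p" using denominator_vertices(1)[OF rat] by (simp add: p_def)
  have "\<forall>v\<in>V. \<exists>z. real p *\<^sub>R v = of_int_vec z"
    using denominator_vertices(2)[OF rat] by (auto simp: V_def p_def)
  then obtain z where z: "\<And>v. v \<in> V \<Longrightarrow> real p *\<^sub>R v = of_int_vec (z v)" by metis
  define a where "a v = (lin_form l (z v) :: int)" for v
  have lin_scale: "lin_form l (s *\<^sub>R x) = s * (lin_form l x :: real)" for s and x :: "real ^ 'n"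
    by (simp add: lin_form_def sum_distrib_left mult_ac)
  have real_a: "real_of_int (a v) = real p * lin_form l v" if "v \<in> V" for v
    using z[OF that] lin_scale[of "real p" v] by (simp add: a_def lin_form_of_int_vec)
  have a_nonneg: "0 \<le> a v" if "v \<in> V" for v
  proof -
    have "0 \<le> lin_form l v" using pos that by (simp add: positive_form_def V_def)
    then have "0 \<le> real_of_int (a v)" unfolding real_a[OF that] using p by simp
    then show ?thesis by simp
  qed
  define Adj where "Adj v = {w. adjacent_vertices P v w}" for v
  have AdjV: "Adj v \<subseteq> V" for v by (auto simp: Adj_def V_def adjacent_vertices_def)
  define E where "E v = (\<lambda>w. z w - z v) ` Adj v" for v
  define K where "K v = convex_cone hull ((\<lambda>w. w - v) ` V)" for v
  have finE: "finite (E v)" for v unfolding E_def using finite_subset[OF AdjV fin] by simp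
  have vecE: "of_int_vec ` E v = (*\<^sub>R) (real p) ` (\<lambda>w. w - v) ` Adj v" if "v \<in> V" for v
    unfolding E_def image_image using z that AdjV[of v]
    by (intro image_cong refl) (auto simp: of_int_vec_diff scaleR_diff_right)
  have coneE: "convex_cone hull (of_int_vec ` E v) = K v" if "v \<in> V" for v
    unfolding vecE[OF that] convex_cone_hull_scaleR[OF p] K_def Adj_def
    using vertex_cone_edges[OF V_def fin P that] by simp
  have dimE: "aff_dim P = int (dim (of_int_vec ` E v))" if "v \<in> V" for v
    using aff_dim_vertex_cone[OF that, of "of_int_vec ` E v"] coneE[OF that] P by (simp add: K_def)
  have l_E: "lin_form l e \<noteq> (0::int)" if "v \<in> V" "e \<in> E v" for v e
  proof -
    obtain w where w: "w \<in> Adj v" "e = z w - z v" using \<open>e \<in> E v\<close> by (auto simp: E_def)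
    then have "lin_form l v \<noteq> (lin_form l w :: real)" using gen by (simp add: generic_form_def Adj_def)
    moreover have "w \<in> V" using w(1) AdjV by blast
    ultimately have "real_of_int (a w) \<noteq> real_of_int (a v)"
      using real_a \<open>v \<in> V\<close> p by simp
    then show ?thesis unfolding w(2) lin_form_diff by (simp add: a_def)
  qed
  define U where "U = homogenize ` V"
  have finU: "finite U" using fin by (simp add: U_def)
  have snd_U: "snd u = 1" if "u \<in> U" for u using that by (auto simp: U_def)
  obtain \<epsilon> N where dis: "dissection U \<epsilon> N"
    using dissection_exists[OF finU, of snd] snd_U linear_snd by auto
  have "\<exists>\<epsilon> N. dissection (of_int_vec ` E v) \<epsilon> N" if v: "v \<in> V" for v
  proof -
    obtain h where h: "linear h" "\<forall>w\<in>V - {v}. 0 < (h (w - v) :: real)"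
      using extreme_point_functional[OF fin ext[OF v]] by blast
    show ?thesis
    proof (rule dissection_exists[OF finite_imageI[OF finE] h(1)])
      fix e assume "e \<in> of_int_vec ` E v"
      then obtain w where w: "w \<in> Adj v" "e = real p *\<^sub>R (w - v)" unfolding vecE[OF v] by auto
      \<comment> \<open>A vertex adjacent to itself would contradict genericity of the form.\<close>
      have "w \<noteq> v" using w(1) gen by (auto simp: Adj_def generic_form_def)
      then have "0 < h (w - v)" using w(1) AdjV h(2) by blast
      then show "0 < h e" using w(2) p h(1) by (simp add: linear_scale)
    qed
  qed
  then obtain \<epsilon>E NE where disE: "\<And>v. v \<in> V \<Longrightarrow> dissection (of_int_vec ` E v) (\<epsilon>E v) (NE v)" by metis
  \<comment> \<open>Linear projection along (v, 1); it sends (w, 1) to w - v, and so the cone over P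
    to the vertex cone.\<close>
  define pr where "pr v y = fst y - snd y *\<^sub>R v" for v and y :: "(real ^ 'n) \<times> real"
  have lin_pr: "linear (pr v)" for v
    unfolding pr_def by (intro linearI) (auto simp: algebra_simps)
  \<comment> \<open>The functionals of the vertex cones are pulled back along \<open>pr v\<close>,
    so that avoiding \<open>M\<close> makes one \<xi> generic for the cone over P and all its
    projections.\<close>
  define M where "M = N \<union> coords U \<union> (\<Union>v\<in>V. (\<lambda>f. f \<circ> pr v) ` (NE v \<union> coords (of_int_vec ` E v)))"
  have "generic_for U (\<Union>v\<in>V. (\<lambda>f. f \<circ> pr v) ` (NE v \<union> coords (of_int_vec ` E v)))"
    unfolding generic_for_def
  proof (intro conjI ballI)
    have gE: "generic_for (of_int_vec ` E v) (NE v \<union> coords (of_int_vec ` E v))" if "v \<in> V" for v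
      unfolding generic_for_Un using disE[OF that] finE
      by (simp add: dissection_def generic_for_coords)
    show "finite (\<Union>v\<in>V. (\<lambda>f. f \<circ> pr v) ` (NE v \<union> coords (of_int_vec ` E v)))"
      using gE fin by (auto simp: generic_for_def)
    fix g assume "g \<in> (\<Union>v\<in>V. (\<lambda>f. f \<circ> pr v) ` (NE v \<union> coords (of_int_vec ` E v)))"
    then obtain v f where v: "v \<in> V" and f: "f \<in> NE v \<union> coords (of_int_vec ` E v)" and g: "g = f \<circ> pr v"
      by blast
    obtain e where e: "e \<in> of_int_vec ` E v" "f e \<noteq> 0" and lin: "linear f"
      using gE[OF v] f unfolding generic_for_def by blast
    show "linear g" unfolding g using linear_compose[OF lin_pr lin] .
    obtain w where w: "w \<in> Adj v" "e = real p *\<^sub>R (w - v)" using e(1) unfolding vecE[OF v] by auto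
    have "f (w - v) \<noteq> 0" using e(2) w(2) lin by (auto simp: linear_scale)
    then have "g (w, 1) \<noteq> 0" by (simp add: g pr_def)
    moreover have "(w, 1) \<in> U" using w(1) AdjV by (auto simp: U_def)
    ultimately show "\<exists>u\<in>U. g u \<noteq> 0" by blast
  qed
  then have "generic_for U M"
    unfolding M_def generic_for_Un using dis generic_for_coords[OF finU] by (simp add: dissection_def)
  from generic_point_exists[OF finU this] obtain b where
    b: "\<forall>u\<in>U. 0 < b u" "\<forall>f\<in>M. f (\<Sum>u\<in>U. b u *\<^sub>R u) \<noteq> 0" by blast
  define \<xi> where "\<xi> = (\<Sum>u\<in>U. b u *\<^sub>R u)"
  have \<xi>_pair: "\<xi> = (\<Sum>v\<in>V. b (v, 1) *\<^sub>R v, \<Sum>v\<in>V. b (v, 1))"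
    unfolding \<xi>_def U_def by (subst sum.reindex) (auto simp: inj_on_def prod_eq_iff fst_sum snd_sum)
  have bV: "0 < b (v, 1)" if "v \<in> V" for v using b(1) that by (auto simp: U_def)
  have \<xi>_cone: "\<xi> \<in> convex_cone hull U"
    unfolding \<xi>_def using b(1) by (intro convex_cone_hull_sum convex_cone_hull_mul hull_inc) (auto intro: less_imp_le)
  have \<xi>_N: "\<forall>f\<in>N. f \<xi> \<noteq> 0" using b(2) by (auto simp: M_def \<xi>_def)
  have pr_\<xi>: "pr v \<xi> \<in> K v" for v
  proof -
    have "pr v \<xi> = (\<Sum>w\<in>V. b (w, 1) *\<^sub>R (w - v))"
      by (simp add: pr_def \<xi>_pair scaleR_diff_right sum_subtractf scaleR_sum_left)
    also have "\<dots> \<in> K v"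
      unfolding K_def by (intro convex_cone_hull_sum convex_cone_hull_mul hull_inc imageI less_imp_le[OF bV])
    finally show ?thesis .
  qed
  have pr_\<xi>_generic: "\<forall>f\<in>NE v \<union> coords (of_int_vec ` E v). f (pr v \<xi>) \<noteq> 0" if "v \<in> V" for v
  proof
    fix f assume "f \<in> NE v \<union> coords (of_int_vec ` E v)"
    then have "f \<circ> pr v \<in> M" using that unfolding M_def by blast
    then show "f (pr v \<xi>) \<noteq> 0" using b(2) by (auto simp: \<xi>_def)
  qed
  \<comment> \<open>Reciprocity is used with shift r v: the closed cone at r v belongs to t = k p +
    r, the open one at - r v to t = k p - r.\<close>
  have "\<forall>v\<in>V. \<exists>c. has_value l (\<lambda>m. of_bool (of_int_vec m - real r *\<^sub>R v \<in> K v)) c \<and>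
      has_value l (\<lambda>m. of_bool (\<exists>\<delta>>0. of_int_vec m + real r *\<^sub>R v - \<delta> *\<^sub>R pr v \<xi> \<in> K v))
        ((-1) powi aff_dim P * subst_inv_q c)" (is "\<forall>v\<in>V. \<exists>c. ?R v c")
  proof
    fix v assume v: "v \<in> V"
    show "\<exists>c. ?R v c"
      unfolding dimE[OF v] power_int_of_nat
      by (rule cone_reciprocity[OF finE l_E[OF v] disE[OF v] _ pr_\<xi>_generic[OF v],
            unfolded coneE[OF v], OF _ pr_\<xi>])
  qed
  from bchoice[OF this] obtain c where "\<forall>v\<in>V. ?R v (c v)" ..
  then have c: "has_value l (\<lambda>m. of_bool (of_int_vec m - real r *\<^sub>R v \<in> K v)) (c v)"
    "has_value l (\<lambda>m. of_bool (\<exists>\<delta>>0. of_int_vec m + real r *\<^sub>R v - \<delta> *\<^sub>R pr v \<xi> \<in> K v))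
      ((-1) powi aff_dim P * subst_inv_q (c v))" if "v \<in> V" for v
    using that by blast+
  \<comment> \<open>The vector k p v is integral, so translating by it multiplies the value by q^(k
    \<lambda>(p v)).\<close>
  have shift: "has_value l (\<lambda>m. of_bool (A (of_int_vec m - (real k * real p) *\<^sub>R v)))
      (qvar powi (int k * a v) * d)"
    if v: "v \<in> V" and val: "has_value l (\<lambda>m. of_bool (A (of_int_vec m))) d"
    for v k d and A :: "real ^ 'n \<Rightarrow> bool"
  proof -
    define y where "y = (\<chi> i. int k * z v $ i)"
    have "of_int_vec y = real k *\<^sub>R (real p *\<^sub>R v)"
      unfolding z[OF v] by (simp add: y_def of_int_vec_def vec_eq_iff)
    then have vec: "of_int_vec (m - y) = of_int_vec m - (real k * real p) *\<^sub>R v" for m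
      by (simp add: of_int_vec_diff)
    have "lin_form l y = int k * a v"
      by (simp add: y_def a_def lin_form_def sum_distrib_left mult_ac)
    then have "qweight l y = qvar powi (int k * a v)" by (simp add: qweight_def)
    then show ?thesis using has_value_shift[OF val, of y] by (simp only: vec)
  qed
  have vert: "u \<notin> convex_cone hull (U - {u})" if uU: "u \<in> U" for u
  proof
    assume u: "u \<in> convex_cone hull (U - {u})"
    obtain v where v: "v \<in> V" "u = (v, 1)" using uU by (auto simp: U_def)
    have "U - {u} = homogenize ` (V - {v})" by (auto simp: U_def v(2))
    with u have mem: "(v, 1) \<in> convex_cone hull (homogenize ` (V - {v}))" by (simp add: v(2))
    have "V - {v} \<noteq> {}"
    proof
      assume "V - {v} = {}"
      with mem show False unfolding \<open>V - {v} = {}\<close> by (simp add: zero_prod_def)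
    qed
    then have "v \<in> (*\<^sub>R) 1 ` (convex hull (V - {v}))"
      using mem fin by (simp add: mem_cone_over_dilate)
    then have "v \<in> convex hull (V - {v})" by auto
    then show False using extreme_point_notin_hull[OF ext[OF v(1)]] by blast
  qed
  have zU: "of_int_vec ((z \<circ> fst) u) = real p *\<^sub>R fst u" if "u \<in> U" for u
    using that z by (auto simp: U_def)
  have sumU: "(\<Sum>u\<in>U. f u) = (\<Sum>v\<in>V. f (v, 1))" for f :: "_ \<Rightarrow> ratfun"
    unfolding U_def by (subst sum.reindex) (auto simp: inj_on_def)
  \<comment> \<open>The coordinates of \<xi> sum to its height, which is positive; this covers the
    case of height 0 in Brion's formula.\<close>
  have coord_pos: "\<exists>b\<in>B. 0 \<le> coord B b \<xi>" if B: "B \<in> bases U" for B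
  proof (rule ccontr)
    assume neg: "\<not> (\<exists>b\<in>B. 0 \<le> coord B b \<xi>)"
    note BB = basesD[OF B]
    have "\<xi> \<in> span B" using \<xi>_cone convex_cone_hull_subset_span BB(3) by auto
    then have "snd \<xi> = snd (\<Sum>b\<in>B. coord B b \<xi> *\<^sub>R b)"
      using sum_coord[OF BB(2) finite_basis[OF finU B]] by simp
    also have "\<dots> = (\<Sum>b\<in>B. coord B b \<xi>)"
      unfolding snd_sum using BB(1) snd_U by (intro sum.cong) auto
    also have "\<dots> \<le> 0" using neg by (intro sum_nonpos) (auto simp: not_le less_imp_le)
    finally have "(\<Sum>v\<in>V. b (v, 1)) \<le> 0" by (simp add: \<xi>_pair)
    moreover have "0 < (\<Sum>v\<in>V. b (v, 1))" using fin \<open>V \<noteq> {}\<close> bV by (intro sum_pos) auto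
    ultimately show False by simp
  qed
  note decomp = half_open_dissection[OF finU dis \<xi>_cone \<xi>_N]
  have bounded_P: "bounded P"
    unfolding P using fin by (simp add: finite_imp_bounded_convex_hull)
  have closed_ehr: "ehr P l (int (k * p + r)) = (\<Sum>v\<in>V. qvar powi (int k * a v) * c v)" for k
  proof (rule ehr_eq_vertex_sum[OF bounded_P])
    let ?t = "real_of_int (int (k * p + r))"
    let ?Q = "\<lambda>u m. of_int_vec m - ?t *\<^sub>R fst u \<in> K (fst u)"
    have "torsion (\<lambda>m. of_bool ((of_int_vec m, ?t) \<in> convex_cone hull U) - (\<Sum>u\<in>U. of_bool (?Q u m)))"
    proof (rule brion_torsion[where X = "\<lambda>y. y \<in> convex_cone hull U", OF finU snd_U vert p zU _ decomp(1)])
      show "0 < ?t \<or> (?t = 0 \<and> (\<forall>B\<in>bases U. \<exists>b\<in>B. 0 \<le> coord B b \<xi>))"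
        using coord_pos by (auto simp: less_le)
      show "eventually (\<lambda>s. ((of_int_vec m, ?t) + s *\<^sub>R u \<in> convex_cone hull U) = ?Q u m) at_top"
        if "u \<in> U" for u m
        using that cone_over_translate_vertex(1)[OF fin, of "fst u" "of_int_vec m" ?t]
        by (auto simp: U_def K_def)
    qed
    then show "torsion (\<lambda>m. of_bool (of_int_vec m \<in> (*\<^sub>R) ?t ` P)
        - (\<Sum>v\<in>V. of_bool (of_int_vec m - ?t *\<^sub>R v \<in> K v)))"
      unfolding sumU unfolding U_def mem_cone_over_dilate[OF fin \<open>V \<noteq> {}\<close>] P[symmetric] by simp
    show "has_value l (\<lambda>m. of_bool (of_int_vec m - ?t *\<^sub>R v \<in> K v)) (qvar powi (int k * a v) * c v)"
      if v: "v \<in> V" for v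
      using shift[OF v, of "\<lambda>x. x - real r *\<^sub>R v \<in> K v", OF c(1)[OF v], of k]
      by (simp add: scaleR_add_left diff_diff_eq)
  qed
  have open_ehr: "ehr (rel_interior P) l (int (k * p) - int r)
      = (-1) powi aff_dim P * (\<Sum>v\<in>V. qvar powi (int k * a v) * subst_inv_q (c v))"
    if k: "r < k * p" for k
  proof -
    let ?t = "real_of_int (int (k * p) - int r)"
    have "int r < int (k * p)" using k by (simp only: of_nat_less_iff)
    then have t: "0 < ?t" by (simp only: of_int_0_less_iff diff_gt_0_iff_gt)
    let ?X = "\<lambda>y. \<exists>\<delta>>0. y - \<delta> *\<^sub>R \<xi> \<in> convex_cone hull U"
    let ?Q = "\<lambda>u m. \<exists>\<delta>>0. of_int_vec m - ?t *\<^sub>R fst u - \<delta> *\<^sub>R pr (fst u) \<xi> \<in> K (fst u)"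
    have "ehr (rel_interior P) l (int (k * p) - int r)
      = (\<Sum>v\<in>V. qvar powi (int k * a v) * ((-1) powi aff_dim P * subst_inv_q (c v)))"
    proof (rule ehr_eq_vertex_sum)
      show "bounded (rel_interior P)" using bounded_P rel_interior_subset by (rule bounded_subset)
      have "torsion (\<lambda>m. of_bool (?X (of_int_vec m, ?t)) - (\<Sum>u\<in>U. of_bool (?Q u m)))"
      proof (rule brion_torsion[where X = ?X, OF finU snd_U vert p zU _ decomp(2)])
        show "0 < ?t \<or> (?t = 0 \<and> (\<forall>B\<in>bases U. \<exists>b\<in>B. 0 \<le> coord B b (- \<xi>)))" using t by blast
        show "eventually (\<lambda>s. ?X ((of_int_vec m, ?t) + s *\<^sub>R u) = ?Q u m) at_top" if "u \<in> U" for u m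
          using that cone_over_translate_vertex(2)[OF fin, of "fst u" "of_int_vec m" ?t \<xi>]
          by (auto simp: U_def K_def pr_def)
      qed
      moreover have "?X (x, ?t) \<longleftrightarrow> x \<in> (*\<^sub>R) ?t ` rel_interior P" for x
        using rel_interior_cone_over[OF fin \<open>V \<noteq> {}\<close> bV t, of "\<lambda>v. v"] unfolding U_def P[symmetric] \<xi>_pair by simp
      ultimately show "torsion (\<lambda>m. of_bool (of_int_vec m \<in> (*\<^sub>R) ?t ` rel_interior P)
        - (\<Sum>v\<in>V. of_bool (\<exists>\<delta>>0. of_int_vec m - ?t *\<^sub>R v - \<delta> *\<^sub>R pr v \<xi> \<in> K v)))"
        unfolding sumU by simp
      show "has_value l (\<lambda>m. of_bool (\<exists>\<delta>>0. of_int_vec m - ?t *\<^sub>R v - \<delta> *\<^sub>R pr v \<xi> \<in> K v))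
          (qvar powi (int k * a v) * ((-1) powi aff_dim P * subst_inv_q (c v)))"
        if v: "v \<in> V" for v
      proof -
        have "of_int_vec m - (real k * real p) *\<^sub>R v + real r *\<^sub>R v = of_int_vec m - ?t *\<^sub>R v" for m
          by (simp add: algebra_simps)
        then show ?thesis
          using shift[OF v, of "\<lambda>x. \<exists>\<delta>>0. x + real r *\<^sub>R v - \<delta> *\<^sub>R pr v \<xi> \<in> K v", OF c(2)[OF v], of k]
          by (simp only:)
      qed
    qed
    then show ?thesis by (simp add: sum_distrib_left mult_ac)
  qed
  show thesis
    using that[OF a_nonneg closed_ehr[unfolded p_def] open_ehr[unfolded p_def]] .
qed

theorem theorem1p13:
  fixes P :: "(real ^ 'n) set" and l :: "int ^ 'n" and p r k :: nat
  assumes "rational_polytope P"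
    and "p = denominator P"
    and "generic_form l P"
    and "positive_form l P"
    and "r < p"
    and "k > 0"
  shows "(-1) powi aff_dim P *
           poly (map_poly subst_inv_q (ehrhart_poly P l r)) (qint (1 / qvar) (- int k))
         = ehr (rel_interior P) l (int k * int p - int r)"
proof (cases "P = {}")
  case True
  then have "ehrhart_poly P l r = 0" by (intro ehrhart_poly_eqI) (simp add: ehr_def)
  with True show ?thesis by (simp add: ehr_def)
next
  case False
  obtain V :: "(real ^ 'n) set" and a c where a: "\<And>v. v \<in> V \<Longrightarrow> 0 \<le> a v"
    and closed_ehr: "\<And>k. ehr P l (int (k * denominator P + r)) = (\<Sum>v\<in>V. qvar powi (int k * a v) * c v)"
    and open_ehr: "\<And>k. r < k * denominator P \<Longrightarrow>
      ehr (rel_interior P) l (int (k * denominator P) - int r)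
      = (-1) powi aff_dim P * (\<Sum>v\<in>V. qvar powi (int k * a v) * subst_inv_q (c v))"
    using vertex_expansion[OF assms(1,3,4) False, of r] by blast
  \<comment> \<open>The linear factor is 1 + (q - 1) x; the conversion of the exponent by
    \<open>nat\<close> loses nothing because a v is nonnegative.\<close>
  define \<Phi> where "\<Phi> = (\<Sum>v\<in>V. smult (c v) ([:1, qvar - 1:] ^ nat (a v)))"
  have q1: "qvar - 1 \<noteq> 0" using qvar_power_int_neq_1[of 1] by simp
  \<comment> \<open>Valid for all integers j: nonnegative ones identify the polynomial, negative
    ones are needed for reciprocity.\<close>
  have \<Phi>_qint: "poly \<Phi> (qint qvar j) = (\<Sum>v\<in>V. qvar powi (j * a v) * c v)" for j
  proof -
    have "1 + qint qvar j * (qvar - 1) = qvar powi j" using q1 by (simp add: qint_def)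
    moreover have "(qvar powi j) ^ nat (a v) = qvar powi (j * a v)" if vV: "v \<in> V" for v
    proof -
      obtain n where "a v = int n" using a[OF vV] nonneg_int_cases by blast
      then show ?thesis by (simp add: power_int_mult)
    qed
    ultimately show ?thesis by (simp add: \<Phi>_def poly_sum poly_power mult.commute)
  qed
  have "ehrhart_poly P l r = \<Phi>"
    by (intro ehrhart_poly_eqI) (simp only: \<Phi>_qint closed_ehr)
  \<comment> \<open>The evaluation point is itself the image of [-k]_q under q \<mapsto> 1/q, so
    coefficients and argument are substituted simultaneously and the substitution can be pulled
    outside.\<close>
  moreover have "qint (1 / qvar) (- int k) = subst_inv_q (qint qvar (- int k))"
    by (simp add: qint_def subst_inv_q_divide subst_inv_q_diff subst_inv_q_power_int)
  ultimately have "poly (map_poly subst_inv_q (ehrhart_poly P l r)) (qint (1 / qvar) (- int k))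
      = subst_inv_q (\<Sum>v\<in>V. qvar powi (- int k * a v) * c v)"
    by (simp only: poly_map_subst_inv_q \<Phi>_qint)
  also have "\<dots> = (\<Sum>v\<in>V. qvar powi (int k * a v) * subst_inv_q (c v))"
    by (simp add: subst_inv_q_sum subst_inv_q_mult subst_inv_q_qvar_power_int)
  finally have "(-1) powi aff_dim P *
      poly (map_poly subst_inv_q (ehrhart_poly P l r)) (qint (1 / qvar) (- int k))
      = (-1) powi aff_dim P * (\<Sum>v\<in>V. qvar powi (int k * a v) * subst_inv_q (c v))" by simp
  also have "\<dots> = ehr (rel_interior P) l (int (k * denominator P) - int r)"
  proof (rule open_ehr[symmetric])
    \<comment> \<open>From k > 0 and r < p the height k p - r is positive, as the open expansion
      requires.\<close>
    have "1 * denominator P \<le> k * denominator P" using \<open>k > 0\<close> by (intro mult_le_mono1) simp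
    then show "r < k * denominator P" using assms(2,5) by linarith
  qed
  finally show ?thesis by (simp add: assms(2))
qed

end
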